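(* Let $D\subset\mathbb{R}^n$ be a disk of radius $R>0$ centered at the point $z_0$ and consider $f\in C^2(D,\mathbb{R})$ such that the equation $f=0$ is regular in $D$ and $Z(f)\subset\mathrm{int}(D)$. Let also $\tau=\tau(f,D)>0$ be such that $$e^{-3\tau}R=\max_{z\in Z(f)}\|z-z_0\|$$ and set $r=e^{-2\tau}R<R$. Denote by $D_r$ the disk with the same center as $D$ and with radius $r$, and define $$\tilde\kappa^{(\ell)}=\max\{\kappa^{(\ell)}(f,D),\ \kappa^{(\ell)}(f,D_r)\},\qquad \ell=1,2.$$ Then there exist an integer $d$ with $0\le d\leq\max\{1,\ \tilde\kappa^{(2)}\cdot 2a_2(D)\}$ and a polynomial $p\in\mathbb{R}[x_1,\ldots,x_n]$ with $$\deg(p)\leq\max\left\{1,\ \tilde\kappa^{(2)}\cdot 2a_2(D),\ \frac{\log\tilde\kappa^{(1)}+\log\frac1\tau+\log\left(8+\frac{8}{Re^{-\tau}}+4Re^{-\tau}+4\tau\right)+\log\left(c_1(n,d)\right)}{\tau}\right\}$$ such that $$(\mathbb{R}^n,Z(p))\sim(\mathbb{R}^n,Z(f)).$$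
   Context: Disks are closed Euclidean balls; $Z(\cdot)$ denotes the zero set. For a disk $D$, $\|f\|_{C^\ell(D,\mathbb{R})}=\sup_{z\in D}\left(\sum_{|\alpha|\le\ell}|\partial^\alpha f(z)|^2\right)^{1/2}$, $$\delta(f,D)=\min\left\{\inf_{z\in D}\left(|f(z)|^2+|\nabla f(z)|^2\right)^{1/2},\ \inf_{z\in\partial D}\left(|f(z)|^2+|\nabla(f|_{\partial D})(z)|^2\right)^{1/2}\right\},\qquad \kappa^{(\ell)}(f,D)=\frac{\|f\|_{C^\ell(D,\mathbb{R})}}{\delta(f,D)},$$ and similarly for $D_r$. The equation $f=0$ is regular in $D$ if $f$ has no critical point on $Z(f)$ (and likewise for $f|_{\partial D}$). Constants: $a_2(D)>0$ is the constant of the quantitative Weierstrass theorem: for every $g\in C^2(D,\mathbb{R})$ and every integer $d\ge0$ there is a polynomial $q$ of degree at most $d$ with $\|g-q\|_{C^\ell(D,\mathbb{R})}\le\frac{a_2(D)}{d^{2-\ell}}\|g\|_{C^2(D,\mathbb{R})}$ for every $\ell\le\min\{2,d\}$. The constant $c_1(n,d)>0$ depends only on $n,d$ and is such that for every $R>0$ and every polynomial $q\in\mathbb{R}[x_1,\dots,x_n]$ of degree $d$, with $B_R$ the disk of radius $R$ centered at the origin, $$|q(x)|\le c_1(n,d)\,\|q\|_{C^1(B_R,\mathbb{R})}\left(\frac{\|x\|}{R}\right)^d(1+R)\qquad\forall\,\|x\|\ge R.$$ $(\mathbb{R}^n,K_0)\sim(\mathbb{R}^n,K_1)$ means there is a continuous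 family of diffeomorphisms $\varphi_t:\mathbb{R}^n\to\mathbb{R}^n$, $t\in[0,1]$, with $\varphi_0=\mathrm{id}$ and $\varphi_1(K_0)=K_1$. *)

theory Defs
  imports "HOL-Analysis.Analysis" "HOL-Library.Poly_Mapping"
begin

section \<open>Differentiable functions on a closed disk\<close>

text \<open>
  Derivatives are taken within the disk \<open>D\<close>.  At interior points they are the ordinary
  derivatives; at boundary points they are still uniquely determined (a closed ball of positive
  radius is convex with nonempty interior) and are the continuous extensions of the
  derivatives from the interior.  Only the values of \<open>f\<close> on \<open>D\<close> matter at points of \<open>D\<close>.
\<close>

definition partial_deriv ::
    "(real^'n::finite) set \<Rightarrow> 'n \<Rightarrow> (real^'n \<Rightarrow> real) \<Rightarrow> real^'n \<Rightarrow> real" where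
  "partial_deriv D i f z = frechet_derivative f (at z within D) (axis i 1)"

definition grad :: "(real^'n::finite) set \<Rightarrow> (real^'n \<Rightarrow> real) \<Rightarrow> real^'n \<Rightarrow> real^'n" where
  "grad D f z = (\<chi> i. partial_deriv D i f z)"

primrec Ck_on :: "nat \<Rightarrow> (real^'n::finite) set \<Rightarrow> (real^'n \<Rightarrow> real) \<Rightarrow> bool" where
  "Ck_on 0 D f \<longleftrightarrow> continuous_on D f"
| "Ck_on (Suc k) D f \<longleftrightarrow> f differentiable_on D \<and> (\<forall>i. Ck_on k D (partial_deriv D i f))"

primrec iter_partial_deriv ::
    "(real^'n::finite) set \<Rightarrow> 'n list \<Rightarrow> (real^'n \<Rightarrow> real) \<Rightarrow> real^'n \<Rightarrow> real" where
  "iter_partial_deriv D [] f = f"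
| "iter_partial_deriv D (i # is) f = partial_deriv D i (iter_partial_deriv D is f)"

text \<open>
  For a multi-index \<open>\<alpha>\<close> differentiate \<open>\<alpha> i\<close> times in the direction \<open>i\<close>.  The order is left
  unspecified: it is immaterial for functions that are
  \<open>\<Sum>i. \<alpha> i\<close> times continuously differentiable.
\<close>

definition multi_partial_deriv ::
    "(real^'n::finite) set \<Rightarrow> ('n \<Rightarrow> nat) \<Rightarrow> (real^'n \<Rightarrow> real) \<Rightarrow> real^'n \<Rightarrow> real" where
  "multi_partial_deriv D \<alpha> f =
     iter_partial_deriv D (SOME is. \<forall>i. count_list is i = \<alpha> i) f"

definition C_norm :: "nat \<Rightarrow> (real^'n::finite) set \<Rightarrow> (real^'n \<Rightarrow> real) \<Rightarrow> real" where
  "C_norm l D f =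
     (SUP z\<in>D. sqrt (\<Sum>\<alpha> | (\<Sum>i\<in>UNIV. \<alpha> i) \<le> l. (multi_partial_deriv D \<alpha> f z)\<^sup>2))"

lemma finite_multi_indices: "finite {\<alpha> :: 'n::finite \<Rightarrow> nat. (\<Sum>i\<in>UNIV. \<alpha> i) \<le> l}"
proof (rule finite_subset)
  show "{\<alpha> :: 'n \<Rightarrow> nat. (\<Sum>i\<in>UNIV. \<alpha> i) \<le> l} \<subseteq> PiE UNIV (\<lambda>_. {..l})"
  proof (clarsimp simp: PiE_UNIV_domain)
    fix \<alpha> :: "'n \<Rightarrow> nat" and i
    assume "(\<Sum>i\<in>UNIV. \<alpha> i) \<le> l"
    moreover have "\<alpha> i \<le> (\<Sum>i\<in>UNIV. \<alpha> i)" by (rule member_le_sum) auto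
    ultimately show "\<alpha> i \<le> l" by simp
  qed
  show "finite (PiE (UNIV :: 'n set) (\<lambda>_. {..l}))" by (intro finite_PiE) auto
qed

lemma ex_multi_index_list: "\<exists>is. \<forall>i :: 'n::finite. count_list is i = \<alpha> i"
proof -
  obtain xs :: "'n list" where xs: "set xs = UNIV" "distinct xs"
    using finite_distinct_list[of "UNIV :: 'n set"] by auto
  have rep: "count_list (replicate m j) i = (if i = j then m else 0)" for m and i j :: 'n
    by (induction m) auto
  have count: "count_list (concat (map (\<lambda>j. replicate (\<alpha> j) j) ys)) i
      = (if i \<in> set ys then \<alpha> i else 0)" if "distinct ys" for ys and i :: 'n
    using that by (induction ys) (auto simp: rep)
  show ?thesis
    using count[OF xs(2)] xs(1) by auto
qed


section \<open>Condition number and regularity\<close>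

text \<open>
  The gradient of the restriction of \<open>f\<close> to the boundary sphere is the orthogonal projection of
  the gradient of \<open>f\<close> to the tangent space of the sphere, the hyperplane orthogonal to
  \<open>z - z0\<close>.  In dimension one this is zero.
\<close>

definition sphere_grad :: "real^'n::finite \<Rightarrow> real \<Rightarrow> (real^'n \<Rightarrow> real) \<Rightarrow> real^'n \<Rightarrow> real^'n" where
  "sphere_grad z0 R f z =
     (let v = grad (cball z0 R) f z; \<nu> = (1 / R) *\<^sub>R (z - z0) in v - (v \<bullet> \<nu>) *\<^sub>R \<nu>)"

lemma sphere_grad_tangent:
  assumes "R > 0" "z \<in> sphere z0 R"
  shows "sphere_grad z0 R f z \<bullet> (z - z0) = 0"
proof -
  have "(z - z0) \<bullet> (z - z0) = R\<^sup>2"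
    using assms by (simp add: dist_norm norm_minus_commute flip: power2_norm_eq_inner)
  then show ?thesis
    using assms(1) by (simp add: sphere_grad_def Let_def inner_diff_left power2_eq_square)
qed

lemma sphere_grad_inner:
  assumes "w \<bullet> (z - z0) = 0"
  shows "sphere_grad z0 R f z \<bullet> w = grad (cball z0 R) f z \<bullet> w"
proof -
  have "(z - z0) \<bullet> w = 0" using assms by (simp add: inner_commute)
  then show ?thesis by (simp add: sphere_grad_def Let_def inner_diff_left)
qed

definition delta :: "(real^'n::finite \<Rightarrow> real) \<Rightarrow> real^'n \<Rightarrow> real \<Rightarrow> real" where
  "delta f z0 R =
     min (INF z\<in>cball z0 R. sqrt ((f z)\<^sup>2 + (norm (grad (cball z0 R) f z))\<^sup>2))
         (INF z\<in>sphere z0 R. sqrt ((f z)\<^sup>2 + (norm (sphere_grad z0 R f z))\<^sup>2))"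

text \<open>
  When \<open>delta\<close> vanishes the condition number is infinite, whereas the quotient below is zero.
  For an equation that is regular in the disk \<open>delta\<close> is positive.
\<close>

definition cond_number :: "nat \<Rightarrow> (real^'n::finite \<Rightarrow> real) \<Rightarrow> real^'n \<Rightarrow> real \<Rightarrow> real" where
  "cond_number l f z0 R = C_norm l (cball z0 R) f / delta f z0 R"

definition regular_equation :: "(real^'n::finite \<Rightarrow> real) \<Rightarrow> real^'n \<Rightarrow> real \<Rightarrow> bool" where
  "regular_equation f z0 R \<longleftrightarrow>
     (\<forall>z\<in>cball z0 R. f z = 0 \<longrightarrow> grad (cball z0 R) f z \<noteq> 0) \<and>
     (\<forall>z\<in>sphere z0 R. f z = 0 \<longrightarrow> sphere_grad z0 R f z \<noteq> 0)"


section \<open>Polynomials in several variables\<close>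

type_synonym 'n real_mpoly = "('n \<Rightarrow>\<^sub>0 nat) \<Rightarrow>\<^sub>0 real"

definition mpoly_eval :: "'n::finite real_mpoly \<Rightarrow> real^'n \<Rightarrow> real" where
  "mpoly_eval p x =
     (\<Sum>m\<in>Poly_Mapping.keys p. Poly_Mapping.lookup p m * (\<Prod>i\<in>UNIV. x $ i ^ Poly_Mapping.lookup m i))"

text \<open>The zero polynomial is given degree zero.\<close>

definition mpoly_degree :: "'n::finite real_mpoly \<Rightarrow> nat" where
  "mpoly_degree p =
     Max (insert 0 ((\<lambda>m. \<Sum>i\<in>UNIV. Poly_Mapping.lookup m i) ` Poly_Mapping.keys p))"

text \<open>
  The estimate \<open>C_norm l D (g - q) \<le> a / d ^ (2 - l) * C_norm 2 D g\<close> is stated without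
  division, so that it is void (and not false) for \<open>d = 0\<close>.
\<close>

definition weierstrass_constant :: "(real^'n::finite) set \<Rightarrow> real \<Rightarrow> bool" where
  "weierstrass_constant D a \<longleftrightarrow> a > 0 \<and>
     (\<forall>g. Ck_on 2 D g \<longrightarrow>
       (\<forall>d::nat. \<exists>q. mpoly_degree q \<le> d \<and>
         (\<forall>l \<le> min 2 d.
            real d ^ (2 - l) * C_norm l D (\<lambda>z. g z - mpoly_eval q z) \<le> a * C_norm 2 D g)))"

definition growth_constant :: "'n::finite itself \<Rightarrow> nat \<Rightarrow> real \<Rightarrow> bool" where
  "growth_constant _ d c \<longleftrightarrow> c > 0 \<and>
     (\<forall>R>0. \<forall>q :: 'n real_mpoly. mpoly_degree q = d \<longrightarrow>
       (\<forall>x. norm x \<ge> R \<longrightarrow>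
         \<bar>mpoly_eval q x\<bar> \<le> c * C_norm 1 (cball 0 R) (mpoly_eval q) * (norm x / R) ^ d * (1 + R)))"


section \<open>Ambient diffeotopy of subsets\<close>

definition C1_map :: "(real^'n::finite \<Rightarrow> real^'n) \<Rightarrow> bool" where
  "C1_map g \<longleftrightarrow> (\<exists>g' :: real^'n \<Rightarrow> ((real^'n) \<Rightarrow>\<^sub>L (real^'n)).
     (\<forall>x. (g has_derivative blinfun_apply (g' x)) (at x)) \<and> continuous_on UNIV g')"

definition diffeomorphism :: "(real^'n::finite \<Rightarrow> real^'n) \<Rightarrow> bool" where
  "diffeomorphism g \<longleftrightarrow> bij g \<and> C1_map g \<and> C1_map (inv g)"

text \<open>
  Continuity of the family is that of a path in the group of \<open>C\<^sup>1\<close> diffeomorphisms with the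
  \<open>C\<^sup>1\<close> compact-open topology: both the map and its derivative are jointly continuous in
  \<open>t\<close> and \<open>x\<close>.  Diffeomorphisms are of class \<open>C\<^sup>1\<close>, since a zero set of a \<open>C\<^sup>2\<close> function
  is in general not the image of an algebraic hypersurface under a smooth diffeomorphism.
\<close>

definition continuous_family :: "(real \<Rightarrow> real^'n::finite \<Rightarrow> real^'n) \<Rightarrow> bool" where
  "continuous_family \<phi> \<longleftrightarrow>
     continuous_on ({0..1} \<times> UNIV) (\<lambda>(t, x). \<phi> t x) \<and>
     (\<exists>\<phi>' :: real \<Rightarrow> real^'n \<Rightarrow> ((real^'n) \<Rightarrow>\<^sub>L (real^'n)).
        (\<forall>t\<in>{0..1}. \<forall>x. (\<phi> t has_derivative blinfun_apply (\<phi>' t x)) (at x)) \<and>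
        continuous_on ({0..1} \<times> UNIV) (\<lambda>(t, x). \<phi>' t x))"

definition diffeotopic_sets :: "(real^'n::finite) set \<Rightarrow> (real^'n) set \<Rightarrow> bool" where
  "diffeotopic_sets K0 K1 \<longleftrightarrow>
     (\<exists>\<phi>. (\<forall>t\<in>{0..1}. diffeomorphism (\<phi> t)) \<and> continuous_family \<phi> \<and>
        \<phi> 0 = id \<and> \<phi> 1 ` K0 = K1)"

end

theory Submission
  imports Defs
begin

text \<open>
  By the quantitative Weierstrass theorem there is a polynomial \<open>q\<close> that is \<open>C\<^sup>1\<close>-close to
  \<open>f\<close> on the disk \<open>D\<close>, and \<open>p\<close> is the sum of \<open>q\<close> and a large even power of
  \<open>norm (x - z0) / R\<close>, with the sign of \<open>f\<close> near the boundary and a coefficient that makes it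
  dominate \<open>q\<close> outside \<open>D\<close>.  On the small disk where zeros can occur this power is smaller
  than \<open>delta f z0 R\<close>, hence no member of the linear homotopy from \<open>f\<close> to \<open>p\<close> has a
  critical zero and no zero comes near the boundary; this gives a diffeotopy of the zero sets,
  obtained without flows: nearby zero sets are matched by moving along a transverse field.
  Zeros stay in the disk of radius \<open>r\<close> because the uniform error of \<open>q\<close> is smaller than the
  \<open>C\<^sup>1\<close> error by a factor \<open>d\<close>, while \<open>delta f z0 r \<ge> delta f z0 R / \<kappa> 2\<close>.

  The degree of \<open>p\<close> must be even, so nothing may be lost in the rounding.  The room comes from
  using the growth estimate with the radius \<open>R\<close> instead of \<open>exp (- \<tau>) * R\<close>.
  This suffices unless the degree is \<open>4\<close>, where the zeros have to be located more precisely, or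
  smaller, where a quadratic \<open>q\<close> needs no correction.  In dimension one the even power may have
  the wrong sign, but there \<open>p\<close> is just the product of the linear factors of the zeros of \<open>f\<close>.
\<close>

section \<open>Diffeotopic sets\<close>

text \<open>Rounding to an even degree is the obstacle. With \<open>2 * k\<close> the largest even
  number below the degree bound \<open>M\<close>, only \<open>M < 2 * k + 2\<close> is known, so the
  coefficient of the power may be as large as a multiple of
  \<open>\<tau> * exp (\<tau> * (2 * k + 2))\<close>. On the disk of radius \<open>r\<close> the
  power, measured against \<open>R\<close>, is at most \<open>exp (- 4 * k * \<tau>)\<close>. The
  factors \<open>1 + R\<close> and \<open>1 + 2 * k / r\<close>, written in
  \<open>R * exp (- \<tau>)\<close>, each cost one more \<open>exp \<tau>\<close>. What is left is
  \<open>\<tau> * exp (- (2 * k - 4) * \<tau>)\<close>, bounded from \<open>2 * k = 6\<close> on.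
  The degree of \<open>q\<close> is rounded too, to the largest even
  \<open>d <= M2 = 2 * a2 * \<kappa> 2\<close>. For \<open>d >= 4\<close> this gives
  \<open>M2 / d < 3/2\<close>, so the \<open>C^1\<close> error stays below
  \<open>3/4 * \<delta>\<close> and a quarter of \<open>\<delta>\<close> remains for the power;
  hence the constants \<open>7/4\<close> and \<open>7\<close>. The uniform error has to beat
  \<open>\<delta> / \<kappa> 2\<close>, which is achieved through
  \<open>2 * \<kappa> 2 <= M2\<close>, that is \<open>a2 >= 1\<close>. A Weierstrass constant is
  only asked to be positive, so this bound is derived from functions that quadratics approximate
  badly.\<close>

lemma C1_map_id: "C1_map (\<lambda>x. x)"
  unfolding C1_map_def
  by (rule exI[of _ "\<lambda>_. id_blinfun"]) (auto intro!: derivative_eq_intros)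

lemma C1_map_compose:
  assumes "C1_map f" "C1_map g"
  shows "C1_map (f \<circ> g)"
proof -
  obtain f' where f': "\<And>x. (f has_derivative blinfun_apply (f' x)) (at x)" "continuous_on UNIV f'"
    using assms(1) unfolding C1_map_def by blast
  obtain g' where g': "\<And>x. (g has_derivative blinfun_apply (g' x)) (at x)" "continuous_on UNIV g'"
    using assms(2) unfolding C1_map_def by blast
  have g_cont: "continuous_on UNIV g"
    by (meson g'(1) has_derivative_continuous continuous_at_imp_continuous_on)
  show ?thesis
    unfolding C1_map_def
  proof (intro exI conjI allI)
    show "((f \<circ> g) has_derivative blinfun_apply (f' (g x) o\<^sub>L g' x)) (at x)" for x
      by (rule has_derivative_eq_rhs[OF diff_chain_at[OF g'(1) f'(1)]]) auto
    show "continuous_on UNIV (\<lambda>x. f' (g x) o\<^sub>L g' x)"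
      by (intro continuous_intros g'(2) continuous_on_compose2[OF f'(2) g_cont]) auto
  qed
qed

lemma diffeomorphism_id: "diffeomorphism id"
  unfolding diffeomorphism_def using C1_map_id by (simp add: id_def inv_unique_comp bij_id[unfolded id_def] inv_id[unfolded id_def])

lemma diffeomorphism_compose:
  assumes "diffeomorphism f" "diffeomorphism g"
  shows "diffeomorphism (f \<circ> g)"
  using assms unfolding diffeomorphism_def
  by (auto intro: bij_comp C1_map_compose simp: o_inv_distrib)

lemma diffeomorphism_inv:
  assumes "diffeomorphism f"
  shows "diffeomorphism (inv f)"
  using assms unfolding diffeomorphism_def
  by (auto intro: bij_imp_bij_inv simp: inv_inv_eq)

lemma continuous_family_const:
  assumes "diffeomorphism f"
  shows "continuous_family (\<lambda>t. f)"
proof -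
  obtain f' where f': "\<And>x. (f has_derivative blinfun_apply (f' x)) (at x)" "continuous_on UNIV f'"
    using assms unfolding diffeomorphism_def C1_map_def by blast
  have f_cont: "continuous_on UNIV f"
    by (meson f'(1) has_derivative_continuous continuous_at_imp_continuous_on)
  show ?thesis
    unfolding continuous_family_def case_prod_beta
    by (intro conjI exI[of _ "\<lambda>t. f'"] ballI allI f'(1)
        continuous_on_compose2[OF f_cont] continuous_on_compose2[OF f'(2)] continuous_intros) auto
qed

lemma continuous_family_compose:
  assumes "continuous_family \<phi>" "continuous_family \<psi>"
  shows "continuous_family (\<lambda>t. \<phi> t \<circ> \<psi> t)"
proof -
  obtain \<phi>' where \<phi>: "continuous_on ({0..1} \<times> UNIV) (\<lambda>(t, x). \<phi> t x)"
    "\<And>t x. t \<in> {0..1} \<Longrightarrow> (\<phi> t has_derivative blinfun_apply (\<phi>' t x)) (at x)"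
    "continuous_on ({0..1} \<times> UNIV) (\<lambda>(t, x). \<phi>' t x)"
    using assms(1) unfolding continuous_family_def by blast
  obtain \<psi>' where \<psi>: "continuous_on ({0..1} \<times> UNIV) (\<lambda>(t, x). \<psi> t x)"
    "\<And>t x. t \<in> {0..1} \<Longrightarrow> (\<psi> t has_derivative blinfun_apply (\<psi>' t x)) (at x)"
    "continuous_on ({0..1} \<times> UNIV) (\<lambda>(t, x). \<psi>' t x)"
    using assms(2) unfolding continuous_family_def by blast
  have inner: "continuous_on ({0..1} \<times> UNIV) (\<lambda>p. (fst p, \<psi> (fst p) (snd p)))"
    using \<psi>(1) by (intro continuous_intros) (simp add: case_prod_beta)
  show ?thesis
    unfolding continuous_family_def case_prod_beta
  proof (intro conjI exI[of _ "\<lambda>t x. \<phi>' t (\<psi> t x) o\<^sub>L \<psi>' t x"] ballI allI)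
    show "continuous_on ({0..1} \<times> UNIV) (\<lambda>p. (\<phi> (fst p) \<circ> \<psi> (fst p)) (snd p))"
      using continuous_on_compose2[OF \<phi>(1) inner] by (auto simp: case_prod_beta image_subset_iff)
    show "((\<phi> t \<circ> \<psi> t) has_derivative blinfun_apply (\<phi>' t (\<psi> t x) o\<^sub>L \<psi>' t x)) (at x)"
      if "t \<in> {0..1}" for t x
      by (rule has_derivative_eq_rhs[OF diff_chain_at[OF \<psi>(2)[OF that] \<phi>(2)[OF that]]]) auto
    show "continuous_on ({0..1} \<times> UNIV)
        (\<lambda>p. \<phi>' (fst p) (\<psi> (fst p) (snd p)) o\<^sub>L \<psi>' (fst p) (snd p))"
      using continuous_on_compose2[OF \<phi>(3) inner] \<psi>(3)
      by (intro continuous_intros) (auto simp: case_prod_beta image_subset_iff)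
  qed
qed

lemma continuous_family_reverse:
  assumes "continuous_family \<phi>"
  shows "continuous_family (\<lambda>t. \<phi> (1 - t))"
proof -
  obtain \<phi>' where \<phi>: "continuous_on ({0..1} \<times> UNIV) (\<lambda>(t, x). \<phi> t x)"
    "\<And>t x. t \<in> {0..1} \<Longrightarrow> (\<phi> t has_derivative blinfun_apply (\<phi>' t x)) (at x)"
    "continuous_on ({0..1} \<times> UNIV) (\<lambda>(t, x). \<phi>' t x)"
    using assms(1) unfolding continuous_family_def by blast
  have inner: "continuous_on ({0..1::real} \<times> UNIV) (\<lambda>p. (1 - fst p, snd p :: real^'a))"
    by (intro continuous_intros)
  show ?thesis
    unfolding continuous_family_def case_prod_beta
  proof (intro conjI exI[of _ "\<lambda>t. \<phi>' (1 - t)"] ballI allI)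
    show "continuous_on ({0..1} \<times> UNIV) (\<lambda>p. \<phi> (1 - fst p) (snd p))"
      using continuous_on_compose2[OF \<phi>(1) inner] by (auto simp: case_prod_beta image_subset_iff)
    show "(\<phi> (1 - t) has_derivative blinfun_apply (\<phi>' (1 - t) x)) (at x)"
      if "t \<in> {0..1}" for t x
      using \<phi>(2) that by simp
    show "continuous_on ({0..1} \<times> UNIV) (\<lambda>p. \<phi>' (1 - fst p) (snd p))"
      using continuous_on_compose2[OF \<phi>(3) inner] by (auto simp: case_prod_beta image_subset_iff)
  qed
qed

lemma diffeotopic_sets_refl: "diffeotopic_sets K K"
  unfolding diffeotopic_sets_def
  by (rule exI[of _ "\<lambda>t. id"]) (auto intro: diffeomorphism_id continuous_family_const)

lemma diffeotopic_sets_trans: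
  assumes "diffeotopic_sets K L" "diffeotopic_sets L M"
  shows "diffeotopic_sets K M"
proof -
  obtain \<psi> where \<psi>: "\<And>t. t \<in> {0..1} \<Longrightarrow> diffeomorphism (\<psi> t)" "continuous_family \<psi>"
      "\<psi> 0 = id" "\<psi> 1 ` K = L"
    using assms(1) unfolding diffeotopic_sets_def by blast
  obtain \<phi> where \<phi>: "\<And>t. t \<in> {0..1} \<Longrightarrow> diffeomorphism (\<phi> t)" "continuous_family \<phi>"
      "\<phi> 0 = id" "\<phi> 1 ` L = M"
    using assms(2) unfolding diffeotopic_sets_def by blast
  show ?thesis
    unfolding diffeotopic_sets_def
  proof (intro exI conjI ballI)
    show "diffeomorphism (\<phi> t \<circ> \<psi> t)" if "t \<in> {0..1}" for t
      using \<phi>(1) \<psi>(1) that by (intro diffeomorphism_compose)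
    show "(\<phi> 1 \<circ> \<psi> 1) ` K = M" using \<phi>(4) \<psi>(4) by (simp flip: image_image add: o_def)
  qed (use \<phi> \<psi> continuous_family_compose[OF \<phi>(2) \<psi>(2)] in auto)
qed

text \<open>The reversed path starts at \<open>\<phi> 1\<close>; composing on the right with the
  inverse of this map makes it start at \<open>id\<close> again.\<close>

lemma diffeotopic_sets_sym:
  assumes "diffeotopic_sets K L"
  shows "diffeotopic_sets L K"
proof -
  obtain \<phi> where \<phi>: "\<And>t. t \<in> {0..1} \<Longrightarrow> diffeomorphism (\<phi> t)" "continuous_family \<phi>"
      "\<phi> 0 = id" "\<phi> 1 ` K = L"
    using assms(1) unfolding diffeotopic_sets_def by blast
  have bij: "bij (\<phi> 1)" and inv: "diffeomorphism (inv (\<phi> 1))"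
    using \<phi>(1)[of 1] by (auto simp: diffeomorphism_inv) (simp add: diffeomorphism_def)
  show ?thesis
    unfolding diffeotopic_sets_def
  proof (intro exI conjI ballI)
    show "diffeomorphism (\<phi> (1 - t) \<circ> inv (\<phi> 1))" if "t \<in> {0..1}" for t
      using \<phi>(1) inv that by (intro diffeomorphism_compose) auto
    show "continuous_family (\<lambda>t. \<phi> (1 - t) \<circ> inv (\<phi> 1))"
      by (rule continuous_family_compose[OF continuous_family_reverse[OF \<phi>(2)] continuous_family_const[OF inv]])
    show "\<phi> (1 - 0) \<circ> inv (\<phi> 1) = id"
      using surj_iff[THEN iffD1, OF bij_is_surj, OF bij] by simp
    show "(\<phi> (1 - 1) \<circ> inv (\<phi> 1)) ` L = K"
      using \<phi>(3) bij unfolding \<phi>(4)[symmetric] by (simp add: bij_is_inj image_image)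
  qed
qed

text \<open>Since \<open>u\<close> is \<open>1/2\<close>-Lipschitz, \<open>g x = x + u x\<close>
  shrinks distances at most by the factor 2, which gives injectivity and a Lipschitz inverse.
  Surjectivity is Banach's fixed point theorem for \<open>y - u x\<close>. The same estimate for the
  linear maps makes the derivative invertible everywhere, so no local inverse function theorem is
  involved.\<close>

lemma diffeomorphism_id_plus_contraction:
  fixes u :: "real^'n::finite \<Rightarrow> real^'n"
  assumes u: "\<And>x. (u has_derivative blinfun_apply (u' x)) (at x)"
    and cont: "continuous_on UNIV u'"
    and small: "\<And>x. norm (u' x) \<le> 1/2"
  shows "diffeomorphism (\<lambda>x. x + u x)"
proof -
  define g where "g = (\<lambda>x. x + u x)"
  define g' where "g' = (\<lambda>x. id_blinfun + u' x)"
  have lip: "norm (u x - u y) \<le> 1/2 * norm (x - y)" for x y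
    by (rule differentiable_bound[of UNIV u "\<lambda>x. blinfun_apply (u' x)"])
      (use u small in \<open>auto simp: norm_blinfun.rep_eq\<close>)
  have g_der: "(g has_derivative blinfun_apply (g' x)) (at x)" for x
    unfolding g_def g'_def by (auto intro!: derivative_eq_intros u simp: blinfun.bilinear_simps)
  have g'_cont: "continuous_on UNIV g'"
    unfolding g'_def by (intro continuous_intros cont)
  have expand: "norm (x - y) \<le> 2 * norm (g x - g y)" for x y
  proof -
    have "norm (x - y) \<le> norm (g x - g y) + norm (u x - u y)"
      using norm_triangle_ineq4[of "g x - g y" "u x - u y"] by (simp add: g_def algebra_simps)
    then show ?thesis using lip[of x y] by simp
  qed
  have inj: "inj g"
  proof (rule injI)
    fix x y assume "g x = g y"
    then show "x = y" using expand[of x y] by simp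
  qed
  have surj: "surj g"
  proof -
    have "\<exists>x. g x = y" for y
    proof -
      have "\<exists>!x. y - u x = x"
        by (rule banach_fix_type[of "1/2"]) (use lip in \<open>auto simp: dist_norm norm_minus_commute\<close>)
      then show ?thesis unfolding g_def by (metis diff_add_cancel)
    qed
    then show ?thesis by (metis surjI)
  qed
  have bij: "bij g" using inj surj by (simp add: bij_def)
  have bij': "bij (blinfun_apply (g' x))" and expand': "norm h \<le> 2 * norm (g' x h)" for x h
  proof -
    have e: "norm h \<le> 2 * norm (g' x h)" for h
    proof -
      have "norm (u' x h) \<le> 1/2 * norm h"
        using norm_blinfun[of "u' x" h] small[of x] by (smt (verit) mult_right_mono norm_ge_zero)
      moreover have "norm h \<le> norm (g' x h) + norm (u' x h)"
        using norm_triangle_ineq4[of "g' x h" "u' x h"] by (simp add: g'_def blinfun.bilinear_simps)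
      ultimately show ?thesis by simp
    qed
    show "norm h \<le> 2 * norm (g' x h)" by (rule e)
    have "inj (blinfun_apply (g' x))"
      using e by (intro linear_injective_0[THEN iffD2] blinfun.bounded_linear_right[THEN bounded_linear.linear])
       (metis norm_le_zero_iff mult_zero_right norm_zero)
    then show "bij (blinfun_apply (g' x))"
      by (simp add: bij_def linear_injective_imp_surjective blinfun.bounded_linear_right bounded_linear.linear)
  qed
  define k where "k = inv g"
  define k' where "k' = (\<lambda>y. Blinfun (inv (blinfun_apply (g' (k y)))))"
  have k: "g (k y) = y" "k (g x) = x" for x y
    using surj inj by (auto simp: k_def surj_f_inv_f)
  have bl: "bounded_linear (inv (blinfun_apply (g' x)))" for x
  proof -
    have "linear (blinfun_apply (g' x))"
      by (simp add: blinfun.bounded_linear_right bounded_linear.linear)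
    then show ?thesis
      using bij'[of x] inj_linear_imp_inv_linear linear_conv_bounded_linear bij_is_inj by blast
  qed
  have k'_app: "blinfun_apply (k' y) = inv (blinfun_apply (g' (k y)))" for y
    unfolding k'_def by (simp add: bounded_linear_Blinfun_apply bl)
  have k'_left: "k' y (g' (k y) h) = h" and k'_right: "g' (k y) (k' y h) = h" for y h
    using bij' by (auto simp: k'_app bij_is_inj bij_is_surj surj_f_inv_f)
  have k_lip: "norm (k x - k y) \<le> 2 * norm (x - y)" for x y
    using expand[of "k x" "k y"] by (simp add: k)
  have k_cont: "continuous_on UNIV k"
    by (rule lipschitz_on_continuous_on[of 2])
      (use k_lip in \<open>auto simp: lipschitz_on_def dist_norm\<close>)
  have k_der: "(k has_derivative blinfun_apply (k' y)) (at y)" for y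
  proof (rule has_derivative_inverse_basic[of g "g' (k y)" k y _ UNIV])
    show "(g has_derivative blinfun_apply (g' (k y))) (at (k y))" by (rule g_der)
    show "bounded_linear (blinfun_apply (k' y))" by (rule blinfun.bounded_linear_right)
    show "blinfun_apply (k' y) \<circ> blinfun_apply (g' (k y)) = id" by (auto simp: k'_left)
    show "continuous (at y) k" using k_cont by (simp add: continuous_on_eq_continuous_at)
  qed (auto simp: k)
  have k'_norm: "norm (k' y h) \<le> 2 * norm h" for y h
    using expand'[of "k' y h" "k y"] by (simp add: k'_right)
  \<comment> \<open>Resolvent identity: the difference of the inverses of \<open>A\<close> and
    \<open>B\<close> is the inverse of \<open>A\<close> times \<open>B - A\<close> times the inverse
    of \<open>B\<close>, and both inverses have norm at most 2.\<close>
  have k'_diff: "norm (k' x - k' y) \<le> 4 * norm (g' (k x) - g' (k y))" for x y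
  proof (rule norm_blinfun_bound)
    fix h
    have "(k' x - k' y) h = k' x ((g' (k y) - g' (k x)) (k' y h))"
      by (simp add: blinfun.bilinear_simps k'_left k'_right)
    also have "norm \<dots> \<le> 2 * (norm (g' (k y) - g' (k x)) * (2 * norm h))"
      by (intro order_trans[OF k'_norm] mult_left_mono order_trans[OF norm_blinfun] k'_norm) auto
    finally show "norm ((k' x - k' y) h) \<le> 4 * norm (g' (k x) - g' (k y)) * norm h"
      by (simp add: norm_minus_commute)
  qed simp
  have gk_cont: "continuous_on UNIV (\<lambda>y. g' (k y))"
    by (rule continuous_on_compose2[OF g'_cont k_cont]) auto
  have k'_cont: "continuous_on UNIV k'"
    unfolding continuous_on_iff
  proof (intro ballI allI impI)
    fix x :: "real^'n" and e :: real assume "e > 0"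
    then obtain d where d: "d > 0" "\<And>x'. dist x' x < d \<Longrightarrow> dist (g' (k x')) (g' (k x)) < e / 4"
      using gk_cont unfolding continuous_on_iff by (metis UNIV_I divide_pos_pos zero_less_numeral)
    have "dist (k' x') (k' x) < e" if "dist x' x < d" for x'
      using d(2)[OF that] k'_diff[of x' x] by (simp add: dist_norm)
    then show "\<exists>d>0. \<forall>x'\<in>UNIV. dist x' x < d \<longrightarrow> dist (k' x') (k' x) < e"
      using d(1) by blast
  qed
  have "diffeomorphism g"
    unfolding diffeomorphism_def C1_map_def k_def[symmetric]
    using bij g_der g'_cont k_der k'_cont by blast
  then show ?thesis by (simp add: g_def)
qed

text \<open>The straight path works: for \<open>t\<close> in the unit interval the field
  \<open>t *\<^sub>R u x\<close> satisfies the same smallness condition.\<close>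

lemma diffeotopic_sets_id_plus_contraction:
  fixes u :: "real^'n::finite \<Rightarrow> real^'n"
  assumes u: "\<And>x. (u has_derivative blinfun_apply (u' x)) (at x)"
    and cont: "continuous_on UNIV u'"
    and small: "\<And>x. norm (u' x) \<le> 1/2"
  shows "diffeotopic_sets K ((\<lambda>x. x + u x) ` K)"
  unfolding diffeotopic_sets_def
proof (intro exI conjI ballI)
  fix t :: real assume t: "t \<in> {0..1}"
  show "diffeomorphism (\<lambda>x. x + t *\<^sub>R u x)"
  proof (rule diffeomorphism_id_plus_contraction)
    show "((\<lambda>x. t *\<^sub>R u x) has_derivative blinfun_apply (t *\<^sub>R u' x)) (at x)" for x
      by (auto intro!: derivative_eq_intros u simp: blinfun.bilinear_simps)
    show "continuous_on UNIV (\<lambda>x. t *\<^sub>R u' x)" by (intro continuous_intros cont)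
    show "norm (t *\<^sub>R u' x) \<le> 1/2" for x
      using t small[of x] mult_mono[of "\<bar>t\<bar>" 1 "norm (u' x)" "1/2"] by simp
  qed
next
  have u_cont: "continuous_on UNIV u"
    by (meson u has_derivative_continuous continuous_at_imp_continuous_on)
  show "continuous_family (\<lambda>t x. x + t *\<^sub>R u x)"
    unfolding continuous_family_def case_prod_beta
  proof (intro conjI exI[of _ "\<lambda>t x. id_blinfun + t *\<^sub>R u' x"] ballI allI)
    show "continuous_on ({0..1} \<times> UNIV) (\<lambda>p. snd p + fst p *\<^sub>R u (snd p))"
      by (intro continuous_intros continuous_on_compose2[OF u_cont]) auto
    show "continuous_on ({0..1} \<times> UNIV) (\<lambda>p. id_blinfun + fst p *\<^sub>R u' (snd p))"
      by (intro continuous_intros continuous_on_compose2[OF cont]) auto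
    show "((\<lambda>x. x + t *\<^sub>R u x) has_derivative blinfun_apply (id_blinfun + t *\<^sub>R u' x)) (at x)" for t x
      by (auto intro!: derivative_eq_intros u simp: blinfun.bilinear_simps)
  qed
qed auto

section \<open>Implicit functions and polynomial maps\<close>

text \<open>The differentiability half of the implicit function theorem: a continuous solution
  \<open>\<sigma>\<close> is given, so \<open>H\<close> has to be differentiable at one point only.
  The remainder \<open>r\<close> of \<open>\<sigma>\<close> satisfies \<open>H' = a * r\<close> on
  the increment, while the increment itself is bounded in terms of \<open>r\<close>; for small
  errors \<open>r\<close> can be absorbed.\<close>

lemma has_derivative_implicit_real:
  fixes H :: "'a::real_normed_vector \<times> real \<Rightarrow> real"
  assumes H: "(H has_derivative H') (at (x0, \<sigma> x0))"
    and a: "H' (0, 1) \<noteq> 0"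
    and cont: "continuous (at x0) \<sigma>"
    and zero: "eventually (\<lambda>x. H (x, \<sigma> x) = 0) (nhds x0)"
  shows "(\<sigma> has_derivative (\<lambda>h. - H' (h, 0) / H' (0, 1))) (at x0)"
proof -
  interpret H': bounded_linear H' using H by (rule has_derivative_bounded_linear)
  define a where "a = H' (0, 1)"
  define L where "L = (\<lambda>h. - H' (h, 0) / a)"
  have a0: "\<bar>a\<bar> > 0" using a by (simp add: a_def)
  have "bounded_linear (\<lambda>h. H' (h, 0))"
    by (rule bounded_linear_compose[OF H'.bounded_linear_axioms])
       (intro bounded_linear_Pair bounded_linear_ident bounded_linear_zero)
  then have L: "bounded_linear L"
    unfolding L_def by (simp add: bounded_linear_minus bounded_linear_divide[THEN bounded_linear_compose])
  then interpret L: bounded_linear L .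
  obtain K where K: "K > 0" "\<And>h. norm (L h) \<le> norm h * K"
    using L.pos_bounded by blast
  have split: "H' (h, t) = a * (t - L h)" for h t
  proof -
    have "H' (h, t) = H' ((h, 0) + t *\<^sub>R (0, 1))" by simp
    also have "\<dots> = H' (h, 0) + t * a" by (simp only: H'.add H'.scaleR a_def real_scaleR_def)
    finally show ?thesis using a0 by (simp add: L_def field_simps)
  qed
  have H0: "H (x0, \<sigma> x0) = 0" using zero by (rule eventually_nhds_x_imp_x)
  show ?thesis
    unfolding a_def[symmetric] L_def[symmetric] has_derivative_at_alt
  proof (intro conjI allI impI L)
    fix e :: real assume e: "e > 0"
    \<comment> \<open>The first bound moves the \<open>r\<close> on the right to the left at the
      cost of half of \<open>a\<close>; the second makes what remains at most
      \<open>e * norm (y - x0)\<close>.\<close>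
    define e1 where "e1 = min (\<bar>a\<bar> / 2) (e * \<bar>a\<bar> / (2 * (1 + K)))"
    have e1: "e1 > 0" "e1 \<le> \<bar>a\<bar> / 2" "e1 * (1 + K) \<le> e * \<bar>a\<bar> / 2"
    proof -
      have "e1 * (1 + K) \<le> e * \<bar>a\<bar> / (2 * (1 + K)) * (1 + K)"
        using K(1) by (intro mult_right_mono) (auto simp: e1_def)
      also have "\<dots> = e * \<bar>a\<bar> / 2" using K(1) by (simp add: field_simps)
      finally show "e1 * (1 + K) \<le> e * \<bar>a\<bar> / 2" .
      show "e1 \<le> \<bar>a\<bar> / 2" unfolding e1_def by (rule min.cobounded1)
      show "e1 > 0" using e a0 K(1) by (simp add: e1_def)
    qed
    obtain d1 where d1: "d1 > 0"
      "\<And>p. norm (p - (x0, \<sigma> x0)) < d1 \<Longrightarrow>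
         norm (H p - H (x0, \<sigma> x0) - H' (p - (x0, \<sigma> x0))) \<le> e1 * norm (p - (x0, \<sigma> x0))"
      using H e1(1) unfolding has_derivative_at_alt by blast
    obtain d2 where d2: "d2 > 0" "\<And>x. dist x x0 < d2 \<Longrightarrow> H (x, \<sigma> x) = 0"
      using zero unfolding eventually_nhds_metric by blast
    obtain d3 where d3: "d3 > 0" "\<And>x. dist x x0 < d3 \<Longrightarrow> dist (\<sigma> x) (\<sigma> x0) < d1 / 2"
      using cont d1(1) unfolding continuous_at_eps_delta dist_norm by (metis half_gt_zero)
    show "\<exists>d>0. \<forall>y. norm (y - x0) < d \<longrightarrow> norm (\<sigma> y - \<sigma> x0 - L (y - x0)) \<le> e * norm (y - x0)"
    proof (intro exI[of _ "min (d1 / 2) (min d2 d3)"] conjI allI impI)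
      fix y assume y: "norm (y - x0) < min (d1 / 2) (min d2 d3)"
      define r where "r = \<sigma> y - \<sigma> x0 - L (y - x0)"
      let ?p = "(y, \<sigma> y) - (x0, \<sigma> x0)"
      have np: "norm ?p \<le> norm (y - x0) + \<bar>\<sigma> y - \<sigma> x0\<bar>"
        using norm_Pair_le[of "y - x0" "\<sigma> y - \<sigma> x0"] by simp
      have "\<bar>\<sigma> y - \<sigma> x0\<bar> < d1 / 2" using d3(2)[of y] y by (simp add: dist_norm)
      then have "norm ?p < d1" using np y by simp
      from d1(2)[OF this] have "norm (H' ?p) \<le> e1 * norm ?p"
        using d2(2)[of y] y H0 by (simp add: dist_norm)
      moreover have "H' ?p = a * r" using split[of "y - x0" "\<sigma> y - \<sigma> x0"] by (simp add: r_def)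
      ultimately have "\<bar>a\<bar> * \<bar>r\<bar> \<le> e1 * norm ?p" by (simp add: abs_mult)
      also have "\<dots> \<le> e1 * (norm (y - x0) + \<bar>\<sigma> y - \<sigma> x0\<bar>)"
        using np e1(1) by (intro mult_left_mono) auto
      also have "\<bar>\<sigma> y - \<sigma> x0\<bar> \<le> \<bar>r\<bar> + K * norm (y - x0)"
        using K(2)[of "y - x0"] by (simp add: r_def mult.commute)
      finally have "\<bar>a\<bar> * \<bar>r\<bar> \<le> e1 * (1 + K) * norm (y - x0) + e1 * \<bar>r\<bar>"
        using e1(1) by (simp add: algebra_simps)
      also have "\<dots> \<le> e * \<bar>a\<bar> / 2 * norm (y - x0) + \<bar>a\<bar> / 2 * \<bar>r\<bar>"
        using e1 by (intro add_mono mult_right_mono) auto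
      finally have "\<bar>a\<bar> * \<bar>r\<bar> \<le> \<bar>a\<bar> * (e * norm (y - x0))" by (simp add: algebra_simps)
      then show "norm (\<sigma> y - \<sigma> x0 - L (y - x0)) \<le> e * norm (y - x0)"
        using a0 by (simp add: r_def)
    qed (use d1 d2 d3 in auto)
  qed
qed

lemma linear_eq_inner_axis:
  fixes A :: "real^'n::finite \<Rightarrow> real"
  assumes "linear A"
  shows "A h = h \<bullet> (\<chi> i. A (axis i 1))"
proof -
  interpret linear A by fact
  have "A h = A (\<Sum>i\<in>UNIV. h $ i *\<^sub>R axis i 1)"
    by (simp add: basis_expansion flip: scalar_mult_eq_scaleR)
  also have "\<dots> = (\<Sum>i\<in>UNIV. h $ i * A (axis i 1))" by (simp add: sum scale)
  finally show ?thesis by (simp add: inner_vec_def)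
qed

text \<open>That the gradient is again polynomial is what permits induction: polynomials are of
  every class \<open>Ck_on\<close>.\<close>

lemma real_polynomial_function_gradient:
  fixes p :: "real^'n::finite \<Rightarrow> real"
  assumes "real_polynomial_function p"
  shows "\<exists>G. (\<forall>x. GDERIV p x :> G x) \<and> (\<forall>i. real_polynomial_function (\<lambda>x. G x $ i))"
  using assms
proof induction
  case (linear f)
  have "f h = h \<bullet> (\<chi> i. f (axis i 1))" for h
    by (rule linear_eq_inner_axis[OF bounded_linear.linear[OF linear.hyps]])
  then have "f = (\<lambda>h. h \<bullet> (\<chi> i. f (axis i 1)))" by blast
  then have "(f has_derivative (\<lambda>h. h \<bullet> (\<chi> i. f (axis i 1)))) (at x)" for x
    using bounded_linear_imp_has_derivative[OF linear.hyps] by simp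
  then show ?case
    by (intro exI[of _ "\<lambda>_. \<chi> i. f (axis i 1)"]) (simp add: gderiv_def real_polynomial_function.intros(2))
next
  case (const c)
  show ?case by (intro exI[of _ "\<lambda>_. 0"]) (simp add: GDERIV_const real_polynomial_function.intros(2))
next
  case (add f g)
  then obtain F G where "\<And>x. GDERIV f x :> F x" "\<And>i. real_polynomial_function (\<lambda>x. F x $ i)"
    "\<And>x. GDERIV g x :> G x" "\<And>i. real_polynomial_function (\<lambda>x. G x $ i)" by blast
  then show ?case
    by (intro exI[of _ "\<lambda>x. F x + G x"] conjI allI)
      (simp_all add: GDERIV_add real_polynomial_function.intros(3))
next
  case (mult f g)
  then obtain F G where "\<And>x. GDERIV f x :> F x" "\<And>i. real_polynomial_function (\<lambda>x. F x $ i)"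
    "\<And>x. GDERIV g x :> G x" "\<And>i. real_polynomial_function (\<lambda>x. G x $ i)" by blast
  then show ?case using mult.hyps
    by (intro exI[of _ "\<lambda>x. f x *\<^sub>R G x + g x *\<^sub>R F x"] conjI allI)
      (simp_all add: GDERIV_mult real_polynomial_function.intros(3) real_polynomial_function.intros(4))
qed

lemma continuous_on_real_polynomial_function:
  "real_polynomial_function p \<Longrightarrow> continuous_on S p"
  by (simp add: continuous_at_imp_continuous_on continuous_real_polymonial_function)

lemma polynomial_function_C1_map:
  fixes N :: "real^'n::finite \<Rightarrow> real^'n"
  assumes "polynomial_function N"
  shows "C1_map N"
proof -
  have "real_polynomial_function (\<lambda>x. N x $ i)" for i
    using assms bounded_linear_vec_nth[of i] unfolding polynomial_function_def by (auto simp: o_def)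
  then have "\<forall>i. \<exists>G. (\<forall>x. GDERIV (\<lambda>x. N x $ i) x :> G x) \<and>
      (\<forall>j. real_polynomial_function (\<lambda>x. G x $ j))"
    by (intro allI real_polynomial_function_gradient)
  from choice[OF this] obtain G where G: "\<And>i x. GDERIV (\<lambda>x. N x $ i) x :> G i x"
      "\<And>i j. real_polynomial_function (\<lambda>x. G i x $ j)"
    by blast
  define A where "A = (\<lambda>x h. \<chi> i. h \<bullet> G i x)"
  have A: "bounded_linear (A x)" for x
    unfolding A_def by (intro linear_conv_bounded_linear[THEN iffD1] linearI)
      (auto simp: vec_eq_iff inner_add_left)
  have app: "blinfun_apply (Blinfun (A x)) = A x" for x
    by (simp add: bounded_linear_Blinfun_apply A)
  show ?thesis
    unfolding C1_map_def
  proof (intro exI[of _ "\<lambda>x. Blinfun (A x)"] conjI allI)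
    show "(N has_derivative blinfun_apply (Blinfun (A x))) (at x)" for x
      unfolding app
    proof (subst has_derivative_componentwise_within, safe)
      fix b :: "real^'n" assume "b \<in> Basis"
      then obtain i where b: "b = axis i 1" by (auto simp: Basis_vec_def)
      show "((\<lambda>x. N x \<bullet> b) has_derivative (\<lambda>h. A x h \<bullet> b)) (at x)"
        using G(1)[of i x] by (simp add: b A_def inner_axis gderiv_def)
    qed
    have "continuous_on UNIV (\<lambda>x. A x b)" for b
      unfolding A_def inner_vec_def
      by (intro continuous_intros continuous_on_vec_lambda continuous_on_real_polynomial_function G)
    then show "continuous_on UNIV (\<lambda>x. Blinfun (A x))"
      by (intro continuous_on_blinfun_componentwise) (simp add: app)
  qed
qed

section \<open>Zero sets along a linear homotopy\<close>

lemma GDERIV_along_line: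
  assumes "GDERIV k (x + s *\<^sub>R v) :> G"
  shows "((\<lambda>s. k (x + s *\<^sub>R v)) has_real_derivative (v \<bullet> G)) (at s)"
proof -
  have "((\<lambda>s. x + s *\<^sub>R v) has_derivative (\<lambda>h. h *\<^sub>R v)) (at s)"
    by (auto intro!: derivative_eq_intros)
  from has_derivative_compose[OF this, of k "\<lambda>h. h \<bullet> G"] assms
  show ?thesis
    unfolding has_field_derivative_def
    by (auto simp: gderiv_def mult.commute[of "v \<bullet> G"] elim!: has_derivative_eq_rhs)
qed

lemma GDERIV_isCont: "GDERIV f x :> G \<Longrightarrow> isCont f x"
  unfolding gderiv_def by (rule has_derivative_continuous)

lemma compact_imp_norm_bound:
  fixes f :: "'a::topological_space \<Rightarrow> 'b::real_normed_vector"
  assumes "compact S" "continuous_on S f"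
  shows "\<exists>B. \<forall>x\<in>S. norm (f x) \<le> B"
  using compact_imp_bounded[OF compact_continuous_image[OF assms(2,1)]]
  unfolding bounded_iff by auto

text \<open>
  The diffeomorphism pushes \<open>x\<close> along the transverse field \<open>N\<close> to the point \<open>x + \<sigma> x *\<^sub>R N x\<close>
  at which \<open>k\<close> takes the value \<open>g x\<close>.
\<close>

lemma diffeotopic_zero_sets_of_close:
  fixes g :: "real^'n::finite \<Rightarrow> real"
  assumes g: "\<And>x. x \<in> cball z0 s2 \<Longrightarrow> GDERIV g x :> Gg x"
    and Gg: "continuous_on (cball z0 s2) Gg"
    and N: "C1_map N"
    and s: "s1 < s2" and \<eta>: "\<eta> > 0" and c: "c > 0"
    and near: "\<And>x. x \<in> cball z0 s2 \<Longrightarrow> \<bar>g x\<bar> < 3 * \<eta> \<Longrightarrow> dist z0 x < s1 \<and> N x \<bullet> Gg x > c"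
  shows "\<exists>\<epsilon>>0. \<forall>k Gk. (\<forall>x\<in>ball z0 s2. GDERIV k x :> Gk x) \<longrightarrow> continuous_on (ball z0 s2) Gk \<longrightarrow>
     (\<forall>x\<in>ball z0 s2. \<bar>k x - g x\<bar> < \<epsilon> \<and> norm (Gk x - Gg x) < \<epsilon>) \<longrightarrow>
     (\<forall>x\<in>ball z0 s2. \<bar>g x\<bar> \<ge> 2 * \<eta> \<longrightarrow> k x = g x) \<longrightarrow>
     diffeotopic_sets {x\<in>ball z0 s2. g x = 0} {x\<in>ball z0 s2. k x = 0}"
proof -
  obtain N' where N': "\<And>x. (N has_derivative blinfun_apply (N' x)) (at x)" "continuous_on UNIV N'"
    using N unfolding C1_map_def by blast
  have N_cont: "continuous_on S N" for S
    by (meson N'(1) has_derivative_continuous continuous_at_imp_continuous_on)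
  have g_cont: "continuous_on (cball z0 s2) g"
    using g by (meson GDERIV_isCont continuous_at_imp_continuous_on)
  obtain B1 B2 B3 where B123: "\<And>x. x \<in> cball z0 s2 \<Longrightarrow> norm (N x) \<le> B1"
      "\<And>x. x \<in> cball z0 s2 \<Longrightarrow> norm (N' x) \<le> B2" "\<And>x. x \<in> cball z0 s2 \<Longrightarrow> norm (Gg x) \<le> B3"
    using compact_imp_norm_bound[OF compact_cball N_cont] compact_imp_norm_bound[OF compact_cball Gg]
      compact_imp_norm_bound[OF compact_cball continuous_on_subset[OF N'(2) subset_UNIV]]
    by meson
  define B where "B = max 1 (max B1 (max B2 B3))"
  have B: "B \<ge> 1" "\<And>x. x \<in> cball z0 s2 \<Longrightarrow> norm (N x) \<le> B"
      "\<And>x. x \<in> cball z0 s2 \<Longrightarrow> norm (N' x) \<le> B" "\<And>x. x \<in> cball z0 s2 \<Longrightarrow> norm (Gg x) \<le> B"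
    using B123 unfolding B_def by (fastforce simp: le_max_iff_disj)+
  define \<theta> where "\<theta> = c / (16 * B)"
  have \<theta>: "\<theta> > 0" using B(1) c by (simp add: \<theta>_def)
  have "uniformly_continuous_on (cball z0 s2) Gg"
    using Gg by (rule compact_uniformly_continuous) simp
  then obtain d where d: "d > 0" "\<And>x y. x \<in> cball z0 s2 \<Longrightarrow> y \<in> cball z0 s2 \<Longrightarrow> dist y x < d
      \<Longrightarrow> dist (Gg y) (Gg x) < \<theta>"
    unfolding uniformly_continuous_on_def using \<theta> by metis
  \<comment> \<open>The largest displacement along \<open>N\<close>. The first two bounds keep the
    displaced point in the ball and \<open>Gg\<close> within \<open>\<theta>\<close> of its value at
    \<open>x\<close>. The other two, together with \<open>\<theta>\<close>, bound the two parts of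
    the derivative of the displacement by \<open>5/16\<close> and \<open>1/8\<close>, whose sum is
    below \<open>1/2\<close>.\<close>
  define T where "T = Min {(s2 - s1) / (2 * B), d / (2 * B), c / (64 * B ^ 3), 1 / (8 * B)}"
  have T: "T > 0" "T \<le> (s2 - s1) / (2 * B)" "T \<le> d / (2 * B)" "T \<le> c / (64 * B ^ 3)" "T \<le> 1 / (8 * B)"
    using s d c B(1) by (auto simp: T_def)
  have TB: "T * B < s2 - s1" "T * B < d" "T * B \<le> 1 / 8" "T * B ^ 3 \<le> c / 64"
  proof -
    have "T * B \<le> (s2 - s1) / 2" "T * B \<le> d / 2" "T * B \<le> 1 / 8" "T * B ^ 3 \<le> c / 64"
      using T B(1) by (auto simp: field_simps)
    then show "T * B < s2 - s1" "T * B < d" "T * B \<le> 1 / 8" "T * B ^ 3 \<le> c / 64"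
      using s d(1) by auto
  qed
  \<comment> \<open>Along \<open>N\<close> the function \<open>k\<close> grows at rate at least
    \<open>c / 2\<close>, so moving by \<open>T\<close> changes it by \<open>c * T / 2\<close>, more
    than the error \<open>\<epsilon>\<close>; the value \<open>g x\<close> is therefore passed on
    the way.\<close>
  define \<epsilon> where "\<epsilon> = Min {1, \<theta>, c * T / 4}"
  have \<epsilon>: "\<epsilon> > 0" "\<epsilon> \<le> 1" "\<epsilon> \<le> \<theta>" "\<epsilon> \<le> c * T / 4"
    using \<theta> c T by (auto simp: \<epsilon>_def)
  define V where "V = {x\<in>ball z0 s2. \<bar>g x\<bar> < 3 * \<eta>}"
  \<comment> \<open>The threshold \<open>5/2 * \<eta>\<close> lies between
    \<open>2 * \<eta>\<close>, beyond which \<open>k = g\<close>, and \<open>3 * \<eta>\<close>,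
    below which \<open>N\<close> is transverse. So the open sets \<open>V\<close> and
    \<open>W\<close> cover the space, and on their overlap the displacement is zero, which makes its
    extension by zero of class \<open>C^1\<close>.\<close>
  define W where "W = - {x\<in>cball z0 s2. \<bar>g x\<bar> \<le> 5/2 * \<eta>}"
  have V_near: "x \<in> cball z0 s2" "dist z0 x < s1" "N x \<bullet> Gg x > c" if "x \<in> V" for x
    using that near[of x] by (auto simp: V_def)
  have "open V"
  proof -
    have "continuous_on (ball z0 s2) (\<lambda>x. \<bar>g x\<bar>)"
      by (intro continuous_intros continuous_on_subset[OF g_cont]) auto
    then have "open ((\<lambda>x. \<bar>g x\<bar>) -` {..<3 * \<eta>} \<inter> ball z0 s2)"
      using continuous_on_open_vimage open_ball open_lessThan by blast
    then show ?thesis by (simp add: V_def vimage_def Int_def conj_commute)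
  qed
  have "open W"
  proof -
    have "continuous_on (cball z0 s2) (\<lambda>x. \<bar>g x\<bar>)" by (intro continuous_intros g_cont)
    then have "closed (cball z0 s2 \<inter> (\<lambda>x. \<bar>g x\<bar>) -` {..5/2 * \<eta>})"
      by (intro continuous_closed_preimage) auto
    then show ?thesis by (simp add: W_def vimage_def Int_def open_Compl)
  qed
  have VW: "x \<in> V \<or> x \<in> W" for x
    using near[of x] s \<eta> by (force simp: V_def W_def)
  have seg: "x + s *\<^sub>R N x \<in> ball z0 s2" "norm (Gg (x + s *\<^sub>R N x) - Gg x) < \<theta>"
    if x: "x \<in> V" and s: "\<bar>s\<bar> \<le> T" for x s
  proof -
    have "norm (s *\<^sub>R N x) \<le> T * B"
      using B(2)[OF V_near(1)[OF x]] s T(1) by (auto intro!: mult_mono)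
    then have n: "norm (s *\<^sub>R N x) < s2 - s1" "norm (s *\<^sub>R N x) < d" using TB by auto
    have "dist z0 (x + s *\<^sub>R N x) \<le> dist z0 x + norm (s *\<^sub>R N x)"
      using norm_triangle_ineq4[of "z0 - x" "s *\<^sub>R N x"] by (simp add: dist_norm algebra_simps)
    then show 1: "x + s *\<^sub>R N x \<in> ball z0 s2" using V_near(2)[OF x] n(1) by simp
    show "norm (Gg (x + s *\<^sub>R N x) - Gg x) < \<theta>"
      using d(2)[OF V_near(1)[OF x], of "x + s *\<^sub>R N x"] 1 n(2) by (simp add: dist_norm)
  qed
  show ?thesis
  proof (intro exI[of _ \<epsilon>] conjI allI impI \<epsilon>(1))
    fix k Gk
    assume k: "\<forall>x\<in>ball z0 s2. GDERIV k x :> Gk x" and Gk: "continuous_on (ball z0 s2) Gk"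
      and close: "\<forall>x\<in>ball z0 s2. \<bar>k x - g x\<bar> < \<epsilon> \<and> norm (Gk x - Gg x) < \<epsilon>"
      and eq: "\<forall>x\<in>ball z0 s2. \<bar>g x\<bar> \<ge> 2 * \<eta> \<longrightarrow> k x = g x"
    define Y where "Y = (\<lambda>x s. x + s *\<^sub>R N x)"
    have Gk_close: "norm (Gk (Y x s) - Gg x) \<le> \<epsilon> + \<theta>" if "x \<in> V" "\<bar>s\<bar> \<le> T" for x s
      using seg[OF that] bspec[OF close seg(1)[OF that]]
        norm_triangle_ineq[of "Gk (Y x s) - Gg (Y x s)" "Gg (Y x s) - Gg x"]
      by (simp add: Y_def)
    have slope: "N x \<bullet> Gk (Y x s) \<ge> c / 2" if xs: "x \<in> V" "\<bar>s\<bar> \<le> T" for x s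
    proof -
      have "\<bar>N x \<bullet> (Gk (Y x s) - Gg x)\<bar> \<le> B * (\<theta> + \<theta>)"
        using Gk_close[OF xs] \<epsilon>(3) B(1) B(2)[OF V_near(1)[OF xs(1)]]
        by (intro order_trans[OF Cauchy_Schwarz_ineq2] mult_mono) auto
      also have "\<dots> = c / 8" using B(1) by (simp add: \<theta>_def)
      finally show ?thesis
        using V_near(3)[OF xs(1)] c unfolding inner_diff_right by linarith
    qed
    have der: "((\<lambda>s. k (Y x s)) has_real_derivative N x \<bullet> Gk (Y x s)) (at s)"
      if "x \<in> V" "\<bar>s\<bar> \<le> T" for x s
      unfolding Y_def using k seg(1)[OF that] by (intro GDERIV_along_line) auto
    have increase: "k (Y x s') - k (Y x s) \<ge> c / 2 * (s' - s)"
      if x: "x \<in> V" and s: "- T \<le> s" "s \<le> s'" "s' \<le> T" for x s s'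
    proof (cases "s = s'")
      case False
      then obtain z where "s < z" "z < s'" "k (Y x s') - k (Y x s) = (s' - s) * (N x \<bullet> Gk (Y x z))"
        using MVT2[of s s' "\<lambda>s. k (Y x s)" "\<lambda>z. N x \<bullet> Gk (Y x z)"] der[OF x] s by force
      then show ?thesis
        using slope[OF x, of z] s False by (simp add: mult.commute[of "c / 2"] mult_left_mono)
    qed simp
    have ex: "\<exists>s. \<bar>s\<bar> < T \<and> k (Y x s) = g x" if x: "x \<in> V" for x
    proof -
      have near0: "\<bar>k x - g x\<bar> < c * T / 2"
        using close x \<epsilon>(1,4) unfolding V_def by fastforce
      have "k (Y x T) - k x \<ge> c * T / 2" "k x - k (Y x (- T)) \<ge> c * T / 2"
        using increase[OF x, of 0 T] increase[OF x, of "- T" 0] T(1) by (auto simp: Y_def)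
      then have ends: "k (Y x (- T)) < g x" "g x < k (Y x T)" using near0 by linarith+
      have "continuous_on {- T..T} (\<lambda>s. k (Y x s))"
        by (intro continuous_at_imp_continuous_on ballI DERIV_isCont[OF der[OF x]]) auto
      then obtain s where "- T \<le> s" "s \<le> T" "k (Y x s) = g x"
        using IVT'[of "\<lambda>s. k (Y x s)" "- T" "g x" T] ends T(1) by force
      moreover have "s \<noteq> T" "s \<noteq> - T" using calculation(3) ends by auto
      ultimately show ?thesis by (intro exI[of _ s]) auto
    qed
    define \<sigma> where "\<sigma> = (\<lambda>x. if x \<in> V then SOME s. \<bar>s\<bar> < T \<and> k (Y x s) = g x else 0)"
    have \<sigma>: "\<bar>\<sigma> x\<bar> < T" "k (Y x (\<sigma> x)) = g x" if "x \<in> V" for x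
      using someI_ex[OF ex[OF that]] that by (auto simp: \<sigma>_def)
    \<comment> \<open>By monotonicity along the segment, values of \<open>k\<close> can be compared
      instead of parameters; in particular the choice made in \<open>\<sigma>\<close> is
      unique.\<close>
    have \<sigma>_less: "k (Y x s) > g x \<Longrightarrow> \<sigma> x < s" "k (Y x s) < g x \<Longrightarrow> s < \<sigma> x"
      if x: "x \<in> V" "\<bar>s\<bar> \<le> T" for x s
    proof -
      show "\<sigma> x < s" if "k (Y x s) > g x"
      proof (rule ccontr)
        assume "\<not> \<sigma> x < s"
        then have "k (Y x (\<sigma> x)) - k (Y x s) \<ge> c / 2 * (\<sigma> x - s)" "\<sigma> x - s \<ge> 0"
          using increase[OF x(1), of s "\<sigma> x"] x \<sigma>(1)[OF x(1)] by auto
        moreover have "c / 2 * (\<sigma> x - s) \<ge> 0" using calculation(2) c by simp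
        ultimately show False using \<sigma>(2)[OF x(1)] that by linarith
      qed
      show "s < \<sigma> x" if "k (Y x s) < g x"
      proof (rule ccontr)
        assume "\<not> s < \<sigma> x"
        then have "k (Y x s) - k (Y x (\<sigma> x)) \<ge> c / 2 * (s - \<sigma> x)" "s - \<sigma> x \<ge> 0"
          using increase[OF x(1), of "\<sigma> x" s] x \<sigma>(1)[OF x(1)] by auto
        moreover have "c / 2 * (s - \<sigma> x) \<ge> 0" using calculation(2) c by simp
        ultimately show False using \<sigma>(2)[OF x(1)] that by linarith
      qed
    qed
    have \<sigma>_zero: "\<sigma> x = 0" if "x \<in> W" for x
    proof (cases "x \<in> V")
      case True
      then have "k x = g x" using that eq \<eta> by (auto simp: V_def W_def)
      then have "k (Y x 0) - k (Y x (\<sigma> x)) = 0" using \<sigma>(2)[OF True] by (simp add: Y_def)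
      moreover have "\<sigma> x \<le> 0 \<Longrightarrow> c / 2 * - \<sigma> x \<le> k (Y x 0) - k (Y x (\<sigma> x))"
        "\<sigma> x \<ge> 0 \<Longrightarrow> c / 2 * \<sigma> x \<le> k (Y x (\<sigma> x)) - k (Y x 0)"
        using increase[OF True, of "\<sigma> x" 0] increase[OF True, of 0 "\<sigma> x"] \<sigma>(1)[OF True] by auto
      ultimately have "\<sigma> x \<ge> 0 \<Longrightarrow> c / 2 * \<sigma> x \<le> 0" "\<sigma> x \<le> 0 \<Longrightarrow> c / 2 * - \<sigma> x \<le> 0"
        by linarith+
      then show ?thesis using c by (cases "\<sigma> x \<ge> 0") (simp_all add: mult_le_0_iff zero_le_mult_iff)
    qed (simp add: \<sigma>_def)
    have Y_cont: "isCont (\<lambda>x. Y x s) x" for s x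
      unfolding Y_def using N_cont[of UNIV]
      by (intro continuous_intros) (simp add: continuous_on_eq_continuous_at)
    have g_isCont: "isCont g x" if "x \<in> V" for x
      using g V_near(1)[OF that] by (blast intro: GDERIV_isCont)
    \<comment> \<open>A strict inequality between \<open>k (Y x s)\<close> and \<open>g x\<close> at
      a fixed \<open>s\<close> persists for \<open>x\<close> near \<open>x0\<close>, and
      \<open>\<sigma>_less\<close> turns it into a bound for \<open>\<sigma>\<close>.\<close>
    have \<sigma>_cont: "isCont \<sigma> x0" if x0: "x0 \<in> V" for x0
    proof -
      have kY: "isCont (\<lambda>x. k (Y x s) - g x) x0" if "\<bar>s\<bar> \<le> T" for s
      proof -
        have "isCont k (Y x0 s)"
          using k seg(1)[OF x0 that] unfolding Y_def by (blast intro: GDERIV_isCont)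
        then show ?thesis
          by (intro continuous_intros g_isCont[OF x0] isCont_o2[OF Y_cont])
      qed
      have evV: "eventually (\<lambda>x. x \<in> V) (at x0)"
        using \<open>open V\<close> x0 by (auto simp: eventually_at_topological)
      show ?thesis
        unfolding isCont_def
      proof (rule order_tendstoI)
        fix a assume a: "\<sigma> x0 < a"
        define s where "s = min a T"
        have s: "\<bar>s\<bar> \<le> T" "\<sigma> x0 < s" "s \<le> a" using a \<sigma>(1)[OF x0] by (auto simp: s_def)
        have "k (Y x0 s) - g x0 \<ge> c / 2 * (s - \<sigma> x0)"
          using increase[OF x0, of "\<sigma> x0" s] s \<sigma>[OF x0] by auto
        then have "k (Y x0 s) - g x0 > 0" using c s(2)
          by (smt (verit, best) divide_pos_pos mult_pos_pos)
        then have "eventually (\<lambda>x. k (Y x s) - g x > 0) (at x0)"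
          using kY[OF s(1)] unfolding isCont_def by (rule order_tendstoD(1)[rotated])
        then show "eventually (\<lambda>x. \<sigma> x < a) (at x0)"
          using evV by eventually_elim (use \<sigma>_less(1) s in fastforce)
      next
        fix a assume a: "a < \<sigma> x0"
        define s where "s = max a (- T)"
        have s: "\<bar>s\<bar> \<le> T" "s < \<sigma> x0" "a \<le> s" using a \<sigma>(1)[OF x0] by (auto simp: s_def)
        have "g x0 - k (Y x0 s) \<ge> c / 2 * (\<sigma> x0 - s)"
          using increase[OF x0, of s "\<sigma> x0"] s \<sigma>[OF x0] by auto
        then have "k (Y x0 s) - g x0 < 0" using c s(2)
          by (smt (verit, best) divide_pos_pos mult_pos_pos)
        then have "eventually (\<lambda>x. k (Y x s) - g x < 0) (at x0)"
          using kY[OF s(1)] unfolding isCont_def by (rule order_tendstoD(2)[rotated])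
        then show "eventually (\<lambda>x. a < \<sigma> x) (at x0)"
          using evV by eventually_elim (use \<sigma>_less(2) s in fastforce)
      qed
    qed
    \<comment> \<open>Obtained by differentiating
      \<open>k (x + \<sigma> x *\<^sub>R N x) = g x\<close> and solving for the derivative of
      \<open>\<sigma>\<close>; the denominator is at least \<open>c / 2\<close>.\<close>
    define L where "L = (\<lambda>x h. - ((h + \<sigma> x *\<^sub>R N' x h) \<bullet> Gk (Y x (\<sigma> x)) - h \<bullet> Gg x)
        / (N x \<bullet> Gk (Y x (\<sigma> x))))"
    have \<sigma>_der: "(\<sigma> has_derivative L x) (at x)" if x: "x \<in> V" for x
    proof -
      let ?H = "\<lambda>p. k (fst p + snd p *\<^sub>R N (fst p)) - g (fst p)"
      let ?H' = "\<lambda>q. (fst q + (\<sigma> x *\<^sub>R N' x (fst q) + snd q *\<^sub>R N x)) \<bullet> Gk (Y x (\<sigma> x)) - fst q \<bullet> Gg x"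
      have Nf: "((\<lambda>p. N (fst p)) has_derivative (\<lambda>q. N' x (fst q))) (at (x, \<sigma> x))"
        using has_derivative_compose[OF has_derivative_fst[OF has_derivative_ident] , of N "N' x" "(x, \<sigma> x)"]
          N'(1)[of x] by simp
      have Yf: "((\<lambda>p. fst p + snd p *\<^sub>R N (fst p)) has_derivative
          (\<lambda>q. fst q + (\<sigma> x *\<^sub>R N' x (fst q) + snd q *\<^sub>R N x))) (at (x, \<sigma> x))"
        by (auto intro!: derivative_eq_intros Nf)
      have kd: "(k has_derivative (\<lambda>h. h \<bullet> Gk (Y x (\<sigma> x)))) (at (fst (x, \<sigma> x) + snd (x, \<sigma> x) *\<^sub>R N (fst (x, \<sigma> x))))"
        using k seg(1)[OF x, of "\<sigma> x"] \<sigma>(1)[OF x] by (simp add: gderiv_def Y_def)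
      have gd: "((\<lambda>p. g (fst p)) has_derivative (\<lambda>q. fst q \<bullet> Gg x)) (at (x, \<sigma> x))"
        using has_derivative_compose[OF has_derivative_fst[OF has_derivative_ident], of g "\<lambda>h. h \<bullet> Gg x" "(x, \<sigma> x)"]
          g[OF V_near(1)[OF x]] by (simp add: gderiv_def)
      have H: "(?H has_derivative ?H') (at (x, \<sigma> x))"
        by (rule has_derivative_diff[OF has_derivative_compose[OF Yf kd] gd])
      have "eventually (\<lambda>y. ?H (y, \<sigma> y) = 0) (nhds x)"
        using \<sigma>(2) \<open>open V\<close> x unfolding eventually_nhds Y_def by auto
      moreover have "?H' (0, 1) \<noteq> 0"
        using slope[OF x, of "\<sigma> x"] \<sigma>(1)[OF x] c by simp
      ultimately have der: "(\<sigma> has_derivative (\<lambda>h. - ?H' (h, 0) / ?H' (0, 1))) (at x)"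
        using \<sigma>_cont[OF x] by (intro has_derivative_implicit_real[of ?H ?H' x \<sigma>, OF H])
      have "(\<lambda>h. - ?H' (h, 0) / ?H' (0, 1)) = L x"
        unfolding L_def by (simp add: blinfun.zero_right)
      with der show ?thesis by (rule has_derivative_eq_rhs)
    qed
    define u where "u = (\<lambda>x. \<sigma> x *\<^sub>R N x)"
    define u' where "u' = (\<lambda>x. if x \<in> V then Blinfun (\<lambda>h. \<sigma> x *\<^sub>R N' x h + L x h *\<^sub>R N x) else 0)"
    have uV: "(u has_derivative (\<lambda>h. \<sigma> x *\<^sub>R N' x h + L x h *\<^sub>R N x)) (at x)" if "x \<in> V" for x
      unfolding u_def by (rule has_derivative_scaleR[OF \<sigma>_der[OF that] N'(1)])
    have u'V: "blinfun_apply (u' x) = (\<lambda>h. \<sigma> x *\<^sub>R N' x h + L x h *\<^sub>R N x)" if "x \<in> V" for x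
      using has_derivative_bounded_linear[OF uV[OF that]] that
      by (simp add: u'_def bounded_linear_Blinfun_apply)
    have uW: "(u has_derivative (\<lambda>h. 0)) (at x)" if "x \<in> W" for x
      by (rule has_derivative_transform_within_open[OF has_derivative_const[of 0] \<open>open W\<close> that])
        (simp add: u_def \<sigma>_zero)
    have u'W: "u' x = 0" if "x \<in> W" for x
    proof (cases "x \<in> V")
      case True
      then have "blinfun_apply (u' x) = (\<lambda>h. 0)"
        using has_derivative_unique[OF uV uW] that u'V by simp
      then show ?thesis by (intro blinfun_eqI) simp
    qed (simp add: u'_def)
    have u_der: "(u has_derivative blinfun_apply (u' x)) (at x)" for x
    proof (cases "x \<in> V")
      case True
      then show ?thesis unfolding u'V[OF True] by (rule uV)
    next
      case False
      then have "x \<in> W" using VW by blast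
      then show ?thesis using uW[OF \<open>x \<in> W\<close>] by (simp add: u'W zero_blinfun.rep_eq)
    qed
    have small: "norm (u' x) \<le> 1/2" for x
    proof (cases "x \<in> V")
      case True
      note x = V_near[OF True]
      have sx: "\<bar>\<sigma> x\<bar> \<le> T" using \<sigma>(1)[OF True] by simp
      show ?thesis
      proof (rule norm_blinfun_bound)
        fix h
        have N'h: "norm (N' x h) \<le> B * norm h"
          using B(3)[OF x(1)] by (intro order_trans[OF norm_blinfun] mult_right_mono) auto
        have s': "norm (\<sigma> x *\<^sub>R N' x h) \<le> T * (B * norm h)"
          using sx N'h T(1) by (auto intro!: mult_mono)
        have Gk_B: "norm (Gk (Y x (\<sigma> x))) \<le> 2 * B"
        proof -
          have "B * 1 \<le> B * (B * B)" "c / (16 * B) \<le> c / 16" using B(1) c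
            by (auto intro!: mult_left_mono mult_ge1_I simp: field_simps)
          have "\<bar>\<sigma> x\<bar> \<le> T" by (rule sx)
          then have "norm (Gk (Y x (\<sigma> x)) - Gg (Y x (\<sigma> x))) < \<epsilon>"
            using close seg(1)[OF True] by (simp add: Y_def)
          moreover have "norm (Gg (Y x (\<sigma> x))) \<le> B"
            using seg(1)[OF True sx] by (intro B(4)) (simp add: Y_def)
          ultimately show ?thesis
            using norm_triangle_ineq[of "Gk (Y x (\<sigma> x)) - Gg (Y x (\<sigma> x))" "Gg (Y x (\<sigma> x))"] \<epsilon>(2) B(1)
            by simp
        qed
        have "\<bar>(h + \<sigma> x *\<^sub>R N' x h) \<bullet> Gk (Y x (\<sigma> x)) - h \<bullet> Gg x\<bar>
            = \<bar>h \<bullet> (Gk (Y x (\<sigma> x)) - Gg x) + (\<sigma> x *\<^sub>R N' x h) \<bullet> Gk (Y x (\<sigma> x))\<bar>"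
          by (simp add: inner_add_left inner_diff_right)
        also have "\<dots> \<le> \<bar>h \<bullet> (Gk (Y x (\<sigma> x)) - Gg x)\<bar> + \<bar>(\<sigma> x *\<^sub>R N' x h) \<bullet> Gk (Y x (\<sigma> x))\<bar>"
          by (rule abs_triangle_ineq)
        also have "\<dots> \<le> norm h * (\<theta> + \<theta>) + T * (B * norm h) * (2 * B)"
          using Gk_close[OF True sx] \<epsilon>(3) s' Gk_B T(1) B(1)
          by (intro add_mono order_trans[OF Cauchy_Schwarz_ineq2] mult_mono) auto
        also have "\<dots> = (2 * \<theta> + 2 * (T * B * B)) * norm h" by (simp add: algebra_simps)
        finally have num: "\<bar>(h + \<sigma> x *\<^sub>R N' x h) \<bullet> Gk (Y x (\<sigma> x)) - h \<bullet> Gg x\<bar>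
            \<le> (2 * \<theta> + 2 * (T * B * B)) * norm h" .
        have Lh: "\<bar>L x h\<bar> \<le> (2 * \<theta> + 2 * (T * B * B)) * norm h / (c / 2)"
          unfolding L_def abs_divide abs_minus_cancel
          using num slope[OF True sx] c by (intro frac_le) auto
        have "norm (L x h *\<^sub>R N x) \<le> (2 * \<theta> + 2 * (T * B * B)) * norm h / (c / 2) * B"
          unfolding norm_scaleR real_norm_def[symmetric]
          using Lh B(2)[OF x(1)] order_trans[OF abs_ge_zero Lh] by (intro mult_mono) auto
        also have "\<dots> = (4 * (\<theta> * B) + 4 * (T * B ^ 3)) / c * norm h"
          using c by (simp add: field_simps power3_eq_cube)
        also have "\<dots> \<le> (c / 4 + c / 16) / c * norm h"
          using TB(4) B(1) c by (intro mult_right_mono divide_right_mono) (auto simp: \<theta>_def)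
        also have "\<dots> = 5 / 16 * norm h" using c by (simp add: field_simps)
        finally have "norm (L x h *\<^sub>R N x) \<le> 5 / 16 * norm h" .
        moreover have "norm (\<sigma> x *\<^sub>R N' x h) \<le> 1 / 8 * norm h"
          using s' mult_right_mono[OF TB(3) norm_ge_zero[of h]] by (simp add: mult.assoc)
        ultimately show "norm (u' x h) \<le> 1 / 2 * norm h"
          unfolding u'V[OF True]
          using norm_triangle_ineq[of "\<sigma> x *\<^sub>R N' x h" "L x h *\<^sub>R N x"] norm_ge_zero[of h] by linarith
      qed simp
    qed (simp add: u'_def)
    have cont: "continuous_on UNIV u'"
    proof -
      have "continuous_on V u'"
      proof (rule continuous_on_blinfun_componentwise)
        fix b :: "real^'n" assume "b \<in> Basis"
        have \<sigma>V: "continuous_on V \<sigma>"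
          using \<sigma>_cont by (blast intro: continuous_at_imp_continuous_on)
        have YV: "continuous_on V (\<lambda>x. Y x (\<sigma> x))"
          unfolding Y_def by (intro continuous_intros \<sigma>V N_cont)
        have GkV: "continuous_on V (\<lambda>x. Gk (Y x (\<sigma> x)))"
          using seg(1) \<sigma>(1) by (intro continuous_on_compose2[OF Gk YV]) (force simp: Y_def)
        have GgV: "continuous_on V Gg"
          using V_near(1) by (blast intro: continuous_on_subset[OF Gg])
        define n where "n = (\<lambda>x. N' x b)"
        have n: "continuous_on V n"
          unfolding n_def by (intro continuous_intros continuous_on_subset[OF N'(2)]) auto
        have "N x \<bullet> Gk (Y x (\<sigma> x)) \<noteq> 0" if "x \<in> V" for x
          using slope[OF that, of "\<sigma> x"] \<sigma>(1)[OF that] c by simp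
        then have "continuous_on V (\<lambda>x. \<sigma> x *\<^sub>R n x +
            (- ((b + \<sigma> x *\<^sub>R n x) \<bullet> Gk (Y x (\<sigma> x)) - b \<bullet> Gg x) / (N x \<bullet> Gk (Y x (\<sigma> x)))) *\<^sub>R N x)"
          by (intro continuous_intros \<sigma>V n GkV GgV N_cont ballI)
        then have "continuous_on V (\<lambda>x. \<sigma> x *\<^sub>R N' x b + L x b *\<^sub>R N x)"
          by (simp add: n_def L_def)
        then show "continuous_on V (\<lambda>x. u' x b)"
          by (simp add: u'V cong: continuous_on_cong)
      qed
      moreover have "continuous_on W u'"
        using u'W by (simp cong: continuous_on_cong)
      ultimately have "continuous_on (V \<union> W) u'"
        using \<open>open V\<close> \<open>open W\<close> by (intro continuous_on_open_Un)
      moreover have "V \<union> W = UNIV" using VW by auto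
      ultimately show ?thesis by simp
    qed
    have surj: "\<exists>x. y = x + u x" for y
    proof -
      have "surj (\<lambda>x. x + u x)"
        using diffeomorphism_id_plus_contraction[OF u_der cont small]
        by (simp add: diffeomorphism_def bij_is_surj)
      then show ?thesis by blast
    qed
    have "(\<lambda>x. x + u x) ` {x\<in>ball z0 s2. g x = 0} = {x\<in>ball z0 s2. k x = 0}"
    proof (intro equalityI subsetI)
      fix y assume "y \<in> (\<lambda>x. x + u x) ` {x\<in>ball z0 s2. g x = 0}"
      then obtain x where x: "y = Y x (\<sigma> x)" "x \<in> ball z0 s2" "g x = 0" by (auto simp: u_def Y_def)
      then have "x \<in> V" using \<eta> by (auto simp: V_def)
      then show "y \<in> {x\<in>ball z0 s2. k x = 0}"
        using x \<sigma>[of x] seg(1)[of x "\<sigma> x"] by (auto simp: Y_def)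
    next
      \<comment> \<open>The diffeomorphism of the whole space supplies a preimage of each zero of
        \<open>k\<close>. A preimage outside \<open>V\<close> would be fixed, but there
        \<open>k = g\<close> has no zero inside the ball.\<close>
      fix y assume y: "y \<in> {x\<in>ball z0 s2. k x = 0}"
      obtain x where x: "y = x + u x" using surj by blast
      have "x \<in> V"
      proof (rule ccontr)
        assume "x \<notin> V"
        then have "y = x" by (simp add: x u_def \<sigma>_def)
        then show False using y \<open>x \<notin> V\<close> eq \<eta> by (auto simp: V_def)
      qed
      then have "g x = 0" using \<sigma>(2)[of x] x y by (simp add: Y_def u_def)
      then show "y \<in> (\<lambda>x. x + u x) ` {x\<in>ball z0 s2. g x = 0}"
        using x \<open>x \<in> V\<close> by (auto simp: V_def)
    qed
    then show "diffeotopic_sets {x\<in>ball z0 s2. g x = 0} {x\<in>ball z0 s2. k x = 0}"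
      using diffeotopic_sets_id_plus_contraction[OF u_der cont small, of "{x\<in>ball z0 s2. g x = 0}"] by simp
  qed
qed

text \<open>Squaring removes the corner of the positive part. The result is of class
  \<open>C^1\<close>, all that the diffeomorphisms here require.\<close>

lemma has_real_derivative_pos_part_power2:
  "((\<lambda>t::real. (max 0 t)\<^sup>2) has_real_derivative 2 * max 0 t) (at t)"
proof (cases t "0::real" rule: linorder_cases)
  case less
  then have "((\<lambda>t::real. (max 0 t)\<^sup>2) has_real_derivative 0) (at t)"
    by (intro has_field_derivative_transform_within_open[OF DERIV_const[of 0] open_lessThan[of 0]]) auto
  then show ?thesis using less by simp
next
  case greater
  have "((\<lambda>t::real. t\<^sup>2) has_real_derivative 2 * t) (at t)"
    by (auto intro!: derivative_eq_intros)
  then have "((\<lambda>t::real. (max 0 t)\<^sup>2) has_real_derivative 2 * t) (at t)"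
    by (rule has_field_derivative_transform_within_open[OF _ open_greaterThan[of 0]])
      (use greater in auto)
  then show ?thesis using greater by simp
next
  case equal
  have "((\<lambda>h::real. (max 0 h)\<^sup>2 / h) \<longlongrightarrow> 0) (at 0)"
  proof (rule Lim_null_comparison)
    show "\<forall>\<^sub>F h in at 0. norm ((max 0 h)\<^sup>2 / h) \<le> \<bar>h\<bar>"
      by (intro always_eventually allI) (auto simp: max_def power2_eq_square)
    show "((\<lambda>h::real. \<bar>h\<bar>) \<longlongrightarrow> 0) (at 0)" by (auto intro!: tendsto_eq_intros)
  qed
  then show ?thesis using equal by (simp add: DERIV_def)
qed

text \<open>The bump is \<open>P / (P + Q)\<close>, where \<open>P\<close> vanishes for
  \<open>\<bar>v\<bar> >= 2\<close> and \<open>Q\<close> for \<open>\<bar>v\<bar> <= 1\<close>; they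
  never vanish together.\<close>

lemma C1_bump_exists:
  "\<exists>b b' :: real \<Rightarrow> real. (\<forall>v. (b has_real_derivative b' v) (at v)) \<and> continuous_on UNIV b' \<and>
     (\<forall>v. 0 \<le> b v \<and> b v \<le> 1) \<and> (\<forall>v. \<bar>v\<bar> \<le> 1 \<longrightarrow> b v = 1) \<and> (\<forall>v. \<bar>v\<bar> \<ge> 2 \<longrightarrow> b v = 0)"
proof -
  define P where "P = (\<lambda>v::real. (max 0 (4 - v\<^sup>2))\<^sup>2)"
  define Q where "Q = (\<lambda>v::real. (max 0 (v\<^sup>2 - 1))\<^sup>2)"
  define P' where "P' = (\<lambda>v::real. 2 * max 0 (4 - v\<^sup>2) * (- (2 * v)))"
  define Q' where "Q' = (\<lambda>v::real. 2 * max 0 (v\<^sup>2 - 1) * (2 * v))"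
  have P: "(P has_real_derivative P' v) (at v)" for v
  proof -
    have "((\<lambda>v::real. 4 - v\<^sup>2) has_real_derivative - (2 * v)) (at v)" by (auto intro!: derivative_eq_intros)
    from DERIV_chain2[OF has_real_derivative_pos_part_power2 this] show ?thesis
      by (simp add: P_def P'_def)
  qed
  have Q: "(Q has_real_derivative Q' v) (at v)" for v
  proof -
    have "((\<lambda>v::real. v\<^sup>2 - 1) has_real_derivative 2 * v) (at v)" by (auto intro!: derivative_eq_intros)
    from DERIV_chain2[OF has_real_derivative_pos_part_power2 this] show ?thesis
      by (simp add: Q_def Q'_def)
  qed
  have nn: "P v \<ge> 0" "Q v \<ge> 0" for v by (auto simp: P_def Q_def)
  have pos: "P v + Q v > 0" for v
  proof (cases "v\<^sup>2 > 1")
    case True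
    then have "Q v > 0" by (simp add: Q_def)
    then show ?thesis using nn(1)[of v] by linarith
  next
    case False
    then have "P v > 0" by (simp add: P_def)
    then show ?thesis using nn(2)[of v] by linarith
  qed
  have nz: "(P v + Q v) * (P v + Q v) \<noteq> 0" for v using pos[of v] by simp
  have cont: "continuous_on UNIV P" "continuous_on UNIV Q" "continuous_on UNIV P'" "continuous_on UNIV Q'"
    unfolding P_def Q_def P'_def Q'_def by (intro continuous_intros)+
  show ?thesis
  proof (intro exI conjI allI impI)
    show "((\<lambda>v. P v / (P v + Q v)) has_real_derivative
        (P' v * (P v + Q v) - P v * (P' v + Q' v)) / ((P v + Q v) * (P v + Q v))) (at v)" for v
      using pos[of v] by (intro DERIV_divide DERIV_add P Q) simp
    show "continuous_on UNIV (\<lambda>v. (P' v * (P v + Q v) - P v * (P' v + Q' v)) / ((P v + Q v) * (P v + Q v)))"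
      by (intro continuous_intros cont ballI nz)
    show "0 \<le> P v / (P v + Q v)" "P v / (P v + Q v) \<le> 1" for v
      using nn[of v] pos[of v] by auto
    show "P v / (P v + Q v) = 1" if "\<bar>v\<bar> \<le> 1" for v
    proof -
      have "v\<^sup>2 \<le> 1" using that by (simp add: abs_square_le_1)
      then have "Q v = 0" by (simp add: Q_def)
      then show ?thesis using pos[of v] by simp
    qed
    show "P v / (P v + Q v) = 0" if "\<bar>v\<bar> \<ge> 2" for v
    proof -
      have "2\<^sup>2 \<le> \<bar>v\<bar>\<^sup>2" using that by (intro power_mono) auto
      then show ?thesis by (simp add: P_def)
    qed
  qed
qed

lemma compact_nonzero_imp_bounded_below:
  fixes f :: "'a::topological_space \<Rightarrow> 'b::real_normed_vector"
  assumes "compact S" "continuous_on S f" "\<And>x. x \<in> S \<Longrightarrow> f x \<noteq> 0"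
  shows "\<exists>\<mu>>0. \<forall>x\<in>S. \<mu> \<le> norm (f x)"
proof (cases "S = {}")
  case False
  obtain x where "x \<in> S" "\<forall>y\<in>S. norm (f x) \<le> norm (f y)"
    using continuous_attains_inf[OF assms(1) False continuous_on_norm[OF assms(2)]] by blast
  then show ?thesis using assms(3) by (intro exI[of _ "norm (f x)"]) auto
qed (auto intro: exI[of _ 1])

text \<open>An arbitrary \<open>h\<close> close to \<open>g\<close> is replaced by
  \<open>k = g + b (g) * (h - g)\<close>, which agrees with \<open>g\<close> where \<open>g\<close>
  is not small, as the preceding construction demands, and has the same zeros as
  \<open>h\<close>.\<close>

lemma diffeotopic_zero_sets_of_C1_close:
  fixes g :: "real^'n::finite \<Rightarrow> real"
  assumes g: "\<And>x. x \<in> ball z0 R \<Longrightarrow> GDERIV g x :> Gg x"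
    and Gg: "continuous_on (ball z0 R) Gg"
    and zeros: "\<And>x. x \<in> ball z0 R \<Longrightarrow> g x = 0 \<Longrightarrow> dist z0 x \<le> s \<and> Gg x \<noteq> 0"
    and s: "s < s2" "s2 < R"
  shows "\<exists>\<epsilon>>0. \<forall>h Gh. (\<forall>x\<in>ball z0 s2. GDERIV h x :> Gh x) \<longrightarrow> continuous_on (ball z0 s2) Gh \<longrightarrow>
     (\<forall>x\<in>ball z0 s2. \<bar>h x - g x\<bar> < \<epsilon> \<and> norm (Gh x - Gg x) < \<epsilon>) \<longrightarrow>
     diffeotopic_sets {x\<in>ball z0 s2. g x = 0} {x\<in>ball z0 s2. h x = 0}"
proof -
  let ?C = "cball z0 s2"
  have sub: "?C \<subseteq> ball z0 R" using s by auto
  have GgC: "continuous_on ?C Gg" by (rule continuous_on_subset[OF Gg sub])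
  have gC: "continuous_on ?C g"
    using g sub by (meson GDERIV_isCont continuous_at_imp_continuous_on subsetD)
  define Z where "Z = {x\<in>?C. g x = 0}"
  have "closed (?C \<inter> g -` {0})" by (intro continuous_closed_preimage gC) auto
  then have Z: "compact Z"
    unfolding Z_def by (auto simp: compact_eq_bounded_closed vimage_def Int_def intro: bounded_subset[OF bounded_cball])
  obtain \<mu> where \<mu>: "\<mu> > 0" "\<And>x. x \<in> Z \<Longrightarrow> \<mu> \<le> norm (Gg x)"
  proof -
    have "\<exists>\<mu>>0. \<forall>x\<in>Z. \<mu> \<le> norm (Gg x)"
      using zeros sub by (intro compact_nonzero_imp_bounded_below Z continuous_on_subset[OF GgC])
        (auto simp: Z_def)
    then show ?thesis using that by blast
  qed
  \<comment> \<open>The gradient is only continuous, and moving along it would not be a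
    \<open>C^1\<close> map. A polynomial field within \<open>\<mu> / 2\<close> of it is still
    transverse on \<open>Z\<close>, where its inner product with \<open>Gg\<close> is at least
    \<open>\<mu>\<^sup>2 / 2\<close>.\<close>
  obtain N where N: "polynomial_function N" "\<And>x. x \<in> ?C \<Longrightarrow> norm (Gg x - N x) < \<mu> / 2"
    using Stone_Weierstrass_polynomial_function[OF compact_cball GgC, of "\<mu> / 2"] \<mu>(1) by auto
  have NC: "continuous_on ?C N"
    using N(1) by (simp add: continuous_on_polymonial_function)
  define c where "c = \<mu>\<^sup>2 / 4"
  have c: "c > 0" using \<mu>(1) by (simp add: c_def)
  have NG: "N x \<bullet> Gg x > c" if "x \<in> Z" for x
  proof -
    have xC: "x \<in> ?C" using that by (simp add: Z_def)
    have "\<bar>(Gg x - N x) \<bullet> Gg x\<bar> \<le> \<mu> / 2 * norm (Gg x)"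
      using N(2)[OF xC] by (intro order_trans[OF Cauchy_Schwarz_ineq2] mult_right_mono) auto
    also have "\<dots> \<le> norm (Gg x) / 2 * norm (Gg x)"
      using \<mu>(2)[OF that] by (intro mult_right_mono) auto
    also have "\<dots> = (norm (Gg x))\<^sup>2 / 2" by (simp add: power2_eq_square)
    moreover have "N x \<bullet> Gg x = (norm (Gg x))\<^sup>2 - (Gg x - N x) \<bullet> Gg x"
      by (simp add: inner_diff_left power2_norm_eq_inner)
    ultimately have "N x \<bullet> Gg x \<ge> (norm (Gg x))\<^sup>2 / 2" by linarith
    moreover have "(norm (Gg x))\<^sup>2 \<ge> \<mu>\<^sup>2" using \<mu> that by (intro power_mono) auto
    moreover have "\<mu>\<^sup>2 > 0" using \<mu>(1) by simp
    ultimately show ?thesis unfolding c_def by linarith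
  qed
  define s1 where "s1 = (s + s2) / 2"
  \<comment> \<open>The points at which transversality or the distance from the boundary fails. This
    set is compact and free of zeros, so \<open>\<bar>g\<bar>\<close> has a positive lower bound on
    it, which becomes \<open>3 * \<eta>\<close>.\<close>
  define C where "C = {x\<in>?C. N x \<bullet> Gg x \<le> c} \<union> {x\<in>?C. s1 \<le> dist z0 x}"
  have "closed (?C \<inter> (\<lambda>x. N x \<bullet> Gg x) -` {..c})" "closed (?C \<inter> (\<lambda>x. dist z0 x) -` {s1..})"
    by (intro continuous_closed_preimage continuous_intros NC GgC closed_cball closed_atMost closed_atLeast)+
  then have "compact C"
    unfolding C_def by (auto simp: compact_eq_bounded_closed vimage_def Int_def intro: bounded_subset[OF bounded_cball])
  moreover have "g x \<noteq> 0" if "x \<in> C" for x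
    using that NG[of x] zeros[of x] sub s(1) by (auto simp: C_def Z_def s1_def)
  moreover have "continuous_on C g" by (rule continuous_on_subset[OF gC]) (auto simp: C_def)
  ultimately obtain \<eta>0 where \<eta>0: "\<eta>0 > 0" "\<And>x. x \<in> C \<Longrightarrow> \<eta>0 \<le> \<bar>g x\<bar>"
    using compact_nonzero_imp_bounded_below[of C g] by auto
  define \<eta> where "\<eta> = \<eta>0 / 3"
  have \<eta>: "\<eta> > 0" using \<eta>0 by (simp add: \<eta>_def)
  have near: "dist z0 x < s1 \<and> N x \<bullet> Gg x > c" if "x \<in> ?C" "\<bar>g x\<bar> < 3 * \<eta>" for x
    using \<eta>0(2)[of x] that unfolding C_def \<eta>_def by fastforce
  have "s1 < s2" using s by (simp add: s1_def)
  with near obtain \<epsilon>1 where \<epsilon>1: "\<epsilon>1 > 0" "\<And>k Gk. \<lbrakk>\<forall>x\<in>ball z0 s2. GDERIV k x :> Gk x;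
     continuous_on (ball z0 s2) Gk; \<forall>x\<in>ball z0 s2. \<bar>k x - g x\<bar> < \<epsilon>1 \<and> norm (Gk x - Gg x) < \<epsilon>1;
     \<forall>x\<in>ball z0 s2. \<bar>g x\<bar> \<ge> 2 * \<eta> \<longrightarrow> k x = g x\<rbrakk> \<Longrightarrow>
     diffeotopic_sets {x\<in>ball z0 s2. g x = 0} {x\<in>ball z0 s2. k x = 0}"
    using diffeotopic_zero_sets_of_close[of z0 s2 g Gg N s1 \<eta> c] g sub GgC
      polynomial_function_C1_map[OF N(1)] \<eta> c by blast
  obtain b0 b0' :: "real \<Rightarrow> real" where b0: "\<And>v. (b0 has_real_derivative b0' v) (at v)"
    "continuous_on UNIV b0'" "\<And>v. 0 \<le> b0 v" "\<And>v. b0 v \<le> 1" "\<And>v. \<bar>v\<bar> \<le> 1 \<Longrightarrow> b0 v = 1"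
    "\<And>v. \<bar>v\<bar> \<ge> 2 \<Longrightarrow> b0 v = 0"
    using C1_bump_exists by blast
  define b b' where "b = (\<lambda>v. b0 (v / \<eta>))" and "b' = (\<lambda>v. b0' (v / \<eta>) * (1 / \<eta>))"
  have b: "(b has_real_derivative b' v) (at v)" for v
  proof -
    have "((\<lambda>v. v / \<eta>) has_real_derivative 1 / \<eta>) (at v)"
      using \<eta> by (auto intro!: derivative_eq_intros)
    from DERIV_chain2[OF b0(1) this] show ?thesis by (simp add: b_def b'_def)
  qed
  have b_range: "0 \<le> b v" "b v \<le> 1" for v using b0(3,4) by (auto simp: b_def)
  have b1: "b v = 1" if "\<bar>v\<bar> \<le> \<eta>" for v
    using b0(5)[of "v / \<eta>"] that \<eta> by (simp add: b_def)
  have b2: "b v = 0" if "\<bar>v\<bar> \<ge> 2 * \<eta>" for v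
    using b0(6)[of "v / \<eta>"] that \<eta> by (simp add: b_def field_simps)
  have b'_cont: "continuous_on UNIV b'"
    unfolding b'_def using \<eta> by (intro continuous_intros continuous_on_compose2[OF b0(2)]) auto
  have b_cont: "continuous_on UNIV b"
    using b by (meson DERIV_isCont continuous_at_imp_continuous_on)
  have "continuous_on ?C (\<lambda>x. b' (g x) *\<^sub>R Gg x)"
    by (intro continuous_intros GgC continuous_on_compose2[OF b'_cont gC]) auto
  then obtain K where K: "\<And>x. x \<in> ?C \<Longrightarrow> norm (b' (g x) *\<^sub>R Gg x) \<le> K"
    using compact_imp_norm_bound[OF compact_cball] by blast
  define \<epsilon> where "\<epsilon> = min \<eta> (\<epsilon>1 / (2 * (2 + \<bar>K\<bar>)))"
  have \<epsilon>: "\<epsilon> > 0" "\<epsilon> \<le> \<eta>" "\<epsilon> * (2 + \<bar>K\<bar>) < \<epsilon>1"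
  proof -
    show "\<epsilon> \<le> \<eta>" unfolding \<epsilon>_def by (rule min.cobounded1)
    show "\<epsilon> > 0" using \<eta> \<epsilon>1(1) unfolding \<epsilon>_def by (auto intro!: divide_pos_pos)
    have "\<epsilon> * (2 + \<bar>K\<bar>) \<le> \<epsilon>1 / (2 * (2 + \<bar>K\<bar>)) * (2 + \<bar>K\<bar>)"
      by (intro mult_right_mono) (auto simp: \<epsilon>_def)
    also have "\<dots> = \<epsilon>1 / 2" by (auto simp: field_simps)
    finally show "\<epsilon> * (2 + \<bar>K\<bar>) < \<epsilon>1" using \<epsilon>1(1) by simp
  qed
  show ?thesis
  proof (intro exI[of _ \<epsilon>] conjI allI impI \<epsilon>(1))
    fix h Gh
    assume h: "\<forall>x\<in>ball z0 s2. GDERIV h x :> Gh x" and Gh: "continuous_on (ball z0 s2) Gh"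
      and close: "\<forall>x\<in>ball z0 s2. \<bar>h x - g x\<bar> < \<epsilon> \<and> norm (Gh x - Gg x) < \<epsilon>"
    define k where "k = (\<lambda>x. g x + b (g x) * (h x - g x))"
    define Gk where "Gk = (\<lambda>x. Gg x + (b (g x) *\<^sub>R (Gh x - Gg x) + (h x - g x) *\<^sub>R (b' (g x) *\<^sub>R Gg x)))"
    have inR: "x \<in> ball z0 R" "x \<in> ?C" if "x \<in> ball z0 s2" for x using that s by auto
    have hC: "continuous_on (ball z0 s2) h"
      using h by (meson GDERIV_isCont continuous_at_imp_continuous_on)
    have sub': "ball z0 s2 \<subseteq> ?C" by auto
    have k_close: "\<bar>k x - g x\<bar> < \<epsilon>" if x: "x \<in> ball z0 s2" for x
    proof -
      have "\<bar>k x - g x\<bar> \<le> 1 * \<bar>h x - g x\<bar>"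
        unfolding k_def using b_range[of "g x"] by (simp add: abs_mult mult_left_le_one_le)
      then show ?thesis using close x by fastforce
    qed
    have "diffeotopic_sets {x\<in>ball z0 s2. g x = 0} {x\<in>ball z0 s2. k x = 0}"
    proof (rule \<epsilon>1(2)[of k Gk]; (intro ballI conjI impI)?)
      show "continuous_on (ball z0 s2) Gk"
        unfolding Gk_def
        by (intro continuous_intros Gh hC continuous_on_subset[OF GgC sub'] continuous_on_subset[OF gC sub']
            continuous_on_compose2[OF b_cont continuous_on_subset[OF gC sub']]
            continuous_on_compose2[OF b'_cont continuous_on_subset[OF gC sub']]) auto
      fix x assume x: "x \<in> ball z0 s2"
      show "GDERIV k x :> Gk x"
        unfolding k_def Gk_def
        using h x g[OF inR(1)[OF x]]
        by (intro GDERIV_add GDERIV_mult GDERIV_diff GDERIV_DERIV_compose[OF _ b]) auto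
      show "\<bar>g x\<bar> \<ge> 2 * \<eta> \<Longrightarrow> k x = g x" by (simp add: k_def b2)
      have "\<epsilon> * 1 \<le> \<epsilon> * (2 + \<bar>K\<bar>)" using \<epsilon>(1) by (intro mult_left_mono) auto
      then show "\<bar>k x - g x\<bar> < \<epsilon>1" using k_close[OF x] \<epsilon>(3) by linarith
      have cx: "\<bar>h x - g x\<bar> < \<epsilon>" "norm (Gh x - Gg x) < \<epsilon>" using close x by auto
      have "norm (Gk x - Gg x) \<le> norm (b (g x) *\<^sub>R (Gh x - Gg x)) + norm ((h x - g x) *\<^sub>R (b' (g x) *\<^sub>R Gg x))"
        unfolding Gk_def by (metis add_diff_cancel_left' norm_triangle_ineq)
      also have "\<dots> \<le> 1 * \<epsilon> + \<epsilon> * K"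
        unfolding norm_scaleR[of "b (g x)"] norm_scaleR[of "h x - g x"]
        using cx b_range[of "g x"] K[OF inR(2)[OF x]] \<epsilon>(1) by (intro add_mono mult_mono) auto
      also have "\<dots> \<le> \<epsilon> * (2 + \<bar>K\<bar>)"
        using \<epsilon>(1) by (simp add: algebra_simps mult_left_mono add_increasing)
      finally show "norm (Gk x - Gg x) < \<epsilon>1" using \<epsilon>(3) by simp
    qed
    \<comment> \<open>Where \<open>\<bar>g x\<bar> > \<eta>\<close> neither function vanishes, both
      being within \<open>\<epsilon> <= \<eta>\<close> of \<open>g\<close>; elsewhere the bump is 1
      and \<open>k = h\<close>.\<close>
    moreover have "k x = 0 \<longleftrightarrow> h x = 0" if x: "x \<in> ball z0 s2" for x
    proof (cases "\<bar>g x\<bar> \<le> \<eta>")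
      case False
      have "\<bar>h x - g x\<bar> < \<epsilon>" using close x by auto
      then show ?thesis using False k_close[OF x] \<epsilon>(2) by auto
    qed (simp add: k_def b1)
    then have "{x\<in>ball z0 s2. k x = 0} = {x\<in>ball z0 s2. h x = 0}" by blast
    ultimately show "diffeotopic_sets {x\<in>ball z0 s2. g x = 0} {x\<in>ball z0 s2. h x = 0}" by simp
  qed
qed

text \<open>Stability under small \<open>C^1\<close> changes makes the classes of parameters with
  diffeotopic zero sets open in the unit interval, which is connected; hence there is only one
  class. No diffeotopy depending on the homotopy parameter has to be built.\<close>

lemma diffeotopic_zero_sets_of_linear_homotopy:
  fixes f p :: "real^'n::finite \<Rightarrow> real"
  assumes f: "\<And>x. x \<in> ball z0 R \<Longrightarrow> GDERIV f x :> Gf x" and Gf: "continuous_on (ball z0 R) Gf"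
    and p: "\<And>x. x \<in> ball z0 R \<Longrightarrow> GDERIV p x :> Gp x" and Gp: "continuous_on (ball z0 R) Gp"
    and s: "s < R"
    and zeros: "\<And>t x. t \<in> {0..1} \<Longrightarrow> x \<in> ball z0 R \<Longrightarrow> f x + t * (p x - f x) = 0 \<Longrightarrow>
        dist z0 x \<le> s \<and> Gf x + t *\<^sub>R (Gp x - Gf x) \<noteq> 0"
  shows "diffeotopic_sets {x\<in>ball z0 R. p x = 0} {x\<in>ball z0 R. f x = 0}"
proof -
  define F where "F = (\<lambda>t x. f x + t * (p x - f x))"
  define G where "G = (\<lambda>t x. Gf x + t *\<^sub>R (Gp x - Gf x))"
  \<comment> \<open>The functions are controlled in the open ball only and may be unbounded near its
    boundary. On the closed ball of radius \<open>s2\<close> everything is bounded, and it still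
    contains all zeros.\<close>
  define s2 where "s2 = (s + R) / 2"
  have s2: "s < s2" "s2 < R" using s by (auto simp: s2_def)
  have F: "GDERIV (F t) x :> G t x" if "x \<in> ball z0 R" for t x
    unfolding F_def G_def
    using GDERIV_add[OF f GDERIV_mult[OF GDERIV_const GDERIV_diff[OF p f]], OF that that that, of t] by simp
  have G: "continuous_on (ball z0 R) (G t)" for t
    unfolding G_def by (intro continuous_intros Gf Gp)
  have sub: "cball z0 s2 \<subseteq> ball z0 R" "ball z0 s2 \<subseteq> ball z0 R" using s2 by auto
  have fp: "continuous_on (ball z0 R) f" "continuous_on (ball z0 R) p"
    using f p by (meson GDERIV_isCont continuous_at_imp_continuous_on)+
  obtain K1 where K1: "\<And>x. x \<in> cball z0 s2 \<Longrightarrow> norm (p x - f x) \<le> K1"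
    using compact_imp_norm_bound[OF compact_cball continuous_on_subset[OF continuous_on_diff[OF fp(2,1)] sub(1)]]
    by blast
  obtain K2 where K2: "\<And>x. x \<in> cball z0 s2 \<Longrightarrow> norm (Gp x - Gf x) \<le> K2"
    using compact_imp_norm_bound[OF compact_cball continuous_on_subset[OF continuous_on_diff[OF Gp Gf] sub(1)]]
    by blast
  define K where "K = \<bar>K1\<bar> + \<bar>K2\<bar> + 1"
  have K: "K > 0" "\<And>x. x \<in> ball z0 s2 \<Longrightarrow> \<bar>p x - f x\<bar> \<le> K"
      "\<And>x. x \<in> ball z0 s2 \<Longrightarrow> norm (Gp x - Gf x) \<le> K"
  proof -
    show "K > 0" by (simp add: K_def)
    fix x assume "x \<in> ball z0 s2"
    then have "x \<in> cball z0 s2" by simp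
    then show "\<bar>p x - f x\<bar> \<le> K" "norm (Gp x - Gf x) \<le> K"
      using K1[of x] K2[of x] unfolding K_def real_norm_def by linarith+
  qed
  define Z where "Z = (\<lambda>t. {x\<in>ball z0 s2. F t x = 0})"
  have step: "\<exists>T. openin (top_of_set {0..1}) T \<and> t0 \<in> T \<and> (\<forall>t\<in>T. diffeotopic_sets (Z t0) (Z t))"
    if t0: "t0 \<in> {0..1}" for t0
  proof -
    have "\<And>x. x \<in> ball z0 R \<Longrightarrow> F t0 x = 0 \<Longrightarrow> dist z0 x \<le> s \<and> G t0 x \<noteq> 0"
      using zeros[OF t0] by (simp add: F_def G_def)
    from diffeotopic_zero_sets_of_C1_close[OF F G this s2]
    obtain \<epsilon> where \<epsilon>: "\<epsilon> > 0" "\<And>h Gh. \<lbrakk>\<forall>x\<in>ball z0 s2. GDERIV h x :> Gh x; continuous_on (ball z0 s2) Gh;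
        \<forall>x\<in>ball z0 s2. \<bar>h x - F t0 x\<bar> < \<epsilon> \<and> norm (Gh x - G t0 x) < \<epsilon>\<rbrakk> \<Longrightarrow>
        diffeotopic_sets {x\<in>ball z0 s2. F t0 x = 0} {x\<in>ball z0 s2. h x = 0}"
      by blast
    have "diffeotopic_sets (Z t0) (Z t)" if t: "dist t0 t < \<epsilon> / K" for t
      unfolding Z_def
    proof (rule \<epsilon>(2)[of "F t" "G t"]; (intro ballI conjI)?)
      show "continuous_on (ball z0 s2) (G t)" by (rule continuous_on_subset[OF G sub(2)])
      fix x assume x: "x \<in> ball z0 s2"
      then show "GDERIV (F t) x :> G t x" using F sub(2) by blast
      have tK: "\<bar>t - t0\<bar> * K < \<epsilon>" using t K(1) by (simp add: dist_real_def field_simps abs_minus_commute)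
      have "F t x - F t0 x = (t - t0) * (p x - f x)" by (simp add: F_def algebra_simps)
      then have "\<bar>F t x - F t0 x\<bar> \<le> \<bar>t - t0\<bar> * K"
        using K(2)[OF x] by (simp add: abs_mult mult_left_mono)
      then show "\<bar>F t x - F t0 x\<bar> < \<epsilon>" using tK by simp
      have "G t x - G t0 x = (t - t0) *\<^sub>R (Gp x - Gf x)" by (simp add: G_def algebra_simps)
      then have "norm (G t x - G t0 x) \<le> \<bar>t - t0\<bar> * K"
        using K(3)[OF x] by (simp add: mult_left_mono)
      then show "norm (G t x - G t0 x) < \<epsilon>" using tK by simp
    qed
    then show ?thesis
      using \<epsilon>(1) K(1) t0 by (intro exI[of _ "{0..1} \<inter> ball t0 (\<epsilon> / K)"]) (auto intro: openin_open_Int)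
  qed
  have "diffeotopic_sets (Z 1) (Z 0)"
    by (rule connected_equivalence_relation[of "{0..1::real}" 1 0 "\<lambda>t t'. diffeotopic_sets (Z t) (Z t')"])
      (use step diffeotopic_sets_sym diffeotopic_sets_trans in \<open>auto, blast\<close>)
  moreover have "Z 0 = {x\<in>ball z0 R. f x = 0}"
    using zeros[of 0] s2 by (force simp: Z_def F_def)
  moreover have "Z 1 = {x\<in>ball z0 R. p x = 0}"
    using zeros[of 1] s2 by (force simp: Z_def F_def)
  ultimately show ?thesis by simp
qed

section \<open>Calculus on a closed disk\<close>

text \<open>At a boundary point some directions leave the disk. One-sided derivatives along segments
  determine both linear maps on all \<open>y - z\<close> with \<open>y\<close> in the disk. Taking
  \<open>y = z0\<close> and \<open>y = z0 + e *\<^sub>R v\<close> and subtracting reaches every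
  direction \<open>v\<close>.\<close>

lemma has_derivative_within_cball_unique:
  fixes f :: "real^'n::finite \<Rightarrow> real"
  assumes R: "R > 0" and z: "z \<in> cball z0 R"
    and A: "(f has_derivative A) (at z within cball z0 R)"
    and B: "(f has_derivative B) (at z within cball z0 R)"
  shows "A = B"
proof -
  interpret A: bounded_linear A using A by (rule has_derivative_bounded_linear)
  interpret B: bounded_linear B using B by (rule has_derivative_bounded_linear)
  have eq: "A (y - z) = B (y - z)" if y: "y \<in> cball z0 R" for y
  proof -
    define \<gamma> where "\<gamma> = (\<lambda>t::real. z + t *\<^sub>R (y - z))"
    have img: "\<gamma> ` {0..1} \<subseteq> cball z0 R"
    proof (clarify)
      fix t :: real assume "t \<in> {0..1}"
      then have "(1 - t) *\<^sub>R z + t *\<^sub>R y \<in> cball z0 R"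
        using convexD[OF convex_cball z y] by simp
      then show "\<gamma> t \<in> cball z0 R" by (simp add: \<gamma>_def algebra_simps)
    qed
    have \<gamma>: "(\<gamma> has_derivative (\<lambda>h. h *\<^sub>R (y - z))) (at 0 within {0..1})"
      unfolding \<gamma>_def by (auto intro!: derivative_eq_intros)
    have comp: "((\<lambda>t. f (\<gamma> t)) has_derivative (\<lambda>h. C (h *\<^sub>R (y - z)))) (at 0 within {0..1})"
      if "(f has_derivative C) (at z within cball z0 R)" for C
      using has_derivative_in_compose[OF \<gamma>, of f C] has_derivative_subset[OF that img]
      by (simp add: \<gamma>_def)
    have "(\<lambda>h. A (h *\<^sub>R (y - z))) = (\<lambda>h. B (h *\<^sub>R (y - z)))"
    proof (rule frechet_derivative_unique_within[OF comp[OF A] comp[OF B]])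
      fix i e :: real assume i: "i \<in> Basis" and e: "e > 0"
      have "0 < \<bar>min (e/2) 1\<bar> \<and> \<bar>min (e/2) 1\<bar> < e \<and> 0 + min (e/2) 1 *\<^sub>R i \<in> {0..1}"
        using i e by auto
      then show "\<exists>d. 0 < \<bar>d\<bar> \<and> \<bar>d\<bar> < e \<and> 0 + d *\<^sub>R i \<in> {0..1}" by blast
    qed
    from fun_cong[OF this, of 1] show ?thesis by simp
  qed
  have "A v = B v" for v
  proof (cases "v = 0")
    case False
    define e where "e = R / norm v"
    have e: "e > 0" using R False by (simp add: e_def)
    have "z0 + e *\<^sub>R v \<in> cball z0 R" using R False by (simp add: e_def dist_norm)
    from eq[OF this] have "A (z0 - z) + e * A v = B (z0 - z) + e * B v"
      by (simp add: A.diff B.diff A.add B.add A.scaleR B.scaleR)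
    moreover have "A (z0 - z) = B (z0 - z)" using R by (intro eq) simp
    ultimately show ?thesis using e by simp
  qed (simp add: A.zero B.zero)
  then show ?thesis by blast
qed

lemma partial_deriv_eqI:
  fixes f :: "real^'n::finite \<Rightarrow> real"
  assumes "R > 0" "z \<in> cball z0 R" "(f has_derivative A) (at z within cball z0 R)"
  shows "partial_deriv (cball z0 R) i f z = A (axis i 1)"
proof -
  have "(f has_derivative frechet_derivative f (at z within cball z0 R)) (at z within cball z0 R)"
    using assms(3) differentiableI frechet_derivative_works by blast
  then show ?thesis
    using has_derivative_within_cball_unique assms unfolding partial_deriv_def by blast
qed

lemma has_derivative_grad:
  fixes f :: "real^'n::finite \<Rightarrow> real"
  assumes "f differentiable_on D" "z \<in> D"
  shows "(f has_derivative (\<lambda>h. h \<bullet> grad D f z)) (at z within D)"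
proof -
  have d: "(f has_derivative frechet_derivative f (at z within D)) (at z within D)"
    using assms by (simp add: differentiable_on_def flip: frechet_derivative_works)
  then have "frechet_derivative f (at z within D) = (\<lambda>h. h \<bullet> grad D f z)"
    using linear_eq_inner_axis[OF bounded_linear.linear[OF has_derivative_bounded_linear[OF d]]]
    unfolding grad_def partial_deriv_def by blast
  with d show ?thesis by simp
qed

lemma grad_eqI:
  fixes f :: "real^'n::finite \<Rightarrow> real"
  assumes "R > 0" "z \<in> cball z0 R" "(f has_derivative (\<lambda>h. h \<bullet> G)) (at z within cball z0 R)"
  shows "grad (cball z0 R) f z = G"
  by (simp add: grad_def partial_deriv_eqI[OF assms] vec_eq_iff inner_axis' inner_axis)

lemma GDERIV_grad:
  fixes f :: "real^'n::finite \<Rightarrow> real"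
  assumes "f differentiable_on cball z0 R" "z \<in> ball z0 R"
  shows "GDERIV f z :> grad (cball z0 R) f z"
  using has_derivative_grad[OF assms(1), of z] assms(2) at_within_interior[of z "cball z0 R"]
  by (simp add: gderiv_def less_imp_le)

lemma grad_eq_GDERIV:
  fixes f :: "real^'n::finite \<Rightarrow> real"
  assumes "R > 0" "z \<in> cball z0 R" "GDERIV f z :> G"
  shows "grad (cball z0 R) f z = G"
  using assms by (intro grad_eqI) (auto simp: gderiv_def intro: has_derivative_at_withinI)

lemma grad_smaller_cball:
  fixes f :: "real^'n::finite \<Rightarrow> real"
  assumes "f differentiable_on cball z0 R" "0 < r" "r \<le> R" "z \<in> cball z0 r"
  shows "grad (cball z0 r) f z = grad (cball z0 R) f z"
  using assms by (intro grad_eqI has_derivative_subset[OF has_derivative_grad[OF assms(1)]]) auto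

lemma grad_nth: "grad D f z $ i = partial_deriv D i f z"
  by (simp add: grad_def)

lemma grad_diff:
  fixes f g :: "real^'n::finite \<Rightarrow> real"
  assumes "R > 0" "z \<in> cball z0 R" "f differentiable_on cball z0 R" "g differentiable_on cball z0 R"
  shows "grad (cball z0 R) (\<lambda>x. f x - g x) z = grad (cball z0 R) f z - grad (cball z0 R) g z"
  using has_derivative_diff[OF has_derivative_grad[OF assms(3,2)] has_derivative_grad[OF assms(4,2)]]
  by (intro grad_eqI assms) (simp add: inner_diff_right)

section \<open>Differentiability classes on a disk\<close>

lemma partial_deriv_cong:
  assumes "\<And>x. x \<in> D \<Longrightarrow> f x = g x" "z \<in> D"
  shows "partial_deriv D i f z = partial_deriv D i g z"
proof -
  have "(f has_derivative A) (at z within D) \<longleftrightarrow> (g has_derivative A) (at z within D)" for A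
    using assms by (metis has_derivative_transform)
  then show ?thesis unfolding partial_deriv_def frechet_derivative_def by simp
qed

text \<open>\<open>Ck_on\<close> iterates \<open>partial_deriv\<close> as an operation on total
  functions, whereas identities between partial derivatives hold on the disk only.\<close>

lemma Ck_on_cong:
  assumes "\<And>x. x \<in> D \<Longrightarrow> f x = g x"
  shows "Ck_on k D f \<longleftrightarrow> Ck_on k D g"
  using assms
proof (induction k arbitrary: f g)
  case 0
  then show ?case by (simp cong: continuous_on_cong)
next
  case (Suc k)
  have "f differentiable_on D \<longleftrightarrow> g differentiable_on D"
    using Suc.prems unfolding differentiable_on_def differentiable_def
    by (metis has_derivative_transform)
  moreover have "Ck_on k D (partial_deriv D i f) \<longleftrightarrow> Ck_on k D (partial_deriv D i g)" for i
    using partial_deriv_cong Suc.prems by (intro Suc.IH) blast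
  ultimately show ?case by simp
qed

lemma Ck_on_Suc_imp: "Ck_on (Suc k) D f \<Longrightarrow> Ck_on k D f"
  by (induction k arbitrary: f) (auto intro: differentiable_imp_continuous_on)

lemma Ck_on_imp_continuous_on: "Ck_on k D f \<Longrightarrow> continuous_on D f"
  by (cases k) (auto intro: differentiable_imp_continuous_on)

lemma Ck_on_diff:
  fixes f g :: "real^'n::finite \<Rightarrow> real"
  assumes "R > 0" "Ck_on k (cball z0 R) f" "Ck_on k (cball z0 R) g"
  shows "Ck_on k (cball z0 R) (\<lambda>x. f x - g x)"
  using assms(2,3)
proof (induction k arbitrary: f g)
  case 0
  then show ?case by (auto intro: continuous_intros)
next
  case (Suc k)
  have "Ck_on k (cball z0 R) (partial_deriv (cball z0 R) i (\<lambda>x. f x - g x))" for i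
  proof (subst Ck_on_cong)
    show "Ck_on k (cball z0 R)
        (\<lambda>x. partial_deriv (cball z0 R) i f x - partial_deriv (cball z0 R) i g x)"
      using Suc.prems by (intro Suc.IH) auto
    show "partial_deriv (cball z0 R) i (\<lambda>x. f x - g x) x =
        partial_deriv (cball z0 R) i f x - partial_deriv (cball z0 R) i g x"
      if "x \<in> cball z0 R" for x
      using grad_diff[OF assms(1) that, of f g] Suc.prems by (simp flip: grad_nth)
  qed
  then show ?case using Suc.prems by auto
qed

lemma Ck_on_smaller_cball:
  fixes f :: "real^'n::finite \<Rightarrow> real"
  assumes "0 < r" "r \<le> R" "Ck_on k (cball z0 R) f"
  shows "Ck_on k (cball z0 r) f"
  using assms(3)
proof (induction k arbitrary: f)
  case 0
  then show ?case using assms(1,2) by (auto elim!: continuous_on_subset)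
next
  case (Suc k)
  have "Ck_on k (cball z0 r) (partial_deriv (cball z0 r) i f)" for i
  proof (subst Ck_on_cong)
    show "Ck_on k (cball z0 r) (partial_deriv (cball z0 R) i f)"
      using Suc.prems by (intro Suc.IH) auto
    show "partial_deriv (cball z0 r) i f x = partial_deriv (cball z0 R) i f x"
      if "x \<in> cball z0 r" for x
      using grad_smaller_cball[OF _ assms(1,2) that, of f] Suc.prems by (simp flip: grad_nth)
  qed
  moreover have "f differentiable_on cball z0 r"
    using Suc.prems assms(1,2) by (auto elim!: differentiable_on_subset)
  ultimately show ?case by simp
qed

lemma Ck_on_real_polynomial_function:
  fixes p :: "real^'n::finite \<Rightarrow> real"
  assumes "R > 0" "real_polynomial_function p"
  shows "Ck_on k (cball z0 R) p"
  using assms(2)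
proof (induction k arbitrary: p)
  case 0
  then show ?case by (simp add: continuous_on_real_polynomial_function)
next
  case (Suc k)
  obtain G where G: "\<And>x. GDERIV p x :> G x" "\<And>i. real_polynomial_function (\<lambda>x. G x $ i)"
    using real_polynomial_function_gradient[OF Suc.prems] by blast
  have "Ck_on k (cball z0 R) (partial_deriv (cball z0 R) i p)" for i
  proof (subst Ck_on_cong)
    show "Ck_on k (cball z0 R) (\<lambda>x. G x $ i)" by (rule Suc.IH[OF G(2)])
    show "partial_deriv (cball z0 R) i p x = G x $ i" if "x \<in> cball z0 R" for x
      using grad_eq_GDERIV[OF assms(1) that G(1)] by (simp flip: grad_nth)
  qed
  then show ?case
    using Suc.prems by (simp add: differentiable_on_real_polynomial_function)
qed

lemma continuous_on_grad:
  assumes "Ck_on (Suc k) D f"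
  shows "continuous_on D (grad D f)"
  unfolding grad_def using assms
  by (intro continuous_on_vec_lambda) (auto intro: Ck_on_imp_continuous_on)

section \<open>Derivatives indexed by lists and multi-indices\<close>

lemma iter_partial_deriv_append:
  "iter_partial_deriv D (is @ js) f = iter_partial_deriv D is (iter_partial_deriv D js f)"
  by (induction "is") auto

lemma continuous_on_iter_partial_deriv:
  "Ck_on k D f \<Longrightarrow> length is \<le> k \<Longrightarrow> continuous_on D (iter_partial_deriv D is f)"
proof (induction "is" arbitrary: k f rule: rev_induct)
  case Nil
  then show ?case by (simp add: Ck_on_imp_continuous_on)
next
  case (snoc i "is")
  then obtain k' where "k = Suc k'" by (cases k) auto
  then show ?case using snoc.IH[of k' "partial_deriv D i f"] snoc.prems
    by (simp add: iter_partial_deriv_append)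
qed

lemma multi_partial_deriv_list:
  "\<exists>is. (\<forall>i. count_list is i = \<alpha> i) \<and> multi_partial_deriv D \<alpha> f = iter_partial_deriv D is f"
  using someI_ex[OF ex_multi_index_list[of \<alpha>]] unfolding multi_partial_deriv_def by blast

lemma length_eq_sum_count_list:
  fixes xs :: "'n::finite list"
  shows "length xs = (\<Sum>i\<in>UNIV. count_list xs i)"
  by (simp add: sum_count_set)

lemma continuous_on_multi_partial_deriv:
  assumes "Ck_on k D f" "(\<Sum>i\<in>UNIV. \<alpha> i) \<le> k"
  shows "continuous_on D (multi_partial_deriv D \<alpha> f)"
proof -
  obtain "is" where "\<forall>i. count_list is i = \<alpha> i" "multi_partial_deriv D \<alpha> f = iter_partial_deriv D is f"
    using multi_partial_deriv_list by blast
  then show ?thesis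
    using continuous_on_iter_partial_deriv[OF assms(1), of "is"] assms(2)
    by (simp add: length_eq_sum_count_list)
qed

text \<open>A multi-index supported in one coordinate is represented by a single list, so the
  arbitrary choice of an order is harmless and no symmetry of second derivatives is used.\<close>

lemma multi_partial_deriv_single:
  fixes i :: "'n::finite"
  shows "multi_partial_deriv D (\<lambda>j. if j = i then k else 0) f = iter_partial_deriv D (replicate k i) f"
proof -
  obtain "is" where "is": "\<forall>j. count_list is j = (if j = i then k else 0)"
    "multi_partial_deriv D (\<lambda>j. if j = i then k else 0) f = iter_partial_deriv D is f"
    using multi_partial_deriv_list[of "\<lambda>j. if j = i then k else 0" D f] by blast
  have "length is = k" using "is"(1) by (simp add: length_eq_sum_count_list)
  moreover have "j = i" if "j \<in> set is" for j
    using "is"(1) that by (metis count_list_0_iff)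
  ultimately have "is = replicate k i" by (metis replicate_length_same)
  then show ?thesis using "is"(2) by simp
qed

lemma multi_indices_0: "{\<alpha> :: 'n::finite \<Rightarrow> nat. (\<Sum>i\<in>UNIV. \<alpha> i) \<le> 0} = {\<lambda>_. 0}"
  by auto

lemma multi_indices_1:
  "{\<alpha> :: 'n::finite \<Rightarrow> nat. (\<Sum>i\<in>UNIV. \<alpha> i) \<le> 1}
    = insert (\<lambda>_. 0) (range (\<lambda>i j. if j = i then 1 else 0))"
proof (intro equalityI subsetI)
  fix \<alpha> :: "'n \<Rightarrow> nat" assume "\<alpha> \<in> {\<alpha>. (\<Sum>i\<in>UNIV. \<alpha> i) \<le> 1}"
  then have le: "(\<Sum>i\<in>UNIV. \<alpha> i) \<le> 1" by simp
  show "\<alpha> \<in> insert (\<lambda>_. 0) (range (\<lambda>i j. if j = i then 1 else 0))"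
  proof (cases "\<alpha> = (\<lambda>_. 0)")
    case False
    then obtain i where i: "\<alpha> i \<noteq> 0" by auto
    have "(\<Sum>i\<in>UNIV. \<alpha> i) = \<alpha> i + (\<Sum>j\<in>UNIV - {i}. \<alpha> j)" by (simp add: sum.remove)
    then have "\<alpha> i = 1" "(\<Sum>j\<in>UNIV - {i}. \<alpha> j) = 0" using le i by linarith+
    then have "\<alpha> j = (if j = i then 1 else 0)" for j by (cases "j = i") auto
    then have "\<alpha> = (\<lambda>j. if j = i then 1 else 0)" by blast
    then show ?thesis by blast
  qed simp
next
  fix \<alpha> :: "'n \<Rightarrow> nat" assume "\<alpha> \<in> insert (\<lambda>_. 0) (range (\<lambda>i j. if j = i then 1 else 0))"
  then show "\<alpha> \<in> {\<alpha>. (\<Sum>i\<in>UNIV. \<alpha> i) \<le> 1}" by auto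
qed

lemma multi_partial_deriv_0: "multi_partial_deriv D (\<lambda>_. 0) f = f"
  using multi_partial_deriv_single[of D undefined 0 f] by simp

text \<open>Links the norm to \<open>delta\<close>: the quantity whose supremum is
  \<open>C_norm 1\<close> is the one whose infimum enters \<open>delta\<close>, up to the square
  root.\<close>

lemma sum_multi_indices_1:
  fixes f :: "real^'n::finite \<Rightarrow> real"
  shows "(\<Sum>\<alpha> | (\<Sum>i\<in>UNIV. \<alpha> i) \<le> 1. (multi_partial_deriv D \<alpha> f z)\<^sup>2)
      = (f z)\<^sup>2 + (norm (grad D f z))\<^sup>2"
proof -
  let ?e = "\<lambda>(i::'n) j. if j = i then 1 else 0::nat"
  have notin: "(\<lambda>_. 0) \<notin> range ?e"
  proof
    assume "(\<lambda>_. 0) \<in> range ?e"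
    then obtain i where "(\<lambda>_. 0) = ?e i" by blast
    from fun_cong[OF this, of i] show False by simp
  qed
  have inj: "inj ?e"
  proof (rule injI)
    fix i j assume "?e i = ?e j"
    from fun_cong[OF this, of i] show "i = j" by (simp split: if_splits)
  qed
  have "(\<Sum>\<alpha> | (\<Sum>i\<in>UNIV. \<alpha> i) \<le> 1. (multi_partial_deriv D \<alpha> f z)\<^sup>2)
      = (f z)\<^sup>2 + (\<Sum>i\<in>UNIV. (multi_partial_deriv D (?e i) f z)\<^sup>2)"
    unfolding multi_indices_1 using notin
    by (simp add: sum.reindex[OF inj] multi_partial_deriv_0)
  also have "(\<Sum>i\<in>UNIV. (multi_partial_deriv D (?e i) f z)\<^sup>2) = (norm (grad D f z))\<^sup>2"
    unfolding power2_norm_eq_inner inner_vec_def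
    by (simp add: multi_partial_deriv_single grad_nth power2_eq_square)
  finally show ?thesis .
qed

section \<open>Bounds for the norms and for \<open>delta\<close>\<close>

lemma C_norm_upper:
  fixes f :: "real^'n::finite \<Rightarrow> real"
  assumes "Ck_on l D f" "compact D" "z \<in> D"
  shows "sqrt (\<Sum>\<alpha> | (\<Sum>i\<in>UNIV. \<alpha> i) \<le> l. (multi_partial_deriv D \<alpha> f z)\<^sup>2) \<le> C_norm l D f"
  unfolding C_norm_def
proof (rule cSUP_upper[OF assms(3)])
  have "continuous_on D (\<lambda>z. sqrt (\<Sum>\<alpha> | (\<Sum>i\<in>UNIV. \<alpha> i) \<le> l. (multi_partial_deriv D \<alpha> f z)\<^sup>2))"
    using continuous_on_multi_partial_deriv[OF assms(1)]
    by (intro continuous_intros) auto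
  then have "compact ((\<lambda>z. sqrt (\<Sum>\<alpha> | (\<Sum>i\<in>UNIV. \<alpha> i) \<le> l. (multi_partial_deriv D \<alpha> f z)\<^sup>2)) ` D)"
    using assms(2) by (intro compact_continuous_image)
  then show "bdd_above ((\<lambda>z. sqrt (\<Sum>\<alpha> | (\<Sum>i\<in>UNIV. \<alpha> i) \<le> l. (multi_partial_deriv D \<alpha> f z)\<^sup>2)) ` D)"
    by (intro bounded_imp_bdd_above compact_imp_bounded)
qed

lemma C_norm_ge_gradient:
  fixes f :: "real^'n::finite \<Rightarrow> real"
  assumes "Ck_on l D f" "compact D" "z \<in> D" "l \<ge> 1"
  shows "sqrt ((f z)\<^sup>2 + (norm (grad D f z))\<^sup>2) \<le> C_norm l D f"
proof -
  have "(f z)\<^sup>2 + (norm (grad D f z))\<^sup>2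
      \<le> (\<Sum>\<alpha> | (\<Sum>i\<in>UNIV. \<alpha> i) \<le> l. (multi_partial_deriv D \<alpha> f z)\<^sup>2)"
    unfolding sum_multi_indices_1[symmetric]
    using assms(4) finite_multi_indices by (intro sum_mono2) auto
  from order_trans[OF real_sqrt_le_mono[OF this] C_norm_upper[OF assms(1-3)]] show ?thesis .
qed

lemma C_norm_0_ge:
  fixes f :: "real^'n::finite \<Rightarrow> real"
  assumes "Ck_on 0 D f" "compact D" "z \<in> D"
  shows "\<bar>f z\<bar> \<le> C_norm 0 D f"
  using C_norm_upper[OF assms] unfolding multi_indices_0 by (simp add: multi_partial_deriv_0)

lemma C_norm_2_ge_second_partial:
  fixes f :: "real^'n::finite \<Rightarrow> real"
  assumes "Ck_on 2 D f" "compact D" "z \<in> D"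
  shows "\<bar>partial_deriv D i (partial_deriv D i f) z\<bar> \<le> C_norm 2 D f"
proof -
  let ?e = "\<lambda>j. if j = i then 2 else 0::nat"
  have "(multi_partial_deriv D ?e f z)\<^sup>2
      \<le> (\<Sum>\<alpha> | (\<Sum>i\<in>UNIV. \<alpha> i) \<le> 2. (multi_partial_deriv D \<alpha> f z)\<^sup>2)"
    by (intro member_le_sum finite_multi_indices) auto
  from real_sqrt_le_mono[OF this] show ?thesis
    using C_norm_upper[OF assms] by (simp add: multi_partial_deriv_single numeral_2_eq_2)
qed

lemma C_norm_1_le:
  fixes f :: "real^'n::finite \<Rightarrow> real"
  assumes "D \<noteq> {}" "\<And>z. z \<in> D \<Longrightarrow> sqrt ((f z)\<^sup>2 + (norm (grad D f z))\<^sup>2) \<le> B"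
  shows "C_norm 1 D f \<le> B"
  unfolding C_norm_def sum_multi_indices_1 using assms by (intro cSUP_least)

lemma delta_le:
  fixes f :: "real^'n::finite \<Rightarrow> real"
  assumes "R > 0" "z \<in> cball z0 R"
  shows "delta f z0 R \<le> sqrt ((f z)\<^sup>2 + (norm (grad (cball z0 R) f z))\<^sup>2)"
  unfolding delta_def using assms
  by (intro min.coboundedI1 cINF_lower bdd_belowI2[of _ 0]) auto

lemma delta_le_sphere:
  fixes f :: "real^'n::finite \<Rightarrow> real"
  assumes "z \<in> sphere z0 R"
  shows "delta f z0 R \<le> sqrt ((f z)\<^sup>2 + (norm (sphere_grad z0 R f z))\<^sup>2)"
  unfolding delta_def using assms
  by (intro min.coboundedI2 cINF_lower bdd_belowI2[of _ 0]) auto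

text \<open>On the sphere the tangential gradient is dropped from the lower bound, which loses
  nothing essential for functions without zeros there.\<close>

lemma delta_ge:
  fixes f :: "real^'n::finite \<Rightarrow> real"
  assumes "R > 0" "\<And>z. z \<in> cball z0 R \<Longrightarrow> b \<le> sqrt ((f z)\<^sup>2 + (norm (grad (cball z0 R) f z))\<^sup>2)"
    "\<And>z. z \<in> sphere z0 R \<Longrightarrow> b \<le> \<bar>f z\<bar>"
  shows "b \<le> delta f z0 R"
proof -
  have "b \<le> sqrt ((f z)\<^sup>2 + (norm (sphere_grad z0 R f z))\<^sup>2)" if "z \<in> sphere z0 R" for z
    using assms(3)[OF that] by (intro order_trans[OF assms(3)[OF that]] real_le_rsqrt) auto
  then show ?thesis
    unfolding delta_def using assms(1,2) sphere_eq_empty[of z0 R]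
    by (intro min.boundedI cINF_greatest) auto
qed

section \<open>Polynomials in several variables\<close>

definition monomial_eval :: "('n \<Rightarrow>\<^sub>0 nat) \<Rightarrow> real^'n::finite \<Rightarrow> real" where
  "monomial_eval m x = (\<Prod>i\<in>UNIV. x $ i ^ Poly_Mapping.lookup m i)"

lemma mpoly_eval_superset:
  assumes "finite S" "Poly_Mapping.keys p \<subseteq> S"
  shows "mpoly_eval p x = (\<Sum>m\<in>S. Poly_Mapping.lookup p m * monomial_eval m x)"
  unfolding mpoly_eval_def monomial_eval_def
  by (rule sum.mono_neutral_left) (use assms in \<open>auto simp: in_keys_iff\<close>)

lemma mpoly_degree_le_iff:
  "mpoly_degree p \<le> d \<longleftrightarrow> (\<forall>m\<in>Poly_Mapping.keys p. (\<Sum>i\<in>UNIV. Poly_Mapping.lookup m i) \<le> d)"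
  unfolding mpoly_degree_def by (subst Max_le_iff) auto

lemma mpoly_eval_add: "mpoly_eval (p + q) x = mpoly_eval p x + mpoly_eval q x"
proof -
  let ?S = "Poly_Mapping.keys p \<union> Poly_Mapping.keys q"
  have "Poly_Mapping.keys (p + q) \<subseteq> ?S" by (rule keys_add)
  then show ?thesis
    by (simp add: mpoly_eval_superset[of ?S] lookup_add sum.distrib distrib_right)
qed

lemma mpoly_eval_single: "mpoly_eval (Poly_Mapping.single m c) x = c * monomial_eval m x"
  by (subst mpoly_eval_superset[of "{m}"]) auto

text \<open>A predicate on functions: only values and degree bounds matter later, and a product can
  be expanded monomial by monomial without evaluating the product of coefficient mappings.\<close>

definition polynomial_of_degree_le :: "nat \<Rightarrow> (real^'n::finite \<Rightarrow> real) \<Rightarrow> bool" where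
  "polynomial_of_degree_le d f \<longleftrightarrow> (\<exists>q. mpoly_degree q \<le> d \<and> (\<forall>x. mpoly_eval q x = f x))"

lemma polynomial_of_degree_le_mono:
  "polynomial_of_degree_le d f \<Longrightarrow> d \<le> d' \<Longrightarrow> polynomial_of_degree_le d' f"
  unfolding polynomial_of_degree_le_def using order_trans by blast

lemma polynomial_of_degree_le_mpoly: "polynomial_of_degree_le (mpoly_degree q) (mpoly_eval q)"
  unfolding polynomial_of_degree_le_def by blast

lemma polynomial_of_degree_le_monomial:
  "polynomial_of_degree_le (\<Sum>i\<in>UNIV. Poly_Mapping.lookup m i) (\<lambda>x. c * monomial_eval m x)"
  unfolding polynomial_of_degree_le_def
  by (rule exI[of _ "Poly_Mapping.single m c"]) (auto simp: mpoly_eval_single mpoly_degree_le_iff)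

lemma polynomial_of_degree_le_const: "polynomial_of_degree_le d (\<lambda>x :: real^'n::finite. c)"
proof -
  have "polynomial_of_degree_le 0 (\<lambda>x :: real^'n. c)"
    using polynomial_of_degree_le_monomial[of "0 :: 'n \<Rightarrow>\<^sub>0 nat" c] by (simp add: monomial_eval_def)
  then show ?thesis by (rule polynomial_of_degree_le_mono) simp
qed

lemma polynomial_of_degree_le_coordinate: "polynomial_of_degree_le 1 (\<lambda>x :: real^'n::finite. x $ i)"
proof -
  have "polynomial_of_degree_le 1 (\<lambda>x. 1 * monomial_eval (Poly_Mapping.single i 1) x)"
    using polynomial_of_degree_le_monomial[of "Poly_Mapping.single i 1" 1] by (simp add: lookup_single when_def)
  moreover have "monomial_eval (Poly_Mapping.single i 1) x = x $ i" for x :: "real^'n"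
  proof -
    have "monomial_eval (Poly_Mapping.single i 1) x = (\<Prod>j\<in>UNIV. if j = i then x $ i else 1)"
      unfolding monomial_eval_def by (intro prod.cong) (auto simp: lookup_single when_def)
    then show ?thesis by simp
  qed
  ultimately show ?thesis by simp
qed

lemma polynomial_of_degree_le_add:
  assumes "polynomial_of_degree_le d f" "polynomial_of_degree_le d g"
  shows "polynomial_of_degree_le d (\<lambda>x. f x + g x)"
proof -
  obtain p q where "mpoly_degree p \<le> d" "\<And>x. mpoly_eval p x = f x"
    "mpoly_degree q \<le> d" "\<And>x. mpoly_eval q x = g x"
    using assms unfolding polynomial_of_degree_le_def by blast
  then show ?thesis
    unfolding polynomial_of_degree_le_def using keys_add[of p q]
    by (intro exI[of _ "p + q"]) (auto simp: mpoly_eval_add mpoly_degree_le_iff)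
qed

lemma polynomial_of_degree_le_sum:
  assumes "finite S" "\<And>m. m \<in> S \<Longrightarrow> polynomial_of_degree_le d (f m)"
  shows "polynomial_of_degree_le d (\<lambda>x. \<Sum>m\<in>S. f m x)"
  using assms
  by (induction S) (auto intro: polynomial_of_degree_le_const polynomial_of_degree_le_add)

lemma monomial_eval_add: "monomial_eval (m + m') x = monomial_eval m x * monomial_eval m' x"
  by (simp add: monomial_eval_def lookup_add power_add prod.distrib)

lemma polynomial_of_degree_le_mult:
  assumes "polynomial_of_degree_le d f" "polynomial_of_degree_le d' g"
  shows "polynomial_of_degree_le (d + d') (\<lambda>x. f x * g x)"
proof -
  obtain p q where p: "mpoly_degree p \<le> d" "\<And>x. mpoly_eval p x = f x"
    and q: "mpoly_degree q \<le> d'" "\<And>x. mpoly_eval q x = g x"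
    using assms unfolding polynomial_of_degree_le_def by blast
  let ?c = "\<lambda>m m'. Poly_Mapping.lookup p m * Poly_Mapping.lookup q m'"
  have "f x * g x = (\<Sum>m\<in>Poly_Mapping.keys p. \<Sum>m'\<in>Poly_Mapping.keys q. ?c m m' * monomial_eval (m + m') x)" for x
    unfolding p(2)[symmetric] q(2)[symmetric] mpoly_eval_superset[OF finite_keys order_refl]
      sum_product monomial_eval_add by (intro sum.cong refl) (simp add: algebra_simps)
  moreover have "polynomial_of_degree_le (d + d') (\<lambda>x. ?c m m' * monomial_eval (m + m') x)"
    if "m \<in> Poly_Mapping.keys p" "m' \<in> Poly_Mapping.keys q" for m m'
    using p(1) q(1) that unfolding mpoly_degree_le_iff
    by (intro polynomial_of_degree_le_mono[OF polynomial_of_degree_le_monomial])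
      (auto simp: lookup_add sum.distrib intro: add_mono)
  ultimately show ?thesis
    by (simp add: polynomial_of_degree_le_sum)
qed

lemma polynomial_of_degree_le_prod:
  assumes "finite S" "\<And>i. i \<in> S \<Longrightarrow> polynomial_of_degree_le (d i) (f i)"
  shows "polynomial_of_degree_le (\<Sum>i\<in>S. d i) (\<lambda>x. \<Prod>i\<in>S. f i x)"
  using assms
  by (induction S) (auto intro: polynomial_of_degree_le_const polynomial_of_degree_le_mult)

lemma polynomial_of_degree_le_power:
  assumes "polynomial_of_degree_le d f"
  shows "polynomial_of_degree_le (k * d) (\<lambda>x. f x ^ k)"
  using polynomial_of_degree_le_prod[of "{..<k}" "\<lambda>_. d" "\<lambda>_. f"] assms by simp

lemma polynomial_of_degree_le_coordinate_diff:
  "polynomial_of_degree_le 1 (\<lambda>x :: real^'n::finite. x $ i - c)"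
  using polynomial_of_degree_le_add[OF polynomial_of_degree_le_coordinate polynomial_of_degree_le_const, of i "- c"]
  by simp

text \<open>The growth estimate concerns disks centered at the origin; the approximating polynomial
  lives on a disk centered at \<open>z0\<close>.\<close>

lemma polynomial_of_degree_le_translate:
  fixes q :: "'n::finite real_mpoly"
  shows "polynomial_of_degree_le (mpoly_degree q) (\<lambda>x. mpoly_eval q (x + z))"
  unfolding mpoly_eval_superset[OF finite_keys order_refl] monomial_eval_def
proof (rule polynomial_of_degree_le_sum)
  fix m assume m: "m \<in> Poly_Mapping.keys q"
  have "polynomial_of_degree_le 1 (\<lambda>x :: real^'n. (x + z) $ i)" for i
    using polynomial_of_degree_le_coordinate_diff[of i "- z $ i"] by simp
  from polynomial_of_degree_le_power[OF this]
  have "polynomial_of_degree_le (0 + (\<Sum>i\<in>UNIV. Poly_Mapping.lookup m i))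
      (\<lambda>x. Poly_Mapping.lookup q m * (\<Prod>i\<in>UNIV. (x + z) $ i ^ Poly_Mapping.lookup m i))"
    by (intro polynomial_of_degree_le_mult polynomial_of_degree_le_const polynomial_of_degree_le_prod) auto
  then show "polynomial_of_degree_le (mpoly_degree q)
      (\<lambda>x. Poly_Mapping.lookup q m * (\<Prod>i\<in>UNIV. (x + z) $ i ^ Poly_Mapping.lookup m i))"
    using m mpoly_degree_le_iff[of q "mpoly_degree q"]
    by (elim polynomial_of_degree_le_mono) simp
qed simp

lemma polynomial_of_degree_le_norm_power2:
  "polynomial_of_degree_le 2 (\<lambda>x :: real^'n::finite. (norm (x - z))\<^sup>2)"
proof -
  have "polynomial_of_degree_le (2 * 1) (\<lambda>x :: real^'n. (x $ i - z $ i)\<^sup>2)" for i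
    by (rule polynomial_of_degree_le_power[OF polynomial_of_degree_le_coordinate_diff])
  then have "polynomial_of_degree_le 2 (\<lambda>x :: real^'n. \<Sum>i\<in>UNIV. (x $ i - z $ i)\<^sup>2)"
    by (intro polynomial_of_degree_le_sum) auto
  then show ?thesis
    unfolding power2_norm_eq_inner inner_vec_def by (simp add: power2_eq_square)
qed

lemma real_polynomial_function_mpoly_eval: "real_polynomial_function (mpoly_eval q)"
  unfolding mpoly_eval_def
  by (intro real_polynomial_function_sum real_polynomial_function.intros(4)
      real_polynomial_function.intros(2) real_polynomial_function_prod real_polynomial_function_power
      real_polynomial_function.intros(1) bounded_linear_vec_nth) auto

text \<open>Replacing each coordinate by the linear polynomial \<open>[:y $ i, v $ i:]\<close>
  reduces questions about quadratics and about dimension one to univariate polynomials.\<close>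

lemma mpoly_eval_on_line:
  fixes q :: "'n::finite real_mpoly"
  shows "\<exists>P. degree P \<le> mpoly_degree q \<and> (\<forall>t. poly P t = mpoly_eval q (y + t *\<^sub>R v))"
proof -
  define P where "P = (\<Sum>m\<in>Poly_Mapping.keys q. smult (Poly_Mapping.lookup q m)
      (\<Prod>i\<in>UNIV. [:y $ i, v $ i:] ^ Poly_Mapping.lookup m i))"
  have "poly P t = mpoly_eval q (y + t *\<^sub>R v)" for t
    by (simp add: P_def mpoly_eval_def poly_sum poly_prod)
  moreover have "degree P \<le> mpoly_degree q"
    unfolding P_def
  proof (rule degree_sum_le)
    fix m assume m: "m \<in> Poly_Mapping.keys q"
    have "degree (\<Prod>i\<in>UNIV. [:y $ i, v $ i:] ^ Poly_Mapping.lookup m i)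
        \<le> (\<Sum>i\<in>UNIV. degree ([:y $ i, v $ i:] ^ Poly_Mapping.lookup m i))"
      using degree_prod_sum_le[of UNIV "\<lambda>i. [:y $ i, v $ i:] ^ Poly_Mapping.lookup m i"] by (simp add: o_def)
    also have "\<dots> \<le> (\<Sum>i\<in>UNIV. Poly_Mapping.lookup m i)"
    proof (rule sum_mono)
      fix i
      have "degree ([:y $ i, v $ i:] ^ Poly_Mapping.lookup m i) \<le> degree [:y $ i, v $ i:] * Poly_Mapping.lookup m i"
        by (rule degree_power_le)
      also have "\<dots> \<le> 1 * Poly_Mapping.lookup m i" by (intro mult_right_mono) auto
      finally show "degree ([:y $ i, v $ i:] ^ Poly_Mapping.lookup m i) \<le> Poly_Mapping.lookup m i" by simp
    qed
    also have "\<dots> \<le> mpoly_degree q" using m mpoly_degree_le_iff[of q "mpoly_degree q"] by simp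
    finally show "degree (smult (Poly_Mapping.lookup q m)
        (\<Prod>i\<in>UNIV. [:y $ i, v $ i:] ^ Poly_Mapping.lookup m i)) \<le> mpoly_degree q"
      using degree_smult_le order_trans by blast
  qed simp
  ultimately show ?thesis by blast
qed

section \<open>A lower bound for the Weierstrass constant\<close>

text \<open>Writing the cosine as a sine with phase shifted by \<open>pi / 2\<close> keeps the
  family closed under differentiation, so that iterated derivatives follow by induction.\<close>

lemma partial_deriv_sin_ridge:
  fixes z0 :: "real^'n::finite"
  assumes "R > 0" "z \<in> cball z0 R"
  shows "partial_deriv (cball z0 R) j (\<lambda>x. c * sin (a + \<omega> * x $ i)) z
    = (if j = i then c * \<omega> else 0) * sin (a + pi / 2 + \<omega> * z $ i)"
proof -
  have "((\<lambda>x. c * sin (a + \<omega> * x $ i)) has_derivative (\<lambda>h. c * (cos (a + \<omega> * z $ i) * (\<omega> * h $ i))))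
      (at z within cball z0 R)"
    by (auto intro!: derivative_eq_intros bounded_linear_imp_has_derivative bounded_linear_vec_nth)
  from partial_deriv_eqI[OF assms this] show ?thesis
    by (simp add: axis_def sin_add cos_add)
qed

lemma differentiable_on_sin_ridge:
  "(\<lambda>x :: real^'n::finite. c * sin (a + \<omega> * x $ i)) differentiable_on D"
proof -
  have "((\<lambda>x :: real^'n. c * sin (a + \<omega> * x $ i)) has_derivative (\<lambda>h. c * (cos (a + \<omega> * z $ i) * (\<omega> * h $ i))))
      (at z within D)" for z
    by (auto intro!: derivative_eq_intros bounded_linear_imp_has_derivative bounded_linear_vec_nth)
  then show ?thesis unfolding differentiable_on_def differentiable_def by blast
qed

lemma Ck_on_sin_ridge:
  fixes z0 :: "real^'n::finite"
  assumes "R > 0"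
  shows "Ck_on k (cball z0 R) (\<lambda>x. c * sin (a + \<omega> * x $ i))"
proof (induction k arbitrary: c a)
  case 0
  then show ?case
    using differentiable_on_sin_ridge differentiable_imp_continuous_on by fastforce
next
  case (Suc k)
  have "Ck_on k (cball z0 R) (partial_deriv (cball z0 R) j (\<lambda>x. c * sin (a + \<omega> * x $ i)))" for j
    by (rule iffD2[OF Ck_on_cong[OF partial_deriv_sin_ridge[OF assms]] Suc.IH])
  then show ?case by (simp add: differentiable_on_sin_ridge)
qed

lemma iter_partial_deriv_sin_ridge:
  fixes z0 :: "real^'n::finite"
  assumes "R > 0" "z \<in> cball z0 R"
  shows "iter_partial_deriv (cball z0 R) is (\<lambda>x. c * sin (a + \<omega> * x $ i)) z
    = (if set is \<subseteq> {i} then c * \<omega> ^ length is else 0) * sin (a + real (length is) * pi / 2 + \<omega> * z $ i)"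
  using assms(2)
proof (induction "is" arbitrary: z)
  case (Cons j "is")
  let ?c = "if set is \<subseteq> {i} then c * \<omega> ^ length is else 0"
  have "iter_partial_deriv (cball z0 R) (j # is) (\<lambda>x. c * sin (a + \<omega> * x $ i)) z
      = partial_deriv (cball z0 R) j (\<lambda>x. ?c * sin (a + real (length is) * pi / 2 + \<omega> * x $ i)) z"
    unfolding iter_partial_deriv.simps by (rule partial_deriv_cong[OF Cons.IH Cons.prems])
  also have "\<dots> = (if j = i then ?c * \<omega> else 0) * sin (a + real (length is) * pi / 2 + pi / 2 + \<omega> * z $ i)"
    using partial_deriv_sin_ridge[OF assms(1) Cons.prems] .
  also have "a + real (length is) * pi / 2 + pi / 2 = a + real (length (j # is)) * pi / 2"
    by (simp add: field_simps)
  finally show ?case by (auto simp del: iter_partial_deriv.simps)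
qed simp

text \<open>With the factor \<open>1 / \<omega>\<^sup>2\<close> the pure second derivative in
  direction \<open>i\<close> is bounded by 1, and every other derivative of order at most two by
  \<open>1 / \<omega>\<close>; those in other directions vanish.\<close>

lemma C_norm_2_sin_ridge_le:
  fixes z0 :: "real^'n::finite"
  assumes R: "R > 0" and \<omega>: "\<omega> \<ge> 1"
  shows "C_norm 2 (cball z0 R) (\<lambda>x. 1 / \<omega>\<^sup>2 * sin (a + \<omega> * x $ i))
    \<le> sqrt (1 + card {\<alpha> :: 'n \<Rightarrow> nat. (\<Sum>i\<in>UNIV. \<alpha> i) \<le> 2} / \<omega>\<^sup>2)"
proof -
  let ?g = "\<lambda>x :: real^'n. 1 / \<omega>\<^sup>2 * sin (a + \<omega> * x $ i)"
  let ?A = "{\<alpha> :: 'n \<Rightarrow> nat. (\<Sum>i\<in>UNIV. \<alpha> i) \<le> 2}"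
  let ?e = "\<lambda>j. if j = i then 2 else 0::nat"
  have "(\<Sum>\<alpha>\<in>?A. (multi_partial_deriv (cball z0 R) \<alpha> ?g z)\<^sup>2) \<le> 1 + card ?A / \<omega>\<^sup>2" if z: "z \<in> cball z0 R" for z
  proof -
    have e: "?e \<in> ?A" by simp
    have "(\<Sum>\<alpha>\<in>?A. (multi_partial_deriv (cball z0 R) \<alpha> ?g z)\<^sup>2)
        = (multi_partial_deriv (cball z0 R) ?e ?g z)\<^sup>2
          + (\<Sum>\<alpha>\<in>?A - {?e}. (multi_partial_deriv (cball z0 R) \<alpha> ?g z)\<^sup>2)"
      by (rule sum.remove[OF finite_multi_indices e])
    also have "\<dots> \<le> 1 + (\<Sum>\<alpha>\<in>?A - {?e}. 1 / \<omega>\<^sup>2)"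
    proof (intro add_mono sum_mono)
      show "(multi_partial_deriv (cball z0 R) ?e ?g z)\<^sup>2 \<le> 1"
      proof -
        have "multi_partial_deriv (cball z0 R) ?e ?g z = 1 * sin (a + real (length (replicate 2 i)) * pi / 2 + \<omega> * z $ i)"
          unfolding multi_partial_deriv_single iter_partial_deriv_sin_ridge[OF R z]
          by (rule arg_cong[of _ _ "\<lambda>u. u * sin (a + real (length (replicate 2 i)) * pi / 2 + \<omega> * z $ i)"])
            (use \<omega> in auto)
        then show ?thesis by (simp only: mult_1 abs_square_le_1 abs_sin_le_one)
      qed
      fix \<alpha> assume \<alpha>: "\<alpha> \<in> ?A - {?e}"
      obtain "is" where "is": "\<forall>j. count_list is j = \<alpha> j"
        "multi_partial_deriv (cball z0 R) \<alpha> ?g = iter_partial_deriv (cball z0 R) is ?g"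
        using multi_partial_deriv_list by blast
      have len: "length is \<le> 2" using \<alpha> "is"(1) by (simp add: length_eq_sum_count_list)
      have "\<bar>if set is \<subseteq> {i} then 1 / \<omega>\<^sup>2 * \<omega> ^ length is else 0\<bar> \<le> 1 / \<omega>"
      proof (cases "set is \<subseteq> {i}")
        case True
        have "length is \<noteq> 2"
        proof
          assume "length is = 2"
          then have rep: "is = replicate 2 i" using True by (metis replicate_length_same singletonD subsetD)
          have "\<alpha> j = ?e j" for j
            using "is"(1)[THEN spec, of j] unfolding rep by (cases "j = i") (auto simp: numeral_2_eq_2)
          then have "\<alpha> = ?e" by blast
          then show False using \<alpha> by simp
        qed
        then have "\<omega> ^ length is \<le> \<omega> ^ 1" using len \<omega> by (intro power_increasing) auto
        then show ?thesis using True \<omega> by (simp add: power2_eq_square field_simps)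
      qed (use \<omega> in simp)
      then have "\<bar>multi_partial_deriv (cball z0 R) \<alpha> ?g z\<bar> \<le> 1 / \<omega> * 1"
        unfolding "is"(2) iter_partial_deriv_sin_ridge[OF R z] abs_mult using \<omega>
        by (intro mult_mono) auto
      then have "\<bar>multi_partial_deriv (cball z0 R) \<alpha> ?g z\<bar>\<^sup>2 \<le> (1 / \<omega>)\<^sup>2"
        by (intro power_mono) auto
      then show "(multi_partial_deriv (cball z0 R) \<alpha> ?g z)\<^sup>2 \<le> 1 / \<omega>\<^sup>2"
        by (simp add: power_divide)
    qed
    also have "\<dots> \<le> 1 + card ?A / \<omega>\<^sup>2"
      using card_Diff1_le[of ?A ?e] by (simp add: divide_right_mono)
    finally show ?thesis .
  qed
  then show ?thesis
    unfolding C_norm_def using R by (intro cSUP_least real_sqrt_le_mono) auto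
qed

lemma DERIV_partial_along_axis:
  fixes h :: "real^'n::finite \<Rightarrow> real"
  assumes h: "Ck_on 2 (cball z0 R) h" and t: "z + t *\<^sub>R axis i 1 \<in> ball z0 R"
  shows "((\<lambda>t. h (z + t *\<^sub>R axis i 1)) has_real_derivative
        partial_deriv (cball z0 R) i h (z + t *\<^sub>R axis i 1)) (at t)"
    and "((\<lambda>t. partial_deriv (cball z0 R) i h (z + t *\<^sub>R axis i 1)) has_real_derivative
        partial_deriv (cball z0 R) i (partial_deriv (cball z0 R) i h) (z + t *\<^sub>R axis i 1)) (at t)"
proof -
  have "h differentiable_on cball z0 R" "partial_deriv (cball z0 R) i h differentiable_on cball z0 R"
    using h by (auto simp: numeral_2_eq_2)
  from this[THEN GDERIV_grad, OF t, THEN GDERIV_along_line]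
  show "((\<lambda>t. h (z + t *\<^sub>R axis i 1)) has_real_derivative
        partial_deriv (cball z0 R) i h (z + t *\<^sub>R axis i 1)) (at t)"
    and "((\<lambda>t. partial_deriv (cball z0 R) i h (z + t *\<^sub>R axis i 1)) has_real_derivative
        partial_deriv (cball z0 R) i (partial_deriv (cball z0 R) i h) (z + t *\<^sub>R axis i 1)) (at t)"
    by (simp_all add: inner_axis' grad_nth)
qed

lemma second_partial_quadratic_constant:
  fixes q :: "'n::finite real_mpoly"
  assumes R: "R > 0" and deg: "mpoly_degree q \<le> 2"
  shows "\<exists>C. \<forall>t. \<bar>t\<bar> < R \<longrightarrow>
    partial_deriv (cball z0 R) i (partial_deriv (cball z0 R) i (mpoly_eval q)) (z0 + t *\<^sub>R axis i 1) = C"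
proof -
  let ?D = "cball z0 R"
  have q: "Ck_on 2 ?D (mpoly_eval q)"
    by (rule Ck_on_real_polynomial_function[OF R real_polynomial_function_mpoly_eval])
  obtain P where P: "degree P \<le> 2" "\<And>t. poly P t = mpoly_eval q (z0 + t *\<^sub>R axis i 1)"
    using mpoly_eval_on_line deg order_trans by metis
  have in_ball: "z0 + t *\<^sub>R axis i 1 \<in> ball z0 R" if "\<bar>t\<bar> < R" for t
    using that by (simp add: dist_norm norm_axis_1)
  have d1: "partial_deriv ?D i (mpoly_eval q) (z0 + t *\<^sub>R axis i 1) = poly (pderiv P) t" if "\<bar>t\<bar> < R" for t
    using DERIV_unique[OF DERIV_partial_along_axis(1)[OF q in_ball[OF that]]] poly_DERIV[of P t]
    by (simp add: P(2)[symmetric])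
  have d2: "partial_deriv ?D i (partial_deriv ?D i (mpoly_eval q)) (z0 + t *\<^sub>R axis i 1)
      = poly (pderiv (pderiv P)) t" if t: "\<bar>t\<bar> < R" for t
  proof (rule DERIV_unique[OF DERIV_partial_along_axis(2)[OF q in_ball[OF t]]])
    have "((\<lambda>t. poly (pderiv P) t) has_real_derivative poly (pderiv (pderiv P)) t) (at t)"
      by (rule poly_DERIV)
    then show "((\<lambda>t. partial_deriv ?D i (mpoly_eval q) (z0 + t *\<^sub>R axis i 1)) has_real_derivative
        poly (pderiv (pderiv P)) t) (at t)"
      by (rule has_field_derivative_transform_within_open[of _ _ _ "{- R<..<R}"])
        (use t d1 in \<open>auto simp: abs_less_iff\<close>)
  qed
  have "degree (pderiv (pderiv P)) = 0" using P(1) by (simp add: degree_pderiv)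
  then obtain C where "pderiv (pderiv P) = [:C:]" by (metis degree_eq_zeroE)
  then show ?thesis using d2 by auto
qed

text \<open>
  A function with one rapidly oscillating second derivative \<open>sin (\<omega> * x)\<close> has norm close to \<open>1\<close>,
  whereas the second derivatives of a quadratic approximation are constants.
\<close>

lemma weierstrass_constant_ge_1:
  fixes z0 :: "real^'n::finite"
  assumes a: "weierstrass_constant (cball z0 R) a" and R: "R > 0"
  shows "a \<ge> 1"
proof -
  let ?D = "cball z0 R"
  define i :: 'n where "i = undefined"
  define K where "K = real (card {\<alpha> :: 'n \<Rightarrow> nat. (\<Sum>i\<in>UNIV. \<alpha> i) \<le> 2})"
  have bound: "1 \<le> a * sqrt (1 + K / \<omega>\<^sup>2)" if \<omega>: "\<omega> \<ge> 1" "\<omega> > pi / R" for \<omega>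
  proof -
    \<comment> \<open>The phase is centered at \<open>z0\<close>, so that the second derivative at
      \<open>z0 + t *\<^sub>R axis i 1\<close> is \<open>sin (pi + \<omega> * t)\<close>. As
      \<open>\<omega> > pi / R\<close>, a quarter period fits into the disk on both sides of the
      center.\<close>
    define b where "b = - \<omega> * z0 $ i"
    let ?g = "\<lambda>x :: real^'n. 1 / \<omega>\<^sup>2 * sin (b + \<omega> * x $ i)"
    have g: "Ck_on 2 ?D ?g" by (rule Ck_on_sin_ridge[OF R])
    obtain q where q: "mpoly_degree q \<le> 2"
        "\<forall>l\<le>min 2 2. real 2 ^ (2 - l) * C_norm l ?D (\<lambda>z. ?g z - mpoly_eval q z) \<le> a * C_norm 2 ?D ?g"
      using a g unfolding weierstrass_constant_def by blast
    let ?h = "\<lambda>z. ?g z - mpoly_eval q z"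
    have q_Ck: "Ck_on 2 ?D (mpoly_eval q)"
      by (rule Ck_on_real_polynomial_function[OF R real_polynomial_function_mpoly_eval])
    have h: "Ck_on 2 ?D ?h" by (rule Ck_on_diff[OF R g q_Ck])
    obtain C where C: "\<And>t. \<bar>t\<bar> < R \<Longrightarrow>
        partial_deriv ?D i (partial_deriv ?D i (mpoly_eval q)) (z0 + t *\<^sub>R axis i 1) = C"
      using second_partial_quadratic_constant[OF R q(1)] by blast
    have val: "\<bar>sin (pi + \<omega> * t) - C\<bar> \<le> C_norm 2 ?D ?h" if t: "\<bar>t\<bar> < R" for t
    proof -
      let ?z = "z0 + t *\<^sub>R axis i 1"
      have z: "?z \<in> ?D" using t by (simp add: dist_norm norm_axis_1)
      have dg: "f differentiable_on ?D" "partial_deriv ?D i f differentiable_on ?D"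
        if "Ck_on 2 ?D f" for f using that by (auto simp: numeral_2_eq_2)
      have "partial_deriv ?D i (partial_deriv ?D i ?h) ?z
          = partial_deriv ?D i (\<lambda>x. partial_deriv ?D i ?g x - partial_deriv ?D i (mpoly_eval q) x) ?z"
        using grad_diff[OF R _ dg(1)[OF g] dg(1)[OF q_Ck]] z
        by (intro partial_deriv_cong) (simp_all flip: grad_nth)
      also have "\<dots> = partial_deriv ?D i (partial_deriv ?D i ?g) ?z - C"
        using grad_diff[OF R z dg(2)[OF g] dg(2)[OF q_Ck]] C[OF t] by (simp flip: grad_nth)
      also have "partial_deriv ?D i (partial_deriv ?D i ?g) ?z = sin (pi + \<omega> * t)"
        using iter_partial_deriv_sin_ridge[OF R z, of "[i, i]" "1 / \<omega>\<^sup>2" b \<omega> i] \<omega>(1)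
        by (simp add: b_def algebra_simps power2_eq_square)
      finally show ?thesis using C_norm_2_ge_second_partial[OF h compact_cball z, of i] by simp
    qed
    have "pi < \<omega> * R" "0 < \<omega> * R" using \<omega> R by (simp_all add: field_simps)
    then have "pi / (2 * \<omega>) < R" using \<omega>(1) by (simp add: field_simps)
    moreover define t where "t = pi / (2 * \<omega>)"
    ultimately have t: "\<bar>t\<bar> < R" "\<bar>- t\<bar> < R" and \<omega>t: "\<omega> * t = pi / 2" using \<omega>(1) by auto
    \<comment> \<open>A constant \<open>C\<close> is at distance at least 1 from one of the two
      values \<open>-1\<close> and \<open>1\<close>. For \<open>l = 2\<close> the approximation
      estimate has no power of the degree, so the lower bound 1 reaches \<open>a\<close>
      undiminished.\<close>
    have "sin (pi + \<omega> * t) = - 1" "sin (pi + \<omega> * - t) = 1"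
      unfolding sin_add mult_minus_right \<omega>t by simp_all
    with val[OF t(1)] val[OF t(2)] have "1 \<le> C_norm 2 ?D ?h" by linarith
    also have "\<dots> \<le> a * C_norm 2 ?D ?g" using q(2)[rule_format, of 2] by simp
    also have "\<dots> \<le> a * sqrt (1 + K / \<omega>\<^sup>2)"
      using a C_norm_2_sin_ridge_le[OF R \<omega>(1)] unfolding K_def weierstrass_constant_def
      by (intro mult_left_mono) auto
    finally show ?thesis .
  qed
  have "((\<lambda>\<omega>. K / \<omega>\<^sup>2) \<longlongrightarrow> 0) at_top"
    by (intro tendsto_divide_0[OF tendsto_const] filterlim_at_top_imp_at_infinity filterlim_pow_at_top filterlim_ident) simp
  then have "((\<lambda>\<omega>. a * sqrt (1 + K / \<omega>\<^sup>2)) \<longlongrightarrow> a * sqrt (1 + 0)) at_top"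
    by (intro tendsto_intros)
  moreover have "eventually (\<lambda>\<omega>. 1 \<le> a * sqrt (1 + K / \<omega>\<^sup>2)) at_top"
    using eventually_ge_at_top[of 1] eventually_gt_at_top[of "pi / R"]
    by eventually_elim (rule bound)
  ultimately show ?thesis using tendsto_lowerbound[of _ _ at_top 1] by force
qed

section \<open>The geometry of a regular equation\<close>

text \<open>The square of \<open>f\<close> is differentiable and minimal at the same point; its
  gradient is \<open>2 * f z\<close> times \<open>G\<close>, and \<open>f z\<close> is not
  zero.\<close>

lemma grad_zero_at_local_min_abs:
  fixes f :: "real^'n::finite \<Rightarrow> real"
  assumes "GDERIV f z :> G" "open S" "z \<in> S" "f z \<noteq> 0" "\<And>x. x \<in> S \<Longrightarrow> \<bar>f z\<bar> \<le> \<bar>f x\<bar>"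
  shows "G = 0"
proof -
  have "((\<lambda>x. f x * f x) has_derivative (\<lambda>h. h \<bullet> (f z *\<^sub>R G + f z *\<^sub>R G))) (at z)"
    using GDERIV_mult[OF assms(1) assms(1)] by (simp add: gderiv_def)
  moreover have "f z * f z \<le> f x * f x" if "x \<in> S" for x
    using assms(5)[OF that] abs_le_square_iff[of "f z" "f x"] by (simp add: power2_eq_square)
  ultimately have "(\<lambda>h. h \<bullet> (f z *\<^sub>R G + f z *\<^sub>R G)) = (\<lambda>h. 0)"
    using assms(2,3) by (intro differential_zero_maxmin[of z S "\<lambda>x. f x * f x"]) auto
  from fun_cong[OF this, of "G"] show ?thesis using assms(4) by (simp flip: scaleR_add_left)
qed

lemma norm_add_power2:
  fixes a b :: "'a::real_inner"
  shows "(norm (a + b))\<^sup>2 = (norm a)\<^sup>2 + 2 * (a \<bullet> b) + (norm b)\<^sup>2"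
  using dot_norm[of a b] by simp

text \<open>At a minimum of \<open>\<bar>f\<bar>\<close> on the sphere the tangential gradient
  vanishes, so that the boundary term of \<open>delta\<close> reduces to
  \<open>\<bar>f\<bar>\<close>.\<close>

lemma delta_le_abs_on_sphere:
  fixes f :: "real^'n::finite \<Rightarrow> real"
  assumes R: "R > 0" and f: "f differentiable_on cball z0 R"
    and nz: "\<And>z. z \<in> sphere z0 R \<Longrightarrow> f z \<noteq> 0" and x: "x \<in> sphere z0 R"
  shows "delta f z0 R \<le> \<bar>f x\<bar>"
proof -
  have "continuous_on (sphere z0 R) (\<lambda>z. \<bar>f z\<bar>)"
    using differentiable_imp_continuous_on[OF f]
    by (intro continuous_intros) (auto elim: continuous_on_subset)
  then obtain z where z: "z \<in> sphere z0 R" "\<And>y. y \<in> sphere z0 R \<Longrightarrow> \<bar>f z\<bar> \<le> \<bar>f y\<bar>"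
    using continuous_attains_inf[OF compact_sphere, of z0 R "\<lambda>z. \<bar>f z\<bar>"] x by blast
  define w where "w = sphere_grad z0 R f z"
  have tan: "w \<bullet> (z - z0) = 0" unfolding w_def by (rule sphere_grad_tangent[OF R z(1)])
  have "w = 0"
  proof (rule ccontr)
    assume w: "w \<noteq> 0"
    \<comment> \<open>If \<open>w\<close> is not zero, the great circle through \<open>z\<close> in
      direction \<open>w\<close> is a curve on the sphere along which \<open>f\<close> has
      derivative \<open>R * norm w\<close> at \<open>z\<close>, although the square of
      \<open>f\<close> is minimal there.\<close>
    define e where "e = (R / norm w) *\<^sub>R w"
    define \<gamma> where "\<gamma> = (\<lambda>\<theta>. z0 + (cos \<theta> *\<^sub>R (z - z0) + sin \<theta> *\<^sub>R e))"
    have zz: "norm (z - z0) = R" using z(1) by (simp add: dist_norm norm_minus_commute)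
    have ee: "norm e = R" using w R by (simp add: e_def)
    have ze: "(z - z0) \<bullet> e = 0" using tan by (simp add: e_def inner_commute)
    have on: "\<gamma> \<theta> \<in> sphere z0 R" for \<theta>
    proof -
      have "(norm (cos \<theta> *\<^sub>R (z - z0) + sin \<theta> *\<^sub>R e))\<^sup>2
          = (cos \<theta>)\<^sup>2 * R\<^sup>2 + (sin \<theta>)\<^sup>2 * R\<^sup>2"
        unfolding norm_add_power2 norm_scaleR zz ee by (simp add: ze power_mult_distrib)
      also have "\<dots> = R\<^sup>2" by (simp flip: distrib_right)
      finally have "norm (cos \<theta> *\<^sub>R (z - z0) + sin \<theta> *\<^sub>R e) = R"
        using R by (metis norm_ge_zero power2_eq_iff_nonneg less_imp_le)
      moreover have "dist z0 (z0 + v) = norm v" for v by (simp add: dist_norm)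
      ultimately show ?thesis by (simp only: \<gamma>_def mem_sphere)
    qed
    have \<gamma>0: "\<gamma> 0 = z" by (simp add: \<gamma>_def)
    have \<gamma>: "(\<gamma> has_derivative (\<lambda>h. h *\<^sub>R e)) (at 0)"
      unfolding \<gamma>_def by (auto intro!: derivative_eq_intros)
    \<comment> \<open>At boundary points \<open>f\<close> is differentiable only within the disk, so
      the chain rule is applied relative to the range of the curve.\<close>
    have fd: "(f has_derivative (\<lambda>h. h \<bullet> grad (cball z0 R) f z)) (at (\<gamma> 0) within range \<gamma>)"
      unfolding \<gamma>0 using z(1) on
      by (intro has_derivative_subset[OF has_derivative_grad[OF f]]) (auto simp: image_subset_iff)
    have "((\<lambda>\<theta>. f (\<gamma> \<theta>)) has_derivative (\<lambda>h. (h *\<^sub>R e) \<bullet> grad (cball z0 R) f z)) (at 0)"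
      using has_derivative_in_compose[OF \<gamma> fd] by simp
    moreover have eg: "e \<bullet> grad (cball z0 R) f z = R * norm w"
    proof -
      have "grad (cball z0 R) f z \<bullet> w = w \<bullet> w"
        using sphere_grad_inner[OF tan, of R f] by (simp add: w_def)
      then show ?thesis using w
        by (simp add: e_def inner_commute power2_norm_eq_inner[symmetric] power2_eq_square)
    qed
    ultimately have der: "((\<lambda>\<theta>. f (\<gamma> \<theta>)) has_real_derivative R * norm w) (at 0)"
      by (simp add: has_field_derivative_def mult.commute[of "R * norm w"] eg mult_commute_abs)
    have "((\<lambda>\<theta>. f (\<gamma> \<theta>) * f (\<gamma> \<theta>)) has_real_derivative
        R * norm w * f (\<gamma> 0) + R * norm w * f (\<gamma> 0)) (at 0)"
      by (rule DERIV_mult[OF der der])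
    moreover have "f (\<gamma> 0) * f (\<gamma> 0) \<le> f (\<gamma> \<theta>) * f (\<gamma> \<theta>)" for \<theta>
      using z(2)[OF on[of \<theta>]] abs_le_square_iff[of "f z" "f (\<gamma> \<theta>)"]
      by (simp add: \<gamma>0 power2_eq_square)
    ultimately have "R * norm w * f (\<gamma> 0) + R * norm w * f (\<gamma> 0) = 0"
      by (intro DERIV_local_min[of _ _ _ 1]) auto
    then show False using R w nz[OF z(1)] \<gamma>0 by simp
  qed
  then have "delta f z0 R \<le> \<bar>f z\<bar>"
    using delta_le_sphere[OF z(1), of f] by (simp add: w_def)
  then show ?thesis using z(2)[OF x] by simp
qed

text \<open>A minimum of \<open>\<bar>f\<bar>\<close> on the annulus lies on one of the two spheres,
  where the previous bound applies, or is an interior critical point, where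
  \<open>delta f z0 R\<close> is at most \<open>\<bar>f\<bar>\<close>.\<close>

lemma min_delta_le_abs_on_annulus:
  fixes f :: "real^'n::finite \<Rightarrow> real"
  assumes r: "0 < r" "r < R" and f: "f differentiable_on cball z0 R"
    and nz: "\<And>z. r \<le> dist z0 z \<Longrightarrow> dist z0 z \<le> R \<Longrightarrow> f z \<noteq> 0"
    and x: "r \<le> dist z0 x" "dist z0 x \<le> R"
  shows "min (delta f z0 R) (delta f z0 r) \<le> \<bar>f x\<bar>"
proof -
  let ?A = "cball z0 R \<inter> {z. r \<le> dist z0 z}"
  have "closed {z. r \<le> dist z0 z}" by (intro closed_Collect_le continuous_intros)
  then have A: "compact ?A" by (intro compact_Int_closed compact_cball)
  have "continuous_on ?A (\<lambda>z. \<bar>f z\<bar>)"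
    using differentiable_imp_continuous_on[OF f]
    by (intro continuous_intros) (auto elim: continuous_on_subset)
  then obtain z where z: "z \<in> ?A" "\<And>y. y \<in> ?A \<Longrightarrow> \<bar>f z\<bar> \<le> \<bar>f y\<bar>"
    using continuous_attains_inf[OF A, of "\<lambda>z. \<bar>f z\<bar>"] x by fastforce
  have "min (delta f z0 R) (delta f z0 r) \<le> \<bar>f z\<bar>"
  proof -
    consider "dist z0 z = R" | "dist z0 z = r" | "r < dist z0 z" "dist z0 z < R" using z(1) by force
    then show ?thesis
    proof cases
      case 1
      then show ?thesis using delta_le_abs_on_sphere[OF _ f, of z] r nz by force
    next
      case 2
      have "f differentiable_on cball z0 r" using r by (intro differentiable_on_subset[OF f]) auto
      then show ?thesis using delta_le_abs_on_sphere[of r f z0 z] r nz 2 by force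
    next
      case 3
      have "open (ball z0 R \<inter> {z. r < dist z0 z})"
        by (intro open_Int open_ball open_Collect_less continuous_intros)
      then have "grad (cball z0 R) f z = 0"
        using z nz 3 by (intro grad_zero_at_local_min_abs[OF GDERIV_grad[OF f]]) auto
      then show ?thesis using delta_le[of R z z0 f] r 3 by simp
    qed
  qed
  then show ?thesis using z(2)[of x] x by simp
qed

text \<open>
  Ekeland's principle: minimise \<open>\<bar>f y\<bar> + c * dist x y\<close>.  A minimiser outside the zero set
  would have a gradient of norm at most \<open>c\<close>.
\<close>

lemma zero_near_small_value:
  fixes f :: "real^'n::finite \<Rightarrow> real"
  assumes R: "R > 0" and f: "f differentiable_on cball z0 R"
    and nz: "\<And>z. z \<in> sphere z0 R \<Longrightarrow> f z \<noteq> 0"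
    and x: "x \<in> cball z0 R" "\<bar>f x\<bar> \<le> \<eta>" and c: "c > 0" "\<eta>\<^sup>2 + c\<^sup>2 < (delta f z0 R)\<^sup>2"
    and \<delta>: "delta f z0 R > 0"
  shows "\<exists>y\<in>cball z0 R. f y = 0 \<and> c * dist x y \<le> \<eta>"
proof -
  have \<eta>\<delta>: "\<eta> < delta f z0 R"
    using c \<delta> by (smt (verit) power_mono zero_le_power2)
  have "continuous_on (cball z0 R) (\<lambda>y. \<bar>f y\<bar> + c * dist x y)"
    by (intro continuous_intros differentiable_imp_continuous_on[OF f])
  then obtain y where y: "y \<in> cball z0 R"
    "\<And>y'. y' \<in> cball z0 R \<Longrightarrow> \<bar>f y\<bar> + c * dist x y \<le> \<bar>f y'\<bar> + c * dist x y'"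
    using continuous_attains_inf[OF compact_cball, of z0 R "\<lambda>y. \<bar>f y\<bar> + c * dist x y"] R by force
  have yx: "\<bar>f y\<bar> + c * dist x y \<le> \<eta>" using y(2)[OF x(1)] x(2) by simp
  have nn: "0 \<le> c * dist x y" using c by simp
  have "f y = 0"
  proof (rule ccontr)
    assume fy: "f y \<noteq> 0"
    have "y \<notin> sphere z0 R"
      using delta_le_abs_on_sphere[OF R f nz, of y] yx nn \<eta>\<delta> by fastforce
    then have yb: "y \<in> ball z0 R" using y(1) by simp
    define G where "G = grad (cball z0 R) f y"
    have G: "GDERIV f y :> G" unfolding G_def by (rule GDERIV_grad[OF f yb])
    have "norm G \<le> c"
    proof (rule ccontr)
      assume G_large: "\<not> norm G \<le> c"
      then have G0: "norm G > 0" using c by linarith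
      \<comment> \<open>The sign makes \<open>s * f\<close> equal to \<open>\<bar>f\<bar>\<close>
        near \<open>y\<close>, and \<open>v\<close> is its unit direction of steepest descent. If
        \<open>norm G > c\<close>, a short step along \<open>v\<close> lowers
        \<open>\<bar>f\<bar>\<close> by more than the penalty \<open>c * t\<close> it costs.\<close>
      define s where "s = sgn (f y)"
      define v where "v = (- s / norm G) *\<^sub>R G"
      have s: "s * s = 1" "s * f y = \<bar>f y\<bar>" "\<bar>s\<bar> = 1"
        using fy by (auto simp: s_def sgn_if)
      have nv: "norm v = 1" using G0 s(3) by (simp add: v_def)
      have vG: "s * (v \<bullet> G) = - norm G"
        using G0 s(1) by (simp add: v_def power2_norm_eq_inner[symmetric] power2_eq_square)
      have line: "((\<lambda>t. f (y + t *\<^sub>R v)) has_real_derivative v \<bullet> G) (at 0)"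
        by (rule GDERIV_along_line) (simp add: G)
      define \<phi> where "\<phi> = (\<lambda>t. s * f (y + t *\<^sub>R v) + c * t)"
      have "(\<phi> has_real_derivative s * (v \<bullet> G) + c * 1) (at 0)"
        unfolding \<phi>_def by (intro DERIV_add DERIV_cmult line DERIV_ident)
      from DERIV_neg_dec_right[OF this] obtain d1 where d1: "d1 > 0"
        "\<And>h. h > 0 \<Longrightarrow> h < d1 \<Longrightarrow> \<phi> h < \<phi> 0"
        using vG G_large by auto
      have "isCont (\<lambda>t. s * f (y + t *\<^sub>R v)) 0"
        using DERIV_isCont[OF line] by (intro continuous_intros)
      then have "eventually (\<lambda>t. s * f (y + t *\<^sub>R v) > 0) (at 0)"
        using fy s(2) unfolding isCont_def by (intro order_tendstoD(1)[of _ "s * f y"]) auto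
      then obtain d2 where d2: "d2 > 0" "\<And>t. t \<noteq> 0 \<Longrightarrow> \<bar>t\<bar> < d2 \<Longrightarrow> s * f (y + t *\<^sub>R v) > 0"
        by (auto simp: eventually_at dist_real_def)
      define t where "t = min (min d1 d2) (R - dist z0 y) / 2"
      have t: "t > 0" "t < d1" "t < d2" "t < R - dist z0 y"
        using d1(1) d2(1) yb by (auto simp: t_def)
      have "norm (t *\<^sub>R v) = t" using nv t(1) by simp
      then have dt: "dist y (y + t *\<^sub>R v) = t" by (simp add: dist_norm)
      have "dist z0 (y + t *\<^sub>R v) \<le> dist z0 y + t"
        using dist_triangle[of z0 "y + t *\<^sub>R v" y] dt by simp
      then have "y + t *\<^sub>R v \<in> cball z0 R" using t(4) by simp
      from y(2)[OF this] have "\<bar>f y\<bar> + c * dist x y \<le> \<bar>f (y + t *\<^sub>R v)\<bar> + c * (dist x y + t)"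
        using dist_triangle[of x "y + t *\<^sub>R v" y] dt c(1) by (smt (verit) mult_left_mono)
      moreover have "\<bar>f (y + t *\<^sub>R v)\<bar> = s * f (y + t *\<^sub>R v)"
        using d2(2)[of t] t s(3) by (metis abs_mult abs_of_pos abs_of_pos less_irrefl mult_1)
      moreover have "s * f (y + t *\<^sub>R v) + c * t < \<bar>f y\<bar>"
        using d1(2)[OF t(1,2)] s(2) by (simp add: \<phi>_def)
      ultimately show False by (simp add: algebra_simps)
    qed
    then have "(norm G)\<^sup>2 \<le> c\<^sup>2" by (intro power_mono) auto
    moreover have "\<bar>f y\<bar> \<le> \<bar>\<eta>\<bar>" using yx nn by linarith
    then have "(f y)\<^sup>2 \<le> \<eta>\<^sup>2" by (simp add: abs_le_square_iff)
    ultimately have "(f y)\<^sup>2 + (norm G)\<^sup>2 \<le> \<eta>\<^sup>2 + c\<^sup>2" by linarith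
    also have "\<dots> < (delta f z0 R)\<^sup>2" by (rule c(2))
    finally have "sqrt ((f y)\<^sup>2 + (norm G)\<^sup>2) < delta f z0 R"
      using \<delta> by (intro real_less_lsqrt) auto
    then show False using delta_le[OF R y(1), of f] by (simp add: G_def)
  qed
  then show ?thesis using y(1) yx by (intro bexI[of _ y]) auto
qed

text \<open>At the zero \<open>z\<close> the gradient has norm at least \<open>delta\<close>, so
  \<open>\<sigma> * f\<close> takes negative values. Its minimum on the disk is then negative, lies
  within radius \<open>\<rho>\<close> and is a critical point, where \<open>\<bar>f\<bar>\<close> is
  at least \<open>delta\<close>.\<close>

lemma interior_minimum_below_delta:
  fixes f :: "real^'n::finite \<Rightarrow> real"
  assumes \<sigma>: "\<bar>\<sigma>\<bar> = 1" and \<rho>: "0 < \<rho>" "\<rho> < R" and f: "f differentiable_on cball z0 R"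
    and pos: "\<And>x. \<rho> < dist z0 x \<Longrightarrow> dist z0 x \<le> R \<Longrightarrow> \<sigma> * f x > 0"
    and z: "dist z0 z \<le> \<rho>" "f z = 0" and \<delta>: "delta f z0 R > 0"
  shows "\<exists>y. dist z0 y \<le> \<rho> \<and> grad (cball z0 R) f y = 0 \<and> \<sigma> * f y \<le> - delta f z0 R"
proof -
  define F where "F = (\<lambda>x. \<sigma> * f x)"
  have F: "GDERIV F x :> \<sigma> *\<^sub>R grad (cball z0 R) f x" if "x \<in> ball z0 R" for x
    unfolding F_def using GDERIV_mult[OF GDERIV_const GDERIV_grad[OF f that], of \<sigma>] by simp
  have Fc: "continuous_on (cball z0 R) F"
    unfolding F_def by (intro continuous_intros differentiable_imp_continuous_on[OF f])
  have R: "R > 0" using \<rho> by simp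
  obtain y where y: "y \<in> cball z0 R" "\<And>x. x \<in> cball z0 R \<Longrightarrow> F y \<le> F x"
    using continuous_attains_inf[OF compact_cball _ Fc] R by auto
  have zb: "z \<in> ball z0 R" using z \<rho> by simp
  define G where "G = \<sigma> *\<^sub>R grad (cball z0 R) f z"
  have "delta f z0 R \<le> norm G" using delta_le[OF R, of z z0 f] zb z(2) \<sigma> by (simp add: G_def)
  then have G0: "norm G > 0" using \<delta> by linarith
  have line: "((\<lambda>t. F (z + t *\<^sub>R (- G))) has_real_derivative (- G) \<bullet> G) (at 0)"
    using F[OF zb] by (intro GDERIV_along_line) (simp add: G_def)
  moreover have "(- G) \<bullet> G < 0" using G0 by simp
  ultimately obtain d where d: "d > 0" "\<And>h. h > 0 \<Longrightarrow> h < d \<Longrightarrow> F (z + h *\<^sub>R (- G)) < F z"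
    using DERIV_neg_dec_right[OF line] by auto
  define K where "K = (R - dist z0 z) / norm G"
  have K: "K > 0" using zb G0 by (simp add: K_def)
  define h where "h = min d K / 2"
  have h: "h > 0" "h < d" "h < (R - dist z0 z) / norm G"
    unfolding K_def[symmetric] using d(1) K by (auto simp: h_def)
  have "dist z (z + h *\<^sub>R (- G)) = h * norm G" using h(1) by (simp add: dist_norm)
  then have "dist z0 (z + h *\<^sub>R (- G)) \<le> dist z0 z + h * norm G"
    using dist_triangle[of z0 "z + h *\<^sub>R (- G)" z] by linarith
  also have "\<dots> \<le> R" using h(3) G0 by (simp add: field_simps)
  finally have fy: "F y < 0" using y(2)[of "z + h *\<^sub>R (- G)"] d(2)[OF h(1,2)] z(2) by (simp add: F_def)
  have yd: "dist z0 y \<le> \<rho>" using pos[of y] fy y(1) by (force simp: not_less F_def)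
  then have yb: "y \<in> ball z0 R" using \<rho> by simp
  define Gy where "Gy = \<sigma> *\<^sub>R grad (cball z0 R) f y"
  have "(F has_derivative (\<lambda>h. h \<bullet> Gy)) (at y)"
    using F[OF yb] by (simp add: gderiv_def Gy_def)
  then have "(\<lambda>h. h \<bullet> Gy) = (\<lambda>h. 0)"
    using yb y(2) by (intro differential_zero_maxmin[of y "ball z0 R" F]) auto
  from fun_cong[OF this, of Gy] have g: "grad (cball z0 R) f y = 0" using \<sigma> by (auto simp: Gy_def)
  have "delta f z0 R \<le> \<bar>f y\<bar>" using delta_le[OF R y(1), of f] g by simp
  also have "\<dots> = \<bar>F y\<bar>" using \<sigma> by (simp add: F_def abs_mult)
  finally show ?thesis using yd g fy by (intro exI[of _ y]) (auto simp: F_def)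
qed

text \<open>Second order Taylor estimate: from the critical point \<open>y\<close> to the sphere of
  radius \<open>\<rho>\<close>, \<open>\<sigma> * f\<close> climbs from at most
  \<open>- \<delta>\<close> to a nonnegative value, with initial slope zero and second derivative at
  most the norm of \<open>f\<close>. It shows that a zero set cannot be too small.\<close>

lemma delta_le_second_order:
  fixes f :: "real^'n::finite \<Rightarrow> real"
  assumes \<sigma>: "\<bar>\<sigma>\<bar> = 1" and \<rho>: "0 < \<rho>" "\<rho> < R" and f: "Ck_on 2 (cball z0 R) f"
    and nonneg: "\<And>x. dist z0 x = \<rho> \<Longrightarrow> \<sigma> * f x \<ge> 0"
    and y: "dist z0 y \<le> \<rho>" "grad (cball z0 R) f y = 0" "\<sigma> * f y \<le> - \<delta>"
  shows "2 * \<delta> \<le> C_norm 2 (cball z0 R) f * \<rho>\<^sup>2"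
proof -
  define i :: 'n where "i = undefined"
  define N where "N = C_norm 2 (cball z0 R) f"
  \<comment> \<open>The path follows a coordinate axis, because the norm bounds pure second partial
    derivatives directly. The sign points it away from the center, so that it meets the sphere after
    length at most \<open>\<rho>\<close>.\<close>
  define s :: real where "s = (if (y - z0) $ i \<ge> 0 then 1 else -1)"
  define e where "e = s *\<^sub>R axis i (1::real)"
  have s: "s * s = 1" by (simp add: s_def)
  have e: "norm e = 1" by (simp add: e_def s_def norm_axis_1)
  have we: "(y - z0) \<bullet> e \<ge> 0" by (simp add: e_def s_def inner_axis)
  have "\<exists>t\<ge>0. t \<le> \<rho> \<and> norm (y - z0 + t *\<^sub>R e) = \<rho>"
  proof (rule IVT')
    show "norm (y - z0 + 0 *\<^sub>R e) \<le> \<rho>" using y(1) by (simp add: dist_norm norm_minus_commute)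
    have "\<rho>\<^sup>2 \<le> (norm (y - z0 + \<rho> *\<^sub>R e))\<^sup>2"
      using norm_add_power2[of "y - z0" "\<rho> *\<^sub>R e"] we e \<rho>(1) by simp
    then show "\<rho> \<le> norm (y - z0 + \<rho> *\<^sub>R e)" using power2_le_imp_le norm_ge_zero by blast
    show "continuous_on {0..\<rho>} (\<lambda>t. norm (y - z0 + t *\<^sub>R e))" by (intro continuous_intros)
  qed (use \<rho> in simp)
  then obtain t1 where t1: "0 \<le> t1" "t1 \<le> \<rho>" "norm (y - z0 + t1 *\<^sub>R e) = \<rho>" by blast
  have end_pt: "dist z0 (y + t1 *\<^sub>R e) = \<rho>"
    using t1(3) by (simp add: dist_norm norm_minus_commute[of z0] algebra_simps)
  have in_ball: "y + (s * t) *\<^sub>R axis i 1 \<in> ball z0 R" if "0 \<le> t" "t \<le> t1" for t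
  proof (cases "t1 = 0")
    case True
    then show ?thesis using that y(1) \<rho> by simp
  next
    case False
    then have t1': "t1 > 0" using t1(1) by simp
    have "(1 - t / t1) *\<^sub>R y + (t / t1) *\<^sub>R (y + t1 *\<^sub>R e) \<in> cball z0 \<rho>"
      using convexD[OF convex_cball, of y z0 \<rho> "y + t1 *\<^sub>R e" "1 - t / t1" "t / t1"] y(1) end_pt that t1'
      by simp
    moreover have "(1 - t / t1) *\<^sub>R y + (t / t1) *\<^sub>R (y + t1 *\<^sub>R e) = y + (s * t) *\<^sub>R axis i 1"
      using t1' by (simp add: e_def algebra_simps)
    ultimately show ?thesis using \<rho>(2) by simp
  qed
  let ?d1 = "partial_deriv (cball z0 R) i f" and ?d2 = "partial_deriv (cball z0 R) i (partial_deriv (cball z0 R) i f)"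
  define \<psi> where "\<psi> = (\<lambda>t. \<sigma> * f (y + (s * t) *\<^sub>R axis i 1))"
  define \<psi>1 where "\<psi>1 = (\<lambda>t. \<sigma> * s * ?d1 (y + (s * t) *\<^sub>R axis i 1))"
  have sd: "((\<lambda>t. s * t) has_real_derivative s) (at t)" for t by (auto intro!: derivative_eq_intros)
  have \<psi>: "(\<psi> has_real_derivative \<psi>1 t) (at t)" if t: "0 \<le> t" "t \<le> t1" for t
    using DERIV_cmult[OF DERIV_chain2[OF DERIV_partial_along_axis(1)[OF f in_ball[OF t]] sd], of \<sigma>]
    by (simp add: \<psi>_def \<psi>1_def mult_ac)
  have \<psi>1: "(\<psi>1 has_real_derivative \<sigma> * ?d2 (y + (s * t) *\<^sub>R axis i 1)) (at t)" if t: "0 \<le> t" "t \<le> t1" for t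
  proof -
    have "\<sigma> * s * (?d2 (y + (s * t) *\<^sub>R axis i 1) * s) = \<sigma> * ?d2 (y + (s * t) *\<^sub>R axis i 1) * (s * s)"
      by (simp only: mult_ac)
    moreover have "(\<psi>1 has_real_derivative \<sigma> * s * (?d2 (y + (s * t) *\<^sub>R axis i 1) * s)) (at t)"
      unfolding \<psi>1_def
      by (rule DERIV_cmult[OF DERIV_chain2[OF DERIV_partial_along_axis(2)[OF f in_ball[OF t]] sd]])
    ultimately show ?thesis by (simp only: s mult_1_right)
  qed
  have d2: "\<sigma> * ?d2 (y + (s * t) *\<^sub>R axis i 1) \<le> N" if "0 \<le> t" "t \<le> t1" for t
  proof -
    have "\<sigma> * ?d2 (y + (s * t) *\<^sub>R axis i 1) \<le> \<bar>\<sigma> * ?d2 (y + (s * t) *\<^sub>R axis i 1)\<bar>" by (rule abs_ge_self)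
    also have "\<dots> = \<bar>?d2 (y + (s * t) *\<^sub>R axis i 1)\<bar>" by (simp only: abs_mult \<sigma> mult_1)
    also have "\<dots> \<le> N"
      unfolding N_def using in_ball[OF that] by (intro C_norm_2_ge_second_partial[OF f compact_cball]) auto
    finally show ?thesis .
  qed
  have \<psi>10: "\<psi>1 0 = 0" using y(2) grad_nth[of "cball z0 R" f y i] by (simp add: \<psi>1_def)
  have \<psi>1_le: "\<psi>1 t \<le> N * t" if t: "0 \<le> t" "t \<le> t1" for t
  proof -
    have "\<psi>1 t - N * t \<le> \<psi>1 0 - N * 0"
    proof (rule DERIV_nonpos_imp_nonincreasing[OF t(1)])
      fix u assume u: "0 \<le> u" "u \<le> t"
      have "((\<lambda>t. \<psi>1 t - N * t) has_real_derivative \<sigma> * ?d2 (y + (s * u) *\<^sub>R axis i 1) - N * 1) (at u)"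
        using u t by (intro DERIV_diff \<psi>1 DERIV_cmult DERIV_ident) auto
      then show "\<exists>d. ((\<lambda>t. \<psi>1 t - N * t) has_real_derivative d) (at u) \<and> d \<le> 0"
        using d2[of u] u t by (intro exI conjI) auto
    qed
    then show ?thesis using \<psi>10 by simp
  qed
  have "\<psi> t1 - N * (t1\<^sup>2 / 2) \<le> \<psi> 0 - N * (0\<^sup>2 / 2)"
  proof (rule DERIV_nonpos_imp_nonincreasing[OF t1(1)])
    fix u assume u: "0 \<le> u" "u \<le> t1"
    have "((\<lambda>t. t\<^sup>2 / 2) has_real_derivative u) (at u)" by (auto intro!: derivative_eq_intros)
    then have "((\<lambda>t. \<psi> t - N * (t\<^sup>2 / 2)) has_real_derivative \<psi>1 u - N * u) (at u)"
      using u by (intro DERIV_diff \<psi> DERIV_cmult) auto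
    then show "\<exists>d. ((\<lambda>t. \<psi> t - N * (t\<^sup>2 / 2)) has_real_derivative d) (at u) \<and> d \<le> 0"
      using \<psi>1_le[OF u] by (intro exI conjI) auto
  qed
  moreover have "\<psi> t1 \<ge> 0" using nonneg[OF end_pt] by (simp add: \<psi>_def e_def mult.commute)
  moreover have "\<psi> 0 \<le> - \<delta>" using y(3) by (simp add: \<psi>_def)
  ultimately have "2 * \<delta> \<le> N * t1\<^sup>2" by (simp add: field_simps)
  also have "\<dots> \<le> N * \<rho>\<^sup>2"
  proof (intro mult_left_mono power_mono t1)
    show "N \<ge> 0"
      using C_norm_2_ge_second_partial[OF f compact_cball, of y i] y(1) \<rho> by (simp add: N_def)
  qed
  finally show ?thesis by (simp add: N_def)
qed

text \<open>From dimension two on the annulus is connected. On a line it has two components, on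
  which \<open>f\<close> may have opposite signs; this is why dimension one is treated
  apart.\<close>

lemma constant_sign_on_annulus:
  fixes f :: "real^'n::finite \<Rightarrow> real"
  assumes n: "CARD('n) \<ge> 2" and f: "continuous_on (cball z0 R) f"
    and nz: "\<And>x. \<rho> < dist z0 x \<Longrightarrow> dist z0 x \<le> R \<Longrightarrow> f x \<noteq> 0"
  shows "\<exists>\<sigma>\<in>{1, -1}. \<forall>x. \<rho> < dist z0 x \<longrightarrow> dist z0 x \<le> R \<longrightarrow> \<sigma> * f x > 0"
proof -
  let ?A = "{x. \<rho> < norm (x - z0) \<and> norm (x - z0) \<le> R}"
  have conn: "connected ?A" using n by (intro connected_annulus) simp
  have A: "x \<in> ?A \<longleftrightarrow> \<rho> < dist z0 x \<and> dist z0 x \<le> R" for x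
    by (simp add: dist_norm norm_minus_commute)
  have "connected (f ` ?A)"
    by (intro connected_continuous_image conn continuous_on_subset[OF f])
      (auto simp: dist_norm norm_minus_commute)
  then have "0 \<in> f ` ?A" if "x \<in> ?A" "y \<in> ?A" "f x < 0" "f y > 0" for x y
    using that by (intro connectedD_interval[of "f ` ?A" "f x" "f y" 0]) (auto simp del: image_eqI)
  moreover have "0 \<notin> f ` ?A" using nz A by fastforce
  ultimately have "(\<forall>x\<in>?A. f x > 0) \<or> (\<forall>x\<in>?A. f x < 0)"
    using nz A by (meson linorder_neqE_linordered_idom)
  then show ?thesis using A by auto
qed

section \<open>Numerical estimates\<close>

text \<open>The quadratic Taylor bound at \<open>1/8\<close> is \<open>145/128\<close>, and its
  eighth power exceeds \<open>2.7\<close>. The final constants leave too little room for a crude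
  bound such as 2.\<close>

lemma exp_1_ge: "27 / 10 \<le> exp (1::real)"
proof -
  have "1 + 1/8 + (1/8)\<^sup>2 / 2 \<le> exp (1/8 :: real)"
    by (rule exp_lower_Taylor_quadratic) simp
  then have "(145/128) ^ 8 \<le> exp (1/8 :: real) ^ 8"
    by (intro power_mono) (auto simp: power2_eq_square)
  also have "exp (1/8 :: real) ^ 8 = exp 1" by (simp flip: exp_of_nat_mult)
  finally show ?thesis by (simp add: power_divide eval_nat_numeral)
qed

text \<open>The maximum over \<open>\<tau>\<close> is \<open>1 / (k * exp 1)\<close>, obtained here
  from \<open>x <= exp (x - 1)\<close>; then \<open>exp 1 >= 27/10\<close>.\<close>

lemma mult_exp_minus_le:
  fixes \<tau> k :: real
  assumes "k > 0"
  shows "\<tau> * exp (- (k * \<tau>)) \<le> 10 / (27 * k)"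
proof -
  have "k * \<tau> \<le> exp (k * \<tau> - 1)" using exp_ge_add_one_self[of "k * \<tau> - 1"] by simp
  then have "k * \<tau> * exp 1 \<le> exp (k * \<tau>)" by (simp add: exp_diff field_simps)
  then have "k * \<tau> * exp 1 * exp (- (k * \<tau>)) \<le> exp (k * \<tau>) * exp (- (k * \<tau>))"
    by (intro mult_right_mono) auto
  then have le: "(k * (\<tau> * exp (- (k * \<tau>)))) * exp 1 \<le> 1" by (simp add: algebra_simps flip: exp_add)
  have "k * (\<tau> * exp (- (k * \<tau>))) \<le> 10 / 27"
  proof (cases "\<tau> \<ge> 0")
    case True
    then have "k * (\<tau> * exp (- (k * \<tau>))) * (27 / 10) \<le> (k * (\<tau> * exp (- (k * \<tau>)))) * exp 1"
      using exp_1_ge assms by (intro mult_left_mono) auto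
    then show ?thesis using le by simp
  next
    case False
    then have "k * (\<tau> * exp (- (k * \<tau>))) \<le> 0" using assms by (simp add: mult_nonneg_nonpos mult_nonpos_nonneg)
    then show ?thesis by simp
  qed
  then show ?thesis using assms by (simp add: field_simps)
qed

text \<open>The case where zeros are confined to the disk of radius \<open>r\<close>. After
  multiplying out, each term contains \<open>t (m - j)\<close> with \<open>j <= 4\<close>, sometimes
  times \<open>m\<close>. For \<open>m >= 6\<close> these are bounded by their estimates at
  \<open>m = 6\<close>.\<close>

lemma perturbation_bound_ge_6:
  fixes \<tau> R \<rho> :: real and m :: nat
  assumes \<tau>: "\<tau> > 0" and R: "R > 0" and m: "m \<ge> 6" and \<rho>: "\<rho> = R * exp (- \<tau>)"
  shows "7 * \<tau> * exp (\<tau> * (real m + 2)) * (1 + R) * (exp (- 2 * \<tau>) ^ m * (1 + real m / (exp (- 2 * \<tau>) * R)))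
     \<le> 8 + 8 / \<rho> + 4 * \<rho> + 4 * \<tau>"
proof -
  have \<rho>0: "\<rho> > 0" using R by (simp add: \<rho>)
  have R\<rho>: "R = \<rho> * exp \<tau>" by (simp add: \<rho> exp_minus)
  define t where "t = (\<lambda>k::real. \<tau> * exp (- (k * \<tau>)))"
  have t: "t k \<le> 10 / (27 * k)" if "k > 0" for k using mult_exp_minus_le[OF that] by (simp add: t_def)
  have mr: "real m \<ge> 6" using m by simp
  have pw: "exp (- 2 * \<tau>) ^ m = exp (- (2 * real m * \<tau>))"
    by (simp flip: exp_of_nat_mult)
  have e1: "\<tau> * exp (\<tau> * (real m + 2)) * exp (- (2 * real m * \<tau>)) = t (real m - 2)"
    by (simp add: t_def mult.assoc algebra_simps flip: exp_add)
  have e2: "t (real m - 2) * exp \<tau> = t (real m - 3)" "t (real m - 3) * exp \<tau> = t (real m - 4)"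
    by (simp_all add: t_def mult.assoc algebra_simps flip: exp_add)
  have inv: "real m / (exp (- 2 * \<tau>) * R) = real m * exp \<tau> / \<rho>"
  proof -
    have "exp (- 2 * \<tau>) * R = \<rho> / exp \<tau>"
      unfolding R\<rho> by (simp add: exp_minus field_simps exp_double power2_eq_square flip: exp_add)
    then show ?thesis by simp
  qed
  have "7 * \<tau> * exp (\<tau> * (real m + 2)) * (1 + R) * (exp (- 2 * \<tau>) ^ m * (1 + real m / (exp (- 2 * \<tau>) * R)))
      = 7 * ((\<tau> * exp (\<tau> * (real m + 2)) * exp (- (2 * real m * \<tau>))) * ((1 + \<rho> * exp \<tau>) * (1 + real m * exp \<tau> / \<rho>)))"
    unfolding inv pw using R\<rho> by (simp add: mult_ac)
  also have "\<dots> = 7 * (t (real m - 2) * ((1 + \<rho> * exp \<tau>) * (1 + real m * exp \<tau> / \<rho>)))"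
    unfolding e1 ..
  also have "\<dots> = 7 * (t (real m - 2) + \<rho> * (t (real m - 2) * exp \<tau>)
      + real m * (t (real m - 2) * exp \<tau>) / \<rho> + real m * (t (real m - 2) * exp \<tau> * exp \<tau>))"
    using \<rho>0 by (simp add: field_simps)
  also have "\<dots> = 7 * (t (real m - 2) + \<rho> * t (real m - 3) + real m * t (real m - 3) / \<rho> + real m * t (real m - 4))"
    unfolding e2 ..
  also have "\<dots> \<le> 7 * (10 / 108 + \<rho> * (10 / 81) + (20 / 27) / \<rho> + 30 / 27)"
  proof (intro mult_left_mono add_mono divide_right_mono)
    have "10 / (27 * (real m - 2)) \<le> 10 / 108" "10 / (27 * (real m - 3)) \<le> 10 / 81"
      using mr by (simp_all add: field_simps)
    then show "t (real m - 2) \<le> 10 / 108" "t (real m - 3) \<le> 10 / 81"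
      using t[of "real m - 2"] t[of "real m - 3"] mr by simp_all
    have "real m * t (real m - 3) \<le> real m * (10 / (27 * (real m - 3)))"
      using mr by (intro mult_left_mono t) auto
    also have "\<dots> \<le> 20 / 27" using mr by (simp add: field_simps)
    finally show "real m * t (real m - 3) \<le> 20 / 27" .
    have "real m * t (real m - 4) \<le> real m * (10 / (27 * (real m - 4)))"
      using mr by (intro mult_left_mono t) auto
    also have "\<dots> \<le> 30 / 27" using mr by (simp add: field_simps)
    finally show "real m * t (real m - 4) \<le> 30 / 27" .
  qed (use \<rho>0 in auto)
  also have "\<dots> \<le> 8 + 8 / \<rho> + 4 * \<rho> + 4 * \<tau>"
  proof -
    \<comment> \<open>The constant terms add up to about \<open>8.43\<close>, slightly more than 8;
      the excess is paid from the spare multiples of \<open>\<rho>\<close> and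
      \<open>1 / \<rho>\<close>.\<close>
    have "2 \<le> \<rho> + 1 / \<rho>"
    proof -
      have "0 \<le> (\<rho> - 1)\<^sup>2 / \<rho>" using \<rho>0 by simp
      also have "\<dots> = \<rho> + 1 / \<rho> - 2" using \<rho>0 by (simp add: field_simps power2_eq_square)
      finally show ?thesis by simp
    qed
    moreover define u where "u = 1 / \<rho>"
    moreover have "u > 0" using \<rho>0 by (simp add: u_def)
    ultimately have "7 * (10 / 108 + \<rho> * (10 / 81) + 20 / 27 * u + 30 / 27) \<le> 8 + 8 * u + 4 * \<rho> + 4 * \<tau>"
      using \<rho>0 \<tau> by simp
    then show ?thesis by (simp add: u_def)
  qed
  finally show ?thesis .
qed

text \<open>With radius \<open>r\<close> the exponent 4 would leave a term
  \<open>28 * \<tau>\<close> against \<open>4 * \<tau>\<close> on the right. The radius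
  \<open>5/4 * w\<close> makes the fourth power decay like \<open>exp (- (12 * \<tau>))\<close>, so
  all terms are bounded. The factor \<open>5/4\<close> just fits: the constant terms come to about
  \<open>7.81\<close>.\<close>

lemma perturbation_bound_4:
  fixes \<tau> R \<rho> w :: real
  assumes \<tau>: "\<tau> > 0" and R: "R > 0" and \<rho>: "\<rho> = R * exp (- \<tau>)" and w: "w = exp (- 3 * \<tau>) * R"
  shows "7 * \<tau> * exp (\<tau> * (real 4 + 2)) * (1 + R) * ((5/4 * w / R) ^ 4 * (1 + real 4 / (5/4 * w)))
     \<le> 8 + 8 / \<rho> + 4 * \<rho> + 4 * \<tau>"
proof -
  have w0: "w > 0" using R by (simp add: w)
  have Rw: "R = w * exp (3 * \<tau>)" by (simp add: w exp_minus)
  have \<rho>w: "\<rho> = w * exp (2 * \<tau>)"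
    unfolding \<rho> w by (simp add: mult.assoc mult.left_commute flip: exp_add)
  define t where "t = (\<lambda>k::real. \<tau> * exp (- (k * \<tau>)))"
  have t: "t k \<le> 10 / (27 * k)" if "k > 0" for k using mult_exp_minus_le[OF that] by (simp add: t_def)
  have wR: "5/4 * w / R = 5/4 * exp (- (3 * \<tau>))" using R by (simp add: w)
  have pw: "(5/4 * w / R) ^ 4 = 625/256 * exp (- (12 * \<tau>))"
    unfolding wR power_mult_distrib by (simp add: power_divide flip: exp_of_nat_mult)
  have e1: "\<tau> * exp (\<tau> * (real 4 + 2)) * exp (- (12 * \<tau>)) = t 6"
    by (simp add: t_def mult.assoc algebra_simps flip: exp_add)
  have e2: "t 6 * exp (3 * \<tau>) = t 3" by (simp add: t_def mult.assoc algebra_simps flip: exp_add)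
  have e3: "t 6 = t 4 * exp (- (2 * \<tau>))" by (simp add: t_def mult.assoc algebra_simps flip: exp_add)
  have "7 * \<tau> * exp (\<tau> * (real 4 + 2)) * (1 + R) * ((5/4 * w / R) ^ 4 * (1 + real 4 / (5/4 * w)))
      = 4375/256 * ((\<tau> * exp (\<tau> * (real 4 + 2)) * exp (- (12 * \<tau>))) * ((1 + w * exp (3 * \<tau>)) * (1 + 16/5 / w)))"
    unfolding pw using Rw by (simp add: mult_ac)
  also have "\<dots> = 4375/256 * (t 6 * ((1 + w * exp (3 * \<tau>)) * (1 + 16/5 / w)))"
    unfolding e1 ..
  also have "\<dots> = 4375/256 * (t 6 + 16/5 * (t 6 / w) + w * (t 6 * exp (3 * \<tau>)) + 16/5 * (t 6 * exp (3 * \<tau>)))"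
    using w0 by (simp add: field_simps)
  also have "\<dots> = 4375/256 * (t 6 + 16/5 * (t 4 * exp (- (2 * \<tau>)) / w) + w * t 3 + 16/5 * t 3)"
    unfolding e2 by (simp add: e3)
  also have "\<dots> \<le> 4375/256 * (10 / 162 + 16/5 * (10 / 108 * exp (- (2 * \<tau>)) / w) + w * (10 / 81) + 16/5 * (10 / 81))"
    using t[of 6] t[of 4] t[of 3] w0
    by (intro mult_left_mono add_mono divide_right_mono mult_right_mono) auto
  also have "\<dots> \<le> 8 + 8 / \<rho> + 4 * \<rho> + 4 * \<tau>"
  proof -
    have 1: "8 / \<rho> = 8 * (exp (- (2 * \<tau>)) / w)" unfolding \<rho>w by (simp add: exp_minus field_simps)
    have 2: "\<rho> \<ge> w" using w0 \<tau> unfolding \<rho>w by simp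
    have 3: "exp (- (2 * \<tau>)) / w > 0" using w0 by simp
    define u where "u = exp (- (2 * \<tau>)) / w"
    have "4375/256 * (10 / 162 + 16/5 * (10 / 108 * u) + w * (10 / 81) + 16/5 * (10 / 81)) \<le> 8 + 8 * u + 4 * \<rho> + 4 * \<tau>"
      using 2 3 w0 \<tau> unfolding u_def[symmetric] by simp
    then show ?thesis unfolding 1 by (simp add: u_def)
  qed
  finally show ?thesis .
qed

section \<open>Perturbed approximations\<close>

text \<open>Value and gradient are treated as one vector. At a critical zero of the homotopy the
  vector of \<open>f\<close> would be \<open>- t\<close> times that of the difference, hence not
  longer than it.\<close>

lemma diffeotopic_zero_sets_of_small_difference:
  fixes f p :: "real^'n::finite \<Rightarrow> real"
  assumes f: "\<And>x. x \<in> ball z0 R \<Longrightarrow> GDERIV f x :> Gf x" and Gf: "continuous_on (ball z0 R) Gf"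
    and p: "\<And>x. x \<in> ball z0 R \<Longrightarrow> GDERIV p x :> Gp x" and Gp: "continuous_on (ball z0 R) Gp"
    and s: "s < R"
    and loc: "\<And>t x. t \<in> {0..1} \<Longrightarrow> x \<in> ball z0 R \<Longrightarrow> f x + t * (p x - f x) = 0 \<Longrightarrow> dist z0 x \<le> s"
    and close: "\<And>x. dist z0 x \<le> s \<Longrightarrow> norm (p x - f x, Gp x - Gf x) < norm (f x, Gf x)"
  shows "diffeotopic_sets {x\<in>ball z0 R. p x = 0} {x\<in>ball z0 R. f x = 0}"
proof (rule diffeotopic_zero_sets_of_linear_homotopy[OF f Gf p Gp s])
  fix t :: real and x
  assume t: "t \<in> {0..1}" and x: "x \<in> ball z0 R" and zero: "f x + t * (p x - f x) = 0"
  have "Gf x + t *\<^sub>R (Gp x - Gf x) \<noteq> 0"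
  proof
    assume "Gf x + t *\<^sub>R (Gp x - Gf x) = 0"
    with zero have "(f x, Gf x) + t *\<^sub>R (p x - f x, Gp x - Gf x) = 0" by (simp add: zero_prod_def)
    then have "(f x, Gf x) = - (t *\<^sub>R (p x - f x, Gp x - Gf x))" by (rule eq_neg_iff_add_eq_0[THEN iffD2])
    then have "norm (f x, Gf x) = \<bar>t\<bar> * norm (p x - f x, Gp x - Gf x)"
      by (metis norm_minus_cancel norm_scaleR)
    also have "\<dots> \<le> 1 * norm (p x - f x, Gp x - Gf x)" using t by (intro mult_right_mono) auto
    finally show False using close[OF loc[OF t x zero]] by simp
  qed
  then show "dist z0 x \<le> s \<and> Gf x + t *\<^sub>R (Gp x - Gf x) \<noteq> 0" using loc[OF t x zero] by simp
qed

lemma delta_le_norm: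
  fixes f :: "real^'n::finite \<Rightarrow> real"
  assumes "R > 0" "z \<in> cball z0 R"
  shows "delta f z0 R \<le> norm (f z, grad (cball z0 R) f z)"
  using delta_le[OF assms] by (simp add: norm_Pair)

lemma norm_le_C_norm:
  fixes f :: "real^'n::finite \<Rightarrow> real"
  assumes "Ck_on l (cball z0 R) f" "z \<in> cball z0 R" "l \<ge> 1"
  shows "norm (f z, grad (cball z0 R) f z) \<le> C_norm l (cball z0 R) f"
  using C_norm_ge_gradient[OF assms(1) compact_cball assms(2,3)] by (simp add: norm_Pair)

lemma grad_mpoly_eval:
  fixes q :: "'n::finite real_mpoly"
  shows "\<exists>G. (\<forall>x. GDERIV (mpoly_eval q) x :> G x) \<and> (\<forall>S. continuous_on S G) \<and>
    (\<forall>z0 R z. R > 0 \<longrightarrow> z \<in> cball z0 R \<longrightarrow> grad (cball z0 R) (mpoly_eval q) z = G z)"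
proof -
  obtain G where G: "\<And>x. GDERIV (mpoly_eval q) x :> G x" "\<And>i. real_polynomial_function (\<lambda>x. G x $ i)"
    using real_polynomial_function_gradient[OF real_polynomial_function_mpoly_eval] by blast
  have "continuous_on S (\<lambda>x. \<chi> i. G x $ i)" for S
    by (intro continuous_on_vec_lambda continuous_on_real_polynomial_function G)
  then have "continuous_on S G" for S by simp
  then show ?thesis using G(1) grad_eq_GDERIV by blast
qed

lemma weierstrass_approximation_C1:
  fixes f :: "real^'n::finite \<Rightarrow> real"
  assumes R: "R > 0" and a: "weierstrass_constant (cball z0 R) a" and f: "Ck_on 2 (cball z0 R) f"
    and d: "d \<ge> 2"
  obtains q where "mpoly_degree q \<le> d"
    "\<And>x. x \<in> cball z0 R \<Longrightarrow> \<bar>mpoly_eval q x - f x\<bar> \<le> a * C_norm 2 (cball z0 R) f / real d ^ 2"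
    "\<And>x. x \<in> cball z0 R \<Longrightarrow> norm (mpoly_eval q x - f x, grad (cball z0 R) (mpoly_eval q) x - grad (cball z0 R) f x)
        \<le> a * C_norm 2 (cball z0 R) f / real d"
proof -
  let ?D = "cball z0 R" and ?N = "C_norm 2 (cball z0 R) f"
  obtain q where q: "mpoly_degree q \<le> d"
    "\<And>l. l \<le> min 2 d \<Longrightarrow> real d ^ (2 - l) * C_norm l ?D (\<lambda>z. f z - mpoly_eval q z) \<le> a * ?N"
    using a f unfolding weierstrass_constant_def by blast
  let ?h = "\<lambda>z. f z - mpoly_eval q z"
  have q_Ck: "Ck_on k ?D (mpoly_eval q)" for k
    by (rule Ck_on_real_polynomial_function[OF R real_polynomial_function_mpoly_eval])
  have h2: "Ck_on (Suc (Suc 0)) ?D ?h" using Ck_on_diff[OF R f q_Ck] by (simp add: numeral_2_eq_2)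
  have h1: "Ck_on 1 ?D ?h" using Ck_on_Suc_imp[OF h2] by simp
  have h0: "Ck_on 0 ?D ?h" using Ck_on_Suc_imp[of 0] h1 by simp
  show thesis
  proof (rule that[OF q(1)])
    fix x assume x: "x \<in> ?D"
    have "\<bar>?h x\<bar> \<le> C_norm 0 ?D ?h" by (rule C_norm_0_ge[OF h0 compact_cball x])
    then have "real d ^ 2 * \<bar>?h x\<bar> \<le> real d ^ (2 - 0) * C_norm 0 ?D ?h"
      by (simp add: mult_left_mono)
    also have "\<dots> \<le> a * ?N" by (rule q(2)) simp
    finally show "\<bar>mpoly_eval q x - f x\<bar> \<le> a * ?N / real d ^ 2"
      using d by (simp add: field_simps abs_minus_commute)
    have "norm (?h x, grad ?D ?h x) \<le> C_norm 1 ?D ?h" by (rule norm_le_C_norm[OF h1 x]) simp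
    then have "real d * norm (?h x, grad ?D ?h x) \<le> real d ^ (2 - 1) * C_norm 1 ?D ?h"
      by (simp add: mult_left_mono)
    also have "\<dots> \<le> a * ?N" using d by (intro q(2)) simp
    finally have "norm (?h x, grad ?D ?h x) \<le> a * ?N / real d"
      using d by (simp add: field_simps)
    moreover have "grad ?D ?h x = grad ?D f x - grad ?D (mpoly_eval q) x"
      using f q_Ck[of 1] by (intro grad_diff[OF R x]) (auto simp: numeral_2_eq_2)
    then have "(mpoly_eval q x - f x, grad ?D (mpoly_eval q) x - grad ?D f x) = - (?h x, grad ?D ?h x)"
      by simp
    ultimately show "norm (mpoly_eval q x - f x, grad ?D (mpoly_eval q) x - grad ?D f x) \<le> a * ?N / real d"
      by (simp only: norm_minus_cancel)
  qed
qed

text \<open>A growth constant belongs to one exact degree, so \<open>d\<close> is the degree of the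
  translated polynomial, of which only an upper bound is known; \<open>c\<close> can be chosen only
  after \<open>d\<close>.\<close>

lemma mpoly_growth_outside_disk:
  fixes q :: "'n::finite real_mpoly"
  assumes R: "R > 0"
    and K: "\<And>x. x \<in> cball z0 R \<Longrightarrow> norm (mpoly_eval q x, grad (cball z0 R) (mpoly_eval q) x) \<le> K"
  obtains d where "d \<le> mpoly_degree q"
    "\<And>c x. growth_constant TYPE('n) d c \<Longrightarrow> R \<le> dist z0 x \<Longrightarrow>
       \<bar>mpoly_eval q x\<bar> \<le> c * K * (dist z0 x / R) ^ d * (1 + R)"
proof -
  obtain q' where q': "mpoly_degree q' \<le> mpoly_degree q" "\<And>x. mpoly_eval q' x = mpoly_eval q (x + z0)"
    using polynomial_of_degree_le_translate[of q z0] unfolding polynomial_of_degree_le_def by blast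
  obtain G where G: "\<And>x. GDERIV (mpoly_eval q) x :> G x"
    and "\<And>S. continuous_on S G"
    and Gq: "\<And>z0 R z. R > 0 \<Longrightarrow> z \<in> cball z0 R \<Longrightarrow> grad (cball z0 R) (mpoly_eval q) z = G z"
    using grad_mpoly_eval[of q] by blast
  have "C_norm 1 (cball 0 R) (mpoly_eval q') \<le> K"
  proof (rule C_norm_1_le)
    show "cball (0 :: real^'n) R \<noteq> {}" using R by simp
    fix z :: "real^'n" assume z: "z \<in> cball 0 R"
    have "((\<lambda>x. x + z0) has_derivative (\<lambda>h. h)) (at z)" by (auto intro!: derivative_eq_intros)
    from has_derivative_compose[OF this, of "mpoly_eval q" "\<lambda>h. h \<bullet> G (z + z0)"] G
    have "GDERIV (mpoly_eval q') z :> G (z + z0)" by (simp add: gderiv_def q'(2)[abs_def])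
    from grad_eq_GDERIV[OF R z this]
    have g: "grad (cball 0 R) (mpoly_eval q') z = G (z + z0)" .
    have "z + z0 \<in> cball z0 R" using z by (simp add: dist_norm)
    then show "sqrt ((mpoly_eval q' z)\<^sup>2 + (norm (grad (cball 0 R) (mpoly_eval q') z))\<^sup>2) \<le> K"
      using K[of "z + z0"] Gq[OF R] by (simp add: g q'(2) norm_Pair)
  qed
  then show thesis
  proof (intro that[of "mpoly_degree q'"] q'(1))
    fix c x assume K': "C_norm 1 (cball 0 R) (mpoly_eval q') \<le> K"
      and c: "growth_constant TYPE('n) (mpoly_degree q') c" and x: "R \<le> dist z0 x"
    have n: "norm (x - z0) = dist z0 x" by (simp add: dist_norm norm_minus_commute)
    have "\<bar>mpoly_eval q' (x - z0)\<bar> \<le> c * C_norm 1 (cball 0 R) (mpoly_eval q') * (norm (x - z0) / R) ^ mpoly_degree q' * (1 + R)"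
      using c[unfolded growth_constant_def, THEN conjunct2, rule_format, of R q' "x - z0"] R x n by simp
    also have "\<dots> \<le> c * K * (norm (x - z0) / R) ^ mpoly_degree q' * (1 + R)"
      using K' c R unfolding growth_constant_def by (intro mult_right_mono mult_left_mono) auto
    finally show "\<bar>mpoly_eval q x\<bar> \<le> c * K * (dist z0 x / R) ^ mpoly_degree q' * (1 + R)"
      by (simp add: q'(2) n)
  qed
qed

text \<open>Eliminating \<open>b\<close> twice: negative at 0, positive at \<open>t1\<close> and not
  positive at 1 would force \<open>a < 0\<close>, whereas positive at \<open>t0\<close>, negative at
  0 and positive at \<open>t1\<close> forces \<open>a > 0\<close>.\<close>

lemma quadratic_sign_aux:
  fixes a b c t0 t1 :: real
  assumes "t0 < 0" "0 < t1" "t1 < 1" "c < 0"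
    and "a * t0\<^sup>2 + b * t0 + c > 0" "a * t1\<^sup>2 + b * t1 + c > 0"
  shows "a + b + c > 0"
proof (rule ccontr)
  assume neg: "\<not> a + b + c > 0"
  have "(1 - t1) * (c - a * t1) = (a * t1\<^sup>2 + b * t1 + c) - t1 * (a + b + c)"
    by (simp add: algebra_simps power2_eq_square)
  also have "t1 * (a + b + c) \<le> 0" using assms(2) neg by (simp add: mult_nonneg_nonpos)
  then have "(a * t1\<^sup>2 + b * t1 + c) - t1 * (a + b + c) > 0" using assms(6) by linarith
  finally have "c - a * t1 > 0" using assms(3) by (simp add: zero_less_mult_iff)
  then have "a * t1 < 0" using assms(4) by linarith
  then have a: "a < 0" using assms(2) by (simp add: mult_less_0_iff)
  have "(t1 - t0) * (c - a * t0 * t1) = t1 * (a * t0\<^sup>2 + b * t0 + c) + (- t0) * (a * t1\<^sup>2 + b * t1 + c)"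
    by (simp add: algebra_simps power2_eq_square)
  also have "\<dots> > 0"
    using mult_pos_pos[OF assms(2,5)] mult_pos_pos[OF _ assms(6), of "- t0"] assms(1) by linarith
  finally have "c - a * t0 * t1 > 0" using assms by (simp add: zero_less_mult_iff)
  moreover have "a * t0 * t1 > 0" using a assms by (intro mult_pos_pos mult_neg_neg) auto
  ultimately show False using assms(4) by linarith
qed

text \<open>
  On a line through \<open>y\<close> the quadratic is positive at the two points of the sphere and negative at
  \<open>y\<close> between them, hence positive beyond them.
\<close>

lemma quadratic_positive_outside_disk:
  fixes q :: "'n::finite real_mpoly"
  assumes R: "R > 0" and deg: "mpoly_degree q \<le> 2" and y: "y \<in> ball z0 R" "\<sigma> * mpoly_eval q y < 0"
    and pos: "\<And>x. x \<in> sphere z0 R \<Longrightarrow> \<sigma> * mpoly_eval q x > 0" and x: "R \<le> dist z0 x"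
  shows "\<sigma> * mpoly_eval q x > 0"
proof -
  obtain P where P: "degree P \<le> 2" "\<And>t. poly P t = mpoly_eval q (y + t *\<^sub>R (x - y))"
    using mpoly_eval_on_line deg order_trans by metis
  have poly: "poly P t = coeff P 2 * t\<^sup>2 + coeff P 1 * t + coeff P 0" for t
  proof -
    have "poly P t = (\<Sum>i\<le>2. coeff P i * t ^ i)"
      unfolding poly_altdef by (rule sum.mono_neutral_left) (use P(1) in \<open>auto simp: coeff_eq_0\<close>)
    then show ?thesis by (simp add: numeral_2_eq_2)
  qed
  define \<gamma> where "\<gamma> = (\<lambda>t. y + t *\<^sub>R (x - y))"
  have cont: "continuous_on S (\<lambda>t. dist z0 (\<gamma> t))" for S unfolding \<gamma>_def by (intro continuous_intros)
  have "\<exists>t\<ge>0. t \<le> 1 \<and> dist z0 (\<gamma> t) = R"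
    by (rule IVT'[OF _ _ _ cont]) (use y x in \<open>auto simp: \<gamma>_def\<close>)
  then obtain t1 where t1: "0 \<le> t1" "t1 \<le> 1" "dist z0 (\<gamma> t1) = R" by blast
  \<comment> \<open>At parameter \<open>- L\<close> the point is at distance
    \<open>R + dist z0 y\<close> from \<open>y\<close>, hence not in the open disk, by the triangle
    inequality; so the line also meets the sphere on this side of \<open>y\<close>.\<close>
  define L where "L = (R + dist z0 y) / norm (x - y)"
  have xy: "norm (x - y) > 0" using x y by auto
  have L: "L > 0" using R xy by (simp add: L_def add_pos_nonneg)
  have "\<exists>t\<ge>0. t \<le> L \<and> dist z0 (\<gamma> (- t)) = R"
  proof (rule IVT')
    show "dist z0 (\<gamma> (- 0)) \<le> R" using y by (simp add: \<gamma>_def)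
    have "L * norm (x - y) = R + dist z0 y" using xy by (simp add: L_def)
    moreover have "dist y (\<gamma> (- L)) = L * norm (x - y)" using L by (simp add: \<gamma>_def dist_norm)
    moreover have "dist y (\<gamma> (- L)) \<le> dist z0 y + dist z0 (\<gamma> (- L))"
      using dist_triangle[of y "\<gamma> (- L)" z0] by (simp add: dist_commute)
    ultimately show "R \<le> dist z0 (\<gamma> (- L))" by linarith
    show "continuous_on {0..L} (\<lambda>t. dist z0 (\<gamma> (- t)))" unfolding \<gamma>_def by (intro continuous_intros)
  qed (use L in simp)
  then obtain t0 where t0: "0 \<le> t0" "dist z0 (\<gamma> (- t0)) = R" by blast
  have ne: "t1 \<noteq> 0" "t0 \<noteq> 0" using t1 t0 y by (auto simp: \<gamma>_def)
  have v: "\<sigma> * poly P t = \<sigma> * mpoly_eval q (\<gamma> t)" for t by (simp add: P(2) \<gamma>_def)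
  show ?thesis
  proof (cases "t1 = 1")
    case True
    then show ?thesis using pos[of x] t1(3) by (simp add: \<gamma>_def)
  next
    case False
    have "\<sigma> * coeff P 2 + \<sigma> * coeff P 1 + \<sigma> * coeff P 0 > 0"
    proof (rule quadratic_sign_aux[of "- t0" t1])
      show "\<sigma> * coeff P 0 < 0" using P(2)[of 0] poly[of 0] y(2) by simp
      show "\<sigma> * coeff P 2 * (- t0)\<^sup>2 + \<sigma> * coeff P 1 * (- t0) + \<sigma> * coeff P 0 > 0"
        using v[of "- t0"] pos[of "\<gamma> (- t0)"] t0(2) by (simp add: poly algebra_simps)
      show "\<sigma> * coeff P 2 * t1\<^sup>2 + \<sigma> * coeff P 1 * t1 + \<sigma> * coeff P 0 > 0"
        using v[of t1] pos[of "\<gamma> t1"] t1(3) by (simp add: poly algebra_simps)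
    qed (use t0 t1 ne False in auto)
    then show ?thesis using v[of 1] by (simp add: poly \<gamma>_def algebra_simps)
  qed
qed

lemma small_values_away_from_sphere:
  fixes f :: "real^'n::finite \<Rightarrow> real"
  assumes R: "R > 0" and f: "continuous_on (cball z0 R) f" and pos: "\<And>x. x \<in> sphere z0 R \<Longrightarrow> \<bar>f x\<bar> > e"
  obtains s where "s < R" "\<And>x. x \<in> cball z0 R \<Longrightarrow> \<bar>f x\<bar> \<le> e \<Longrightarrow> dist z0 x \<le> s"
proof (cases "\<exists>x\<in>cball z0 R. \<bar>f x\<bar> \<le> e")
  case True
  let ?S = "cball z0 R \<inter> (\<lambda>x. \<bar>f x\<bar>) -` {..e}"
  have "closed ?S" by (intro continuous_closed_preimage continuous_intros f closed_cball closed_atMost)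
  then have "compact ?S" by (auto simp: compact_eq_bounded_closed intro: bounded_subset[OF bounded_cball])
  then obtain x where x: "x \<in> ?S" "\<And>y. y \<in> ?S \<Longrightarrow> dist z0 y \<le> dist z0 x"
    using continuous_attains_sup[of ?S "dist z0"] True by (force intro: continuous_intros)
  have "dist z0 x < R" using x(1) pos[of x] by (force simp: less_le)
  then show thesis using that[of "dist z0 x"] x(2) by auto
qed (use that[of 0] R in blast)

lemma delta_pos:
  fixes f :: "real^'n::finite \<Rightarrow> real"
  assumes R: "R > 0" and f: "Ck_on (Suc k) (cball z0 R) f" and reg: "regular_equation f z0 R"
    and nz: "\<And>z. z \<in> sphere z0 R \<Longrightarrow> f z \<noteq> 0"
  shows "delta f z0 R > 0"
proof -
  have fc: "continuous_on (cball z0 R) f" using f by (rule Ck_on_imp_continuous_on)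
  have "continuous_on (cball z0 R) (\<lambda>z. (f z, grad (cball z0 R) f z))"
    by (intro continuous_intros fc continuous_on_grad[OF f])
  moreover have "(f z, grad (cball z0 R) f z) \<noteq> 0" if "z \<in> cball z0 R" for z
    using reg that unfolding regular_equation_def by (auto simp: zero_prod_def)
  ultimately obtain b1 where b1: "b1 > 0" "\<And>z. z \<in> cball z0 R \<Longrightarrow> b1 \<le> norm (f z, grad (cball z0 R) f z)"
    using compact_nonzero_imp_bounded_below[OF compact_cball] by blast
  have "continuous_on (sphere z0 R) f" by (rule continuous_on_subset[OF fc]) auto
  then obtain b2 where b2: "b2 > 0" "\<And>z. z \<in> sphere z0 R \<Longrightarrow> b2 \<le> norm (f z)"
    using compact_nonzero_imp_bounded_below[OF compact_sphere] nz by blast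
  have "min b1 b2 \<le> delta f z0 R"
    using b1(2) b2(2) by (intro delta_ge[OF R]) (auto simp: norm_Pair min.coboundedI1 min.coboundedI2)
  then show ?thesis using b1(1) b2(1) by linarith
qed

text \<open>Passing to the smaller disk may lower \<open>delta\<close> through its sphere term, but
  the condition number there records the loss: its product with \<open>delta f z0 r\<close> is the
  norm of \<open>f\<close>, and at a zero this is at least the norm of the gradient, hence at least
  \<open>delta f z0 R\<close>.\<close>

lemma delta_le_cond_number_mult_delta_smaller:
  fixes f :: "real^'n::finite \<Rightarrow> real"
  assumes r: "0 < r" "r < R" and f: "Ck_on 2 (cball z0 R) f" and \<delta>: "delta f z0 R > 0"
    and nz: "\<And>z. z \<in> sphere z0 r \<Longrightarrow> f z \<noteq> 0" and z: "z \<in> cball z0 r" "f z = 0"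
  shows "delta f z0 r > 0" "delta f z0 R \<le> cond_number 2 f z0 r * delta f z0 r"
proof -
  have f1: "f differentiable_on cball z0 R" using f by (simp add: numeral_2_eq_2)
  have fr: "Ck_on 2 (cball z0 r) f" using r by (intro Ck_on_smaller_cball[OF _ _ f]) auto
  have g: "grad (cball z0 r) f x = grad (cball z0 R) f x" if "x \<in> cball z0 r" for x
    using r that by (intro grad_smaller_cball[OF f1]) auto
  have sub: "x \<in> cball z0 R" if "x \<in> cball z0 r" for x using that r by simp
  have R: "R > 0" using r by simp
  have "continuous_on (sphere z0 r) f"
    using r by (intro continuous_on_subset[OF differentiable_imp_continuous_on[OF f1]]) auto
  then obtain b2 where b2: "b2 > 0" "\<And>z. z \<in> sphere z0 r \<Longrightarrow> b2 \<le> norm (f z)"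
    using compact_nonzero_imp_bounded_below[OF compact_sphere] nz by blast
  have "min (delta f z0 R) b2 \<le> delta f z0 r"
    using delta_le[OF R sub, of _ f] g b2(2)
    by (intro delta_ge[OF r(1)]) (auto simp: min.coboundedI1 min.coboundedI2)
  then show pos: "delta f z0 r > 0" using \<delta> b2(1) by linarith
  have "delta f z0 R \<le> norm (f z, grad (cball z0 r) f z)"
    using delta_le_norm[OF R sub[OF z(1)], of f] g[OF z(1)] by simp
  also have "\<dots> \<le> C_norm 2 (cball z0 r) f" by (rule norm_le_C_norm[OF fr z(1)]) simp
  also have "\<dots> = cond_number 2 f z0 r * delta f z0 r" using pos by (simp add: cond_number_def)
  finally show "delta f z0 R \<le> cond_number 2 f z0 r * delta f z0 r" .
qed

lemma radial_power_gradient: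
  fixes z0 x :: "real^'n::finite"
  shows "GDERIV (\<lambda>x. A * ((norm (x - z0))\<^sup>2 / R\<^sup>2) ^ k) x :>
    (A * (real k * ((norm (x - z0))\<^sup>2 / R\<^sup>2) ^ (k - 1)) * (2 / R\<^sup>2)) *\<^sub>R (x - z0)"
proof -
  have 1: "((\<lambda>x. (x - z0) \<bullet> (x - z0)) has_derivative (\<lambda>h. h \<bullet> (2 *\<^sub>R (x - z0)))) (at x)"
    by (auto intro!: derivative_eq_intros simp: inner_commute)
  have "((\<lambda>u. A * (u / R\<^sup>2) ^ k) has_real_derivative
      A * (real k * ((norm (x - z0))\<^sup>2 / R\<^sup>2) ^ (k - 1)) * (1 / R\<^sup>2)) (at ((norm (x - z0))\<^sup>2))"
  proof -
    have "((\<lambda>u. u / R\<^sup>2) has_real_derivative 1 / R\<^sup>2) (at u)" for u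
      by (rule DERIV_cdivide[OF DERIV_ident])
    from DERIV_cmult[OF DERIV_power[OF this], of A k] show ?thesis by (simp add: mult_ac)
  qed
  then show ?thesis
    using GDERIV_DERIV_compose[of "\<lambda>x. (x - z0) \<bullet> (x - z0)" x "2 *\<^sub>R (x - z0)"
      "\<lambda>u. A * (u / R\<^sup>2) ^ k" "A * (real k * ((norm (x - z0))\<^sup>2 / R\<^sup>2) ^ (k - 1)) * (1 / R\<^sup>2)"] 1
    by (simp add: gderiv_def power2_norm_eq_inner mult.assoc)
qed

lemma radial_power_norm_le:
  fixes z0 x :: "real^'n::finite"
  assumes A: "A \<ge> 0" and R: "R > 0" and s: "s > 0" and k: "k \<ge> 1" and x: "dist z0 x \<le> s"
  shows "norm (A * ((norm (x - z0))\<^sup>2 / R\<^sup>2) ^ k,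
      (A * (real k * ((norm (x - z0))\<^sup>2 / R\<^sup>2) ^ (k - 1)) * (2 / R\<^sup>2)) *\<^sub>R (x - z0))
    \<le> A * ((s / R) ^ (2 * k) * (1 + real (2 * k) / s))"
proof -
  define d where "d = norm (x - z0)"
  have d: "0 \<le> d" "d \<le> s" using x by (auto simp: d_def dist_norm norm_minus_commute)
  have p: "(d\<^sup>2 / R\<^sup>2) ^ j \<le> (s\<^sup>2 / R\<^sup>2) ^ j" for j
    using d by (intro power_mono divide_right_mono) auto
  have sk: "(s\<^sup>2 / R\<^sup>2) ^ k = (s\<^sup>2 / R\<^sup>2) ^ (k - 1) * (s\<^sup>2 / R\<^sup>2)"
    using k by (cases k) auto
  have "norm (A * (d\<^sup>2 / R\<^sup>2) ^ k, (A * (real k * (d\<^sup>2 / R\<^sup>2) ^ (k - 1)) * (2 / R\<^sup>2)) *\<^sub>R (x - z0))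
      \<le> norm (A * (d\<^sup>2 / R\<^sup>2) ^ k) + norm ((A * (real k * (d\<^sup>2 / R\<^sup>2) ^ (k - 1)) * (2 / R\<^sup>2)) *\<^sub>R (x - z0))"
    by (rule norm_Pair_le)
  also have "\<dots> = A * (d\<^sup>2 / R\<^sup>2) ^ k + A * (real k * (d\<^sup>2 / R\<^sup>2) ^ (k - 1)) * (2 / R\<^sup>2) * d"
    using A by (simp add: abs_mult d_def)
  also have "\<dots> \<le> A * (s\<^sup>2 / R\<^sup>2) ^ k + A * (real k * (s\<^sup>2 / R\<^sup>2) ^ (k - 1)) * (2 / R\<^sup>2) * s"
    using A d s p by (intro add_mono mult_mono mult_left_mono) auto
  also have "\<dots> = A * ((s\<^sup>2 / R\<^sup>2) ^ k * (1 + real (2 * k) / s))"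
    unfolding sk using s R by (simp add: field_simps power2_eq_square)
  also have "(s\<^sup>2 / R\<^sup>2) ^ k = (s / R) ^ (2 * k)" by (simp add: power_mult power_divide)
  finally show ?thesis by (simp add: d_def)
qed

section \<open>Zero sets of polynomials in dimension one\<close>

lemma mpoly_with_finite_zero_set_dim_1:
  assumes n: "CARD('n::finite) = 1" and Z: "finite (Z :: (real^'n) set)"
  shows "\<exists>p. mpoly_degree p \<le> card Z \<and> {x. mpoly_eval p x = 0} = Z"
proof -
  obtain i :: 'n where i: "UNIV = {i}" using n card_1_singletonE by blast
  have eq: "x = z \<longleftrightarrow> x $ i = z $ i" for x z :: "real^'n"
    unfolding vec_eq_iff using i by (metis UNIV_I singletonD)
  have "polynomial_of_degree_le (\<Sum>z\<in>Z. 1) (\<lambda>x :: real^'n. \<Prod>z\<in>Z. (x $ i - z $ i))"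
    by (rule polynomial_of_degree_le_prod[OF Z polynomial_of_degree_le_coordinate_diff])
  then obtain p where "mpoly_degree p \<le> card Z" "\<And>x. mpoly_eval p x = (\<Prod>z\<in>Z. (x $ i - z $ i))"
    unfolding polynomial_of_degree_le_def by auto
  moreover have "(\<Prod>z\<in>Z. (x $ i - z $ i)) = 0 \<longleftrightarrow> x \<in> Z" for x
    unfolding prod_zero_iff[OF Z] right_minus_eq eq[symmetric] by blast
  ultimately show ?thesis by (intro exI[of _ p]) simp
qed

lemma card_zeros_mpoly_dim_1:
  fixes q :: "'n::finite real_mpoly"
  assumes n: "CARD('n) = 1" and nz: "mpoly_eval q x0 \<noteq> 0"
  shows "finite {x. mpoly_eval q x = 0}" "card {x. mpoly_eval q x = 0} \<le> mpoly_degree q"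
proof -
  obtain i :: 'n where i: "UNIV = {i}" using n card_1_singletonE by blast
  obtain P where P: "degree P \<le> mpoly_degree q" "\<And>t. poly P t = mpoly_eval q (0 + t *\<^sub>R axis i 1)"
    using mpoly_eval_on_line by blast
  have x: "x = 0 + (x $ i) *\<^sub>R axis i 1" for x :: "real^'n"
    unfolding vec_eq_iff using i by (auto simp: axis_def)
  have px: "poly P (x $ i) = mpoly_eval q x" for x
    using P(2)[of "x $ i"] x[of x] by simp
  have P0: "P \<noteq> 0" using px[of x0] nz by auto
  have sub: "{x. mpoly_eval q x = 0} \<subseteq> (\<lambda>t. 0 + t *\<^sub>R axis i 1) ` {t. poly P t = 0}"
    using x px by (metis (mono_tags, lifting) image_eqI mem_Collect_eq subsetI)
  have fin: "finite {t. poly P t = 0}" by (rule poly_roots_finite[OF P0])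
  show "finite {x. mpoly_eval q x = 0}" using finite_subset[OF sub] fin by blast
  have "card {x. mpoly_eval q x = 0} \<le> card {t. poly P t = 0}"
    using surj_card_le[OF fin sub] .
  also have "\<dots> \<le> degree P" by (rule card_poly_roots_bound[OF P0])
  finally show "card {x. mpoly_eval q x = 0} \<le> mpoly_degree q" using P(1) by simp
qed

text \<open>Without a correction term: zeros of the homotopy satisfy
  \<open>\<bar>f x\<bar> <= e\<close> with \<open>e\<close> below \<open>delta\<close>, while
  \<open>\<bar>f\<bar>\<close> is at least \<open>delta\<close> on the sphere, so they stay away
  from it. Zeros of \<open>q\<close> outside the disk are left open.\<close>

lemma approximation_diffeotopic_in_disk:
  fixes f :: "real^'n::finite \<Rightarrow> real"
  assumes R: "R > 0" and a: "weierstrass_constant (cball z0 R) a" and f: "Ck_on 2 (cball z0 R) f"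
    and \<delta>: "delta f z0 R > 0" and nz: "\<And>z. z \<in> sphere z0 R \<Longrightarrow> f z \<noteq> 0"
    and d: "d \<ge> 2" "a * C_norm 2 (cball z0 R) f / real d < delta f z0 R"
  obtains q where "mpoly_degree q \<le> d"
    "\<And>x. x \<in> cball z0 R \<Longrightarrow> \<bar>mpoly_eval q x - f x\<bar> < delta f z0 R"
    "diffeotopic_sets {x\<in>ball z0 R. mpoly_eval q x = 0} {x\<in>ball z0 R. f x = 0}"
proof -
  let ?D = "cball z0 R"
  obtain q where q: "mpoly_degree q \<le> d"
    "\<And>x. x \<in> ?D \<Longrightarrow> norm (mpoly_eval q x - f x, grad ?D (mpoly_eval q) x - grad ?D f x)
        \<le> a * C_norm 2 ?D f / real d"
    using weierstrass_approximation_C1[OF R a f d(1)] by metis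
  obtain G where G: "\<And>x. GDERIV (mpoly_eval q) x :> G x" and Gc: "\<And>S. continuous_on S G"
    and Gq: "\<And>z0 R z. R > 0 \<Longrightarrow> z \<in> cball z0 R \<Longrightarrow> grad (cball z0 R) (mpoly_eval q) z = G z"
    using grad_mpoly_eval[of q] by blast
  have f1: "Ck_on (Suc 0) ?D f" using f unfolding numeral_2_eq_2 by (rule Ck_on_Suc_imp)
  have fd: "f differentiable_on ?D" using f1 by simp
  have fc: "continuous_on ?D f" using f1 by (rule Ck_on_imp_continuous_on)
  define e where "e = a * C_norm 2 ?D f / real d"
  have close: "norm (mpoly_eval q x - f x, G x - grad ?D f x) \<le> e" if "x \<in> ?D" for x
    using q(2)[OF that] Gq[OF R that] by (simp add: e_def)
  have close0: "\<bar>mpoly_eval q x - f x\<bar> \<le> e" if "x \<in> ?D" for x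
    using close[OF that] norm_fst_le[of "mpoly_eval q x - f x" "G x - grad ?D f x"] by simp
  have e\<delta>: "e < delta f z0 R" using d(2) by (simp add: e_def)
  have "\<bar>f x\<bar> > e" if "x \<in> sphere z0 R" for x
    using delta_le_abs_on_sphere[OF R fd nz that] e\<delta> by linarith
  then obtain s where s: "s < R" "\<And>x. x \<in> ?D \<Longrightarrow> \<bar>f x\<bar> \<le> e \<Longrightarrow> dist z0 x \<le> s"
    using small_values_away_from_sphere[OF R fc] by blast
  have "diffeotopic_sets {x\<in>ball z0 R. mpoly_eval q x = 0} {x\<in>ball z0 R. f x = 0}"
  proof (rule diffeotopic_zero_sets_of_small_difference[OF GDERIV_grad[OF fd] _ G Gc s(1)])
    show "continuous_on (ball z0 R) (grad ?D f)"
      by (rule continuous_on_subset[OF continuous_on_grad[OF f1]]) auto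
    show "dist z0 x \<le> s"
      if t: "t \<in> {0..1}" and x: "x \<in> ball z0 R" and zero: "f x + t * (mpoly_eval q x - f x) = 0" for t x
    proof -
      have "\<bar>f x\<bar> = \<bar>t\<bar> * \<bar>mpoly_eval q x - f x\<bar>" using zero
        by (metis abs_minus_cancel abs_mult add_eq_0_iff)
      also have "\<dots> \<le> 1 * \<bar>mpoly_eval q x - f x\<bar>" using t by (intro mult_right_mono) auto
      also have "\<dots> \<le> e" using close0[of x] x by simp
      finally show ?thesis using s(2)[of x] x by simp
    qed
    fix x assume "dist z0 x \<le> s"
    then have x: "x \<in> ?D" using s(1) by simp
    show "norm (mpoly_eval q x - f x, G x - grad ?D f x) < norm (f x, grad ?D f x)"
      using close[OF x] e\<delta> delta_le_norm[OF R x, of f] by linarith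
  qed
  then show thesis using that[OF q(1)] close0 e\<delta> by (meson le_less_trans)
qed

text \<open>The correction has the sign of \<open>f\<close> near the boundary, so it cannot create
  zeros where \<open>\<sigma> * f > e0\<close>, however large it is there. The uniform error
  \<open>e0\<close> alone locates the zeros; the \<open>C^1\<close> error \<open>e1\<close> and the
  size of the power matter only on the disk of radius \<open>s\<close>.\<close>

lemma perturbed_polynomial_diffeotopic:
  fixes f :: "real^'n::finite \<Rightarrow> real" and q :: "'n real_mpoly"
  assumes R: "R > 0" and f: "Ck_on 2 (cball z0 R) f" and \<sigma>: "\<sigma> \<in> {1, -1}"
    and q0: "\<And>x. x \<in> cball z0 R \<Longrightarrow> \<bar>mpoly_eval q x - f x\<bar> \<le> e0"
    and q1: "\<And>x. x \<in> cball z0 R \<Longrightarrow>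
      norm (mpoly_eval q x - f x, grad (cball z0 R) (mpoly_eval q) x - grad (cball z0 R) f x) \<le> e1"
    and near: "\<And>x. x \<in> cball z0 R \<Longrightarrow> \<sigma> * f x \<le> e0 \<Longrightarrow> dist z0 x \<le> r \<and> dist z0 x \<le> s"
    and r: "r < R" and s: "s > 0" and k: "k \<ge> 1" and A0: "A0 \<ge> 0"
    and outside: "\<And>x. R \<le> dist z0 x \<Longrightarrow> \<bar>mpoly_eval q x\<bar> \<le> A0 * (dist z0 x / R) ^ (2 * k)"
    and small: "A0 * ((s / R) ^ (2 * k) * (1 + real (2 * k) / s)) + e1 < delta f z0 R"
  shows "\<exists>p. mpoly_degree p \<le> max (mpoly_degree q) (2 * k) \<and>
    diffeotopic_sets {x. mpoly_eval p x = 0} {x\<in>ball z0 R. f x = 0}"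
proof -
  let ?D = "cball z0 R"
  define H where "H = (s / R) ^ (2 * k) * (1 + real (2 * k) / s)"
  have H: "H > 0" using s R by (simp add: H_def add_pos_nonneg)
  \<comment> \<open>Half of the gap in \<open>small\<close> is spent on making \<open>A\<close>
    strictly larger than \<open>A0\<close>; then the power strictly dominates \<open>q\<close>
    outside the disk.\<close>
  define A where "A = A0 + (delta f z0 R - e1 - A0 * H) / (2 * H)"
  have A: "A > A0" "A * H + e1 < delta f z0 R"
  proof -
    have gap: "delta f z0 R - e1 - A0 * H > 0" using small by (simp add: H_def)
    then show "A > A0" using H by (simp add: A_def)
    have "A * H = A0 * H + (delta f z0 R - e1 - A0 * H) / 2" using H by (simp add: A_def field_simps)
    then show "A * H + e1 < delta f z0 R" using gap by (simp add: field_simps)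
  qed
  define g where "g = (\<lambda>x. A * ((norm (x - z0))\<^sup>2 / R\<^sup>2) ^ k)"
  define Gg where "Gg = (\<lambda>x. (A * (real k * ((norm (x - z0))\<^sup>2 / R\<^sup>2) ^ (k - 1)) * (2 / R\<^sup>2)) *\<^sub>R (x - z0))"
  have g: "GDERIV g x :> Gg x" for x unfolding g_def Gg_def by (rule radial_power_gradient)
  have g0: "g x \<ge> 0" for x using A A0 by (simp add: g_def)
  have g_norm: "norm (g x, Gg x) \<le> A * H" if "dist z0 x \<le> s" for x
    unfolding g_def Gg_def H_def using A A0 R s k that by (intro radial_power_norm_le) auto
  obtain G where G: "\<And>x. GDERIV (mpoly_eval q) x :> G x" and Gc: "\<And>S. continuous_on S G"
    and Gq: "\<And>z0 R z. R > 0 \<Longrightarrow> z \<in> cball z0 R \<Longrightarrow> grad (cball z0 R) (mpoly_eval q) z = G z"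
    using grad_mpoly_eval[of q] by blast
  have f1: "Ck_on (Suc 0) ?D f" using f unfolding numeral_2_eq_2 by (rule Ck_on_Suc_imp)
  have fd: "f differentiable_on ?D" using f1 by simp
  have \<sigma>1: "\<sigma> * \<sigma> = 1" "\<bar>\<sigma>\<bar> = 1" using \<sigma> by auto
  have "polynomial_of_degree_le (max (mpoly_degree q) (2 * k)) (\<lambda>x. mpoly_eval q x + \<sigma> * g x)"
  proof (rule polynomial_of_degree_le_add)
    show "polynomial_of_degree_le (max (mpoly_degree q) (2 * k)) (mpoly_eval q)"
      by (rule polynomial_of_degree_le_mono[OF polynomial_of_degree_le_mpoly]) simp
    have "polynomial_of_degree_le (0 + k * 2) (\<lambda>x. (\<sigma> * A / (R\<^sup>2) ^ k) * ((norm (x - z0))\<^sup>2) ^ k)"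
      by (intro polynomial_of_degree_le_mult polynomial_of_degree_le_const polynomial_of_degree_le_power
          polynomial_of_degree_le_norm_power2)
    moreover have "(\<lambda>x. (\<sigma> * A / (R\<^sup>2) ^ k) * ((norm (x - z0))\<^sup>2) ^ k) = (\<lambda>x. \<sigma> * g x)"
      by (simp add: g_def power_divide mult.assoc)
    ultimately show "polynomial_of_degree_le (max (mpoly_degree q) (2 * k)) (\<lambda>x. \<sigma> * g x)"
      by (auto elim: polynomial_of_degree_le_mono)
  qed
  then obtain p where p: "mpoly_degree p \<le> max (mpoly_degree q) (2 * k)"
      "\<And>x. mpoly_eval p x = mpoly_eval q x + \<sigma> * g x"
    unfolding polynomial_of_degree_le_def by blast
  have "diffeotopic_sets {x\<in>ball z0 R. mpoly_eval p x = 0} {x\<in>ball z0 R. f x = 0}"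
  proof (rule diffeotopic_zero_sets_of_small_difference[OF GDERIV_grad[OF fd], of z0 R "mpoly_eval p" "\<lambda>x. G x + \<sigma> *\<^sub>R Gg x" "min r s"])
    show "continuous_on (ball z0 R) (grad ?D f)"
      by (rule continuous_on_subset[OF continuous_on_grad[OF f1]]) auto
    show "GDERIV (mpoly_eval p) x :> G x + \<sigma> *\<^sub>R Gg x" for x
      using GDERIV_add[OF G GDERIV_mult[OF GDERIV_const g]] by (simp add: p(2)[abs_def])
    show "continuous_on (ball z0 R) (\<lambda>x. G x + \<sigma> *\<^sub>R Gg x)"
      unfolding Gg_def using R by (intro continuous_intros Gc) auto
    show "min r s < R" using r by simp
    show "dist z0 x \<le> min r s"
      if t: "t \<in> {0..1}" and x: "x \<in> ball z0 R" and zero: "f x + t * (mpoly_eval p x - f x) = 0" for t x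
    proof -
      \<comment> \<open>After multiplication by \<open>\<sigma>\<close> the power appears with the
        sign that only lowers \<open>\<sigma> * f x\<close>, so it can be discarded.\<close>
      have "0 = \<sigma> * (f x + t * (mpoly_eval q x - f x + \<sigma> * g x))" using zero by (simp add: p(2) algebra_simps)
      also have "\<dots> = \<sigma> * f x + t * (\<sigma> * (mpoly_eval q x - f x)) + t * (\<sigma> * \<sigma> * g x)"
        by (simp add: algebra_simps)
      finally have "\<sigma> * f x = - (t * (\<sigma> * (mpoly_eval q x - f x))) - t * g x"
        unfolding \<sigma>1 by (simp add: algebra_simps)
      moreover have "t * g x \<ge> 0" using t g0 by simp
      moreover have "\<bar>t * (\<sigma> * (mpoly_eval q x - f x))\<bar> \<le> 1 * (1 * e0)"
        unfolding abs_mult \<sigma>1 using t q0[of x] x by (intro mult_mono) auto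
      ultimately have "\<sigma> * f x \<le> e0" by linarith
      then show ?thesis using near[of x] x by simp
    qed
    fix x assume "dist z0 x \<le> min r s"
    then have x: "x \<in> ?D" "dist z0 x \<le> s" using r by auto
    have "(mpoly_eval p x - f x, G x + \<sigma> *\<^sub>R Gg x - grad ?D f x)
        = (mpoly_eval q x - f x, G x - grad ?D f x) + \<sigma> *\<^sub>R (g x, Gg x)"
      by (simp add: p(2))
    then have "norm (mpoly_eval p x - f x, G x + \<sigma> *\<^sub>R Gg x - grad ?D f x)
        \<le> norm (mpoly_eval q x - f x, G x - grad ?D f x) + norm (\<sigma> *\<^sub>R (g x, Gg x))"
      by (metis norm_triangle_ineq)
    also have "\<dots> \<le> e1 + A * H"
      using q1[OF x(1)] Gq[OF R x(1)] g_norm[OF x(2)] \<sigma>1(2) unfolding norm_scaleR by simp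
    also have "\<dots> < norm (f x, grad ?D f x)"
      using A(2) delta_le_norm[OF R x(1), of f] by linarith
    finally show "norm (mpoly_eval p x - f x, G x + \<sigma> *\<^sub>R Gg x - grad ?D f x) < norm (f x, grad ?D f x)" .
  qed
  moreover have "mpoly_eval p x \<noteq> 0" if x: "x \<notin> ball z0 R" for x
  proof -
    have Rx: "R \<le> dist z0 x" using x by simp
    have d: "norm (x - z0) = dist z0 x" by (simp add: dist_norm norm_minus_commute)
    have gx: "g x = A * (dist z0 x / R) ^ (2 * k)" by (simp add: g_def d power_mult power_divide)
    have "(dist z0 x / R) ^ (2 * k) > 0" using Rx R by (intro zero_less_power divide_pos_pos) auto
    then have "\<bar>mpoly_eval q x\<bar> < g x"
      using outside[OF Rx] A(1) unfolding gx by (smt (verit) mult_strict_right_mono)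
    then have "\<bar>mpoly_eval q x\<bar> < \<bar>\<sigma> * g x\<bar>" using \<sigma>1(2) g0[of x] by (simp add: abs_mult)
    then show ?thesis unfolding p(2) by linarith
  qed
  then have "{x. mpoly_eval p x = 0} = {x\<in>ball z0 R. mpoly_eval p x = 0}" by blast
  ultimately show ?thesis using p(1) by auto
qed

section \<open>The degree bound\<close>

lemma le_Max_of_le_member: "finite S \<Longrightarrow> b \<in> S \<Longrightarrow> (x::real) \<le> b \<Longrightarrow> x \<le> Max S"
  using Max_ge order_trans by blast

lemma even_floor_bounds:
  fixes x :: real
  assumes "x \<ge> 0"
  obtains k :: nat where "real (2 * k) \<le> x" "x < real (2 * k) + 2"
proof -
  have "real (2 * nat \<lfloor>x / 2\<rfloor>) \<le> x" "x < real (2 * nat \<lfloor>x / 2\<rfloor>) + 2" using assms by linarith+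
  then show thesis by (rule that)
qed

theorem theorem33:
  fixes z0 :: "real^'n::finite"
    and f :: "real^'n \<Rightarrow> real"
    and D Zf :: "(real^'n) set"
    and R r \<tau> a2 :: real
    and c1 :: "nat \<Rightarrow> nat \<Rightarrow> real"
    and \<kappa> :: "nat \<Rightarrow> real"
  assumes a2: "weierstrass_constant D a2"
    and c1: "\<And>d. growth_constant TYPE('n) d (c1 CARD('n) d)"
    and R: "R > 0"
    and D: "D = cball z0 R"
    and f: "Ck_on 2 D f"
    and regular: "regular_equation f z0 R"
    and Zf: "Zf = {z\<in>D. f z = 0}"
    and Zf_interior: "Zf \<subseteq> interior D"
    and \<tau>: "\<tau> > 0"
    and \<tau>_attained: "\<exists>z\<in>Zf. norm (z - z0) = exp (- 3 * \<tau>) * R"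
    and \<tau>_maximal: "\<forall>z\<in>Zf. norm (z - z0) \<le> exp (- 3 * \<tau>) * R"
    and r: "r = exp (- 2 * \<tau>) * R"
    and \<kappa>: "\<And>l. l \<in> {1, 2} \<Longrightarrow> \<kappa> l = max (cond_number l f z0 R) (cond_number l f z0 r)"
  shows "\<exists>d::nat. real d \<le> max 1 (\<kappa> 2 * (2 * a2)) \<and>
    (\<exists>p :: 'n real_mpoly.
      real (mpoly_degree p) \<le>
        Max {1, \<kappa> 2 * (2 * a2),
             (ln (\<kappa> 1) + ln (1 / \<tau>)
                + ln (8 + 8 / (R * exp (- \<tau>)) + 4 * (R * exp (- \<tau>)) + 4 * \<tau>)
                + ln (c1 CARD('n) d)) / \<tau>} \<and>
      diffeotopic_sets {x. mpoly_eval p x = 0} Zf)"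
proof -
  note a2 = a2[unfolded D] and f = f[unfolded D] and Zf = Zf[unfolded D] and Zf_interior = Zf_interior[unfolded D]
  let ?D = "cball z0 R"
  define \<delta> where "\<delta> = delta f z0 R"
  define N where "N = C_norm 2 ?D f"
  define w where "w = exp (- 3 * \<tau>) * R"
  have "Ck_on (Suc 0) ?D f" using f unfolding numeral_2_eq_2 by (rule Ck_on_Suc_imp)
  then have f1: "Ck_on 1 ?D f" by simp
  have fd: "f differentiable_on ?D" using f1 by simp
  have fc: "continuous_on ?D f" using f by (rule Ck_on_imp_continuous_on)
  have a2_1: "a2 \<ge> 1" by (rule weierstrass_constant_ge_1[OF a2 R])
  have w: "0 < w" "w < r" "r < R"
  proof -
    show "0 < w" using R by (simp add: w_def)
    show "w < r" unfolding w_def r using R \<tau> by simp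
    show "r < R" unfolding r using R \<tau> by simp
  qed
  have zeros: "dist z0 z \<le> w" if "z \<in> ?D" "f z = 0" for z
    using \<tau>_maximal that by (auto simp: Zf w_def dist_norm norm_minus_commute[of z0])
  obtain z1 where z1: "z1 \<in> ?D" "f z1 = 0" "dist z0 z1 = w"
    using \<tau>_attained by (auto simp: Zf w_def dist_norm norm_minus_commute)
  have nz: "f z \<noteq> 0" if "w < dist z0 z" "dist z0 z \<le> R" for z
    using zeros[of z] that by auto
  have nzR: "f z \<noteq> 0" if "z \<in> sphere z0 R" for z using nz[of z] that w by simp
  have nzr: "f z \<noteq> 0" if "z \<in> sphere z0 r" for z using nz[of z] that w by simp
  have Zf_ball: "{x\<in>ball z0 R. f x = 0} = Zf" unfolding Zf using zeros w by fastforce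
  have f1': "Ck_on (Suc 0) ?D f" using f1 by simp
  have \<delta>: "\<delta> > 0" unfolding \<delta>_def by (rule delta_pos[OF R f1' regular nzR])
  have N\<kappa>: "N \<le> \<kappa> 2 * \<delta>"
  proof -
    have "N / \<delta> \<le> \<kappa> 2" using \<kappa>[of 2] by (simp add: cond_number_def N_def \<delta>_def)
    then show ?thesis using \<delta> by (simp add: field_simps)
  qed
  have C1\<kappa>: "C_norm 1 ?D f \<le> \<kappa> 1 * \<delta>"
  proof -
    have "C_norm 1 ?D f / \<delta> \<le> \<kappa> 1" using \<kappa>[of 1] by (simp add: cond_number_def \<delta>_def)
    then show ?thesis using \<delta> by (simp add: field_simps)
  qed
  have \<delta>_le: "\<delta> \<le> C_norm l ?D f" if "Ck_on l ?D f" "l \<ge> 1" for l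
    using delta_le_norm[OF R z1(1), of f] norm_le_C_norm[OF that(1) z1(1) that(2)] by (simp add: \<delta>_def)
  have \<kappa>1: "\<kappa> 1 \<ge> 1"
    using order_trans[OF \<delta>_le[OF f1] C1\<kappa>] \<delta> by simp
  have \<kappa>2: "\<kappa> 2 \<ge> 1"
    using order_trans[OF \<delta>_le[OF f, unfolded N_def[symmetric]] N\<kappa>] \<delta> by simp
  define M2 where "M2 = \<kappa> 2 * (2 * a2)"
  \<comment> \<open>Here \<open>a2 >= 1\<close> enters.\<close>
  have M2: "2 * \<kappa> 2 \<le> M2" using a2_1 \<kappa>2 by (simp add: M2_def mult_left_mono)
  have aN: "a2 * N \<le> M2 * \<delta> / 2"
    using mult_left_mono[OF N\<kappa>, of a2] a2_1 by (simp add: M2_def mult_ac)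
  show ?thesis
  proof (cases "CARD('n) = 1")
    case True
    \<comment> \<open>Already \<open>M2 < 2 * d\<close> brings the error \<open>a2 * N / d\<close>,
      at most \<open>M2 * \<delta> / (2 * d)\<close>, below \<open>\<delta>\<close>; in dimension
      one no even degree is needed.\<close>
    define d where "d = nat \<lfloor>M2\<rfloor>"
    have d: "real d \<le> M2" "M2 < real d + 1" "d \<ge> 2"
      using M2 \<kappa>2 unfolding d_def by linarith+
    have "a2 * N / real d < \<delta>"
    proof -
      have "M2 * \<delta> < (2 * real d) * \<delta>" using d \<delta> by (intro mult_strict_right_mono) auto
      then have "a2 * N < real d * \<delta>" using aN by linarith
      then show ?thesis using d(3) by (simp add: field_simps)
    qed
    then obtain q where q: "mpoly_degree q \<le> d" "\<And>x. x \<in> ?D \<Longrightarrow> \<bar>mpoly_eval q x - f x\<bar> < \<delta>"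
      "diffeotopic_sets {x\<in>ball z0 R. mpoly_eval q x = 0} {x\<in>ball z0 R. f x = 0}"
      using approximation_diffeotopic_in_disk[OF R a2 f, of d] \<delta> nzR d(3) unfolding \<delta>_def N_def by blast
    obtain x0 where x0: "x0 \<in> sphere z0 R" using R sphere_eq_empty[of z0 R] by fastforce
    have "mpoly_eval q x0 \<noteq> 0"
      using q(2)[of x0] delta_le_abs_on_sphere[OF R fd nzR x0] x0 by (force simp: \<delta>_def)
    from card_zeros_mpoly_dim_1[OF True this]
    have fin: "finite {x. mpoly_eval q x = 0}" "card {x. mpoly_eval q x = 0} \<le> d" using q(1) by auto
    \<comment> \<open>The diffeotopy serves only for counting: its end map sends the zeros of
      \<open>q\<close> in the ball onto \<open>Zf\<close>, which therefore has at most
      \<open>d\<close> points.\<close>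
    obtain \<phi> where \<phi>: "\<phi> ` {x\<in>ball z0 R. mpoly_eval q x = 0} = Zf"
      using q(3) unfolding diffeotopic_sets_def Zf_ball by blast
    have sub: "finite {x\<in>ball z0 R. mpoly_eval q x = 0}" "card {x\<in>ball z0 R. mpoly_eval q x = 0} \<le> d"
      using fin by (auto intro: finite_subset[OF _ fin(1)] order_trans[OF card_mono[OF fin(1)]])
    have "finite Zf" "card Zf \<le> d"
      unfolding \<phi>[symmetric] using sub card_image_le[OF sub(1), of \<phi>] by auto
    then obtain p where p: "mpoly_degree p \<le> card Zf" "{x. mpoly_eval p x = 0} = Zf"
      using mpoly_with_finite_zero_set_dim_1[OF True] by blast
    have "real (mpoly_degree p) \<le> M2" using p(1) \<open>card Zf \<le> d\<close> d(1) by linarith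
    then have "real (mpoly_degree p) \<le> Max {1, \<kappa> 2 * (2 * a2),
             (ln (\<kappa> 1) + ln (1 / \<tau>)
                + ln (8 + 8 / (R * exp (- \<tau>)) + 4 * (R * exp (- \<tau>)) + 4 * \<tau>)
                + ln (c1 CARD('n) d)) / \<tau>}"
      by (intro le_Max_of_le_member[of _ M2]) (auto simp: M2_def)
    moreover have "diffeotopic_sets {x. mpoly_eval p x = 0} Zf"
      unfolding p(2) by (rule diffeotopic_sets_refl)
    ultimately show ?thesis using d(1) unfolding M2_def by (intro exI[of _ d]) auto
  next
    case False
    then have n: "CARD('n) \<ge> 2" using zero_less_card_finite[where 'a='n] by linarith
    obtain \<sigma> where \<sigma>: "\<sigma> \<in> {1, -1 :: real}" "\<And>x. w < dist z0 x \<Longrightarrow> dist z0 x \<le> R \<Longrightarrow> \<sigma> * f x > 0"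
      using constant_sign_on_annulus[OF n fc, of w] nz by blast
    have \<sigma>1: "\<sigma> * \<sigma> = 1" "\<bar>\<sigma>\<bar> = 1" using \<sigma>(1) by auto
    have f_pos: "\<sigma> * f x = \<bar>f x\<bar>" if "w < dist z0 x" "dist z0 x \<le> R" for x
      using \<sigma>(2)[OF that] \<sigma>1(2) by (metis abs_mult abs_of_pos mult_1)
    \<comment> \<open>This critical point is used twice: as the negative point of the quadratic, and
      for the lower bound on \<open>w\<close> in degree 4.\<close>
    obtain y where y: "dist z0 y \<le> w" "grad ?D f y = 0" "\<sigma> * f y \<le> - \<delta>"
      using interior_minimum_below_delta[OF \<sigma>1(2) w(1) _ fd \<sigma>(2), of z1] w z1 \<delta> unfolding \<delta>_def
      by (metis less_trans order_refl)
    have yb: "y \<in> ball z0 R" using y(1) w by simp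
    have f_sphere: "\<delta> \<le> \<bar>f x\<bar>" if "x \<in> sphere z0 R" for x
      unfolding \<delta>_def by (rule delta_le_abs_on_sphere[OF R fd nzR that])
    show ?thesis
    proof (cases "M2 < 4")
      case True
      \<comment> \<open>Degree 2 suffices, as
        \<open>a2 * N / 2 <= M2 * \<delta> / 4 < \<delta>\<close>.\<close>
      have "M2 * \<delta> < 4 * \<delta>" using True \<delta> by (rule mult_strict_right_mono)
      then have "a2 * N / 2 < \<delta>" using aN by linarith
      then have "a2 * N / real 2 < \<delta>" by simp
      then obtain q where q: "mpoly_degree q \<le> 2" "\<And>x. x \<in> ?D \<Longrightarrow> \<bar>mpoly_eval q x - f x\<bar> < \<delta>"
        "diffeotopic_sets {x\<in>ball z0 R. mpoly_eval q x = 0} {x\<in>ball z0 R. f x = 0}"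
        using approximation_diffeotopic_in_disk[OF R a2 f, of 2] \<delta> nzR unfolding \<delta>_def N_def by blast
      have \<sigma>q: "\<bar>\<sigma> * mpoly_eval q x - \<sigma> * f x\<bar> < \<delta>" if "x \<in> ?D" for x
        using q(2)[OF that] \<sigma>1(2) by (simp add: abs_mult flip: right_diff_distrib)
      have "\<sigma> * mpoly_eval q x > 0" if "R \<le> dist z0 x" for x
      proof (rule quadratic_positive_outside_disk[OF R q(1) yb _ _ that])
        show "\<sigma> * mpoly_eval q y < 0" using \<sigma>q[of y] y(3) yb by simp
        fix x assume x: "x \<in> sphere z0 R"
        show "\<sigma> * mpoly_eval q x > 0" using \<sigma>q[of x] f_pos[of x] f_sphere[OF x] x w by simp
      qed
      then have "{x. mpoly_eval q x = 0} = {x\<in>ball z0 R. mpoly_eval q x = 0}"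
        by (force simp: not_less[symmetric])
      then have diff: "diffeotopic_sets {x. mpoly_eval q x = 0} Zf" using q(3) Zf_ball by simp
      have "real (mpoly_degree q) \<le> M2" using q(1) M2 \<kappa>2 by linarith
      then have "real (mpoly_degree q) \<le> Max {1, \<kappa> 2 * (2 * a2),
             (ln (\<kappa> 1) + ln (1 / \<tau>)
                + ln (8 + 8 / (R * exp (- \<tau>)) + 4 * (R * exp (- \<tau>)) + 4 * \<tau>)
                + ln (c1 CARD('n) 0)) / \<tau>}"
        by (intro le_Max_of_le_member[of _ M2]) (auto simp: M2_def)
      \<comment> \<open>The degree is already bounded by \<open>M2\<close>, so any admissible
        \<open>d\<close> may be named; 0 is one.\<close>
      then show ?thesis using diff by (intro exI[of _ 0]) auto
    next
      case False
      then have M2_4: "M2 \<ge> 4" by simp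
      obtain k0 where k0: "real (2 * k0) \<le> M2" "M2 < real (2 * k0) + 2"
        using even_floor_bounds[of M2] M2_4 by auto
      have k0_2: "k0 \<ge> 2" using k0(2) M2_4 by linarith
      define d where "d = real (2 * k0)"
      have d: "d \<ge> 4" "d \<le> M2" "M2 < d + 2" using k0 k0_2 by (auto simp: d_def)
      define e0 where "e0 = M2 * \<delta> / (2 * d\<^sup>2)"
      define e1 where "e1 = M2 * \<delta> / (2 * d)"
      obtain q where q: "mpoly_degree q \<le> 2 * k0"
        "\<And>x. x \<in> ?D \<Longrightarrow> \<bar>mpoly_eval q x - f x\<bar> \<le> e0"
        "\<And>x. x \<in> ?D \<Longrightarrow> norm (mpoly_eval q x - f x, grad ?D (mpoly_eval q) x - grad ?D f x) \<le> e1"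
      proof -
        have "a2 * N / d\<^sup>2 \<le> e0" "a2 * N / d \<le> e1"
          using divide_right_mono[OF aN, of "d\<^sup>2"] divide_right_mono[OF aN, of d] d
          by (simp_all add: e0_def e1_def)
        moreover obtain q where "mpoly_degree q \<le> 2 * k0"
          "\<And>x. x \<in> ?D \<Longrightarrow> \<bar>mpoly_eval q x - f x\<bar> \<le> a2 * N / d\<^sup>2"
          "\<And>x. x \<in> ?D \<Longrightarrow> norm (mpoly_eval q x - f x, grad ?D (mpoly_eval q) x - grad ?D f x) \<le> a2 * N / d"
          using weierstrass_approximation_C1[OF R a2 f, of "2 * k0"] k0_2 unfolding N_def d_def by auto
        ultimately show thesis by (intro that[of q]) (auto intro: order_trans)
      qed
      \<comment> \<open>\<open>M2 < d + 2 <= 3/2 * d\<close> since \<open>d >= 4\<close>. The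
        remaining quarter of \<open>\<delta>\<close> is reserved for the power.\<close>
      have e1: "e1 \<le> 3/4 * \<delta>" "e1 < 3/4 * \<delta>"
      proof -
        have "M2 * \<delta> < (d + 2) * \<delta>" using d \<delta> by (intro mult_strict_right_mono) auto
        also have "\<dots> \<le> (3/2 * d) * \<delta>" using d \<delta> by (intro mult_right_mono) auto
        finally show "e1 < 3/4 * \<delta>" using d by (simp add: e1_def field_simps)
        then show "e1 \<le> 3/4 * \<delta>" by simp
      qed
      \<comment> \<open>By \<open>\<kappa> 2 <= M2 / 2\<close> the product is at most
        \<open>(M2 / d)\<^sup>2 / 4 * \<delta>\<close>, so \<open>M2 / d < 2\<close> is enough.
        Together with \<open>\<delta> <= \<kappa> 2 * delta f z0 r\<close> it gives
        \<open>e0 < delta f z0 r\<close>.\<close>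
      have e0: "e0 < \<delta>" "e0 * \<kappa> 2 < \<delta>"
      proof -
        have "e0 * \<kappa> 2 \<le> e0 * (M2 / 2)" using M2 d \<delta> by (intro mult_left_mono) (auto simp: e0_def)
        also have "\<dots> = (M2 / d)\<^sup>2 / 4 * \<delta>" by (simp add: e0_def power_divide power2_eq_square mult_ac)
        also have "\<dots> < 1 * \<delta>"
        proof (intro mult_strict_right_mono \<delta>)
          have "M2 / d < 2" "0 \<le> M2 / d" using d by (auto simp: field_simps)
          then have "(M2 / d)\<^sup>2 < 2\<^sup>2" by (intro power_strict_mono) auto
          then show "(M2 / d)\<^sup>2 / 4 < 1" by simp
        qed
        finally show "e0 * \<kappa> 2 < \<delta>" by simp
        moreover have "e0 * 1 \<le> e0 * \<kappa> 2" using \<kappa>2 d \<delta> by (intro mult_left_mono) (auto simp: e0_def)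
        ultimately show "e0 < \<delta>" by simp
      qed
      have e0_nn: "e0 \<ge> 0" using d \<delta> by (simp add: e0_def)
      have e0_r: "e0 < delta f z0 r"
      proof -
        note dr = delta_le_cond_number_mult_delta_smaller[OF _ w(3) f \<delta>[unfolded \<delta>_def] nzr, of z1]
        have dr1: "delta f z0 r > 0" "\<delta> \<le> cond_number 2 f z0 r * delta f z0 r"
          using dr w z1 by (auto simp: \<delta>_def)
        have "cond_number 2 f z0 r \<le> \<kappa> 2" using \<kappa>[of 2] by simp
        then have "\<delta> \<le> \<kappa> 2 * delta f z0 r"
          using dr1 by (meson less_imp_le mult_right_mono order_trans)
        then have "e0 * \<kappa> 2 < delta f z0 r * \<kappa> 2" using e0(2) by (simp add: mult.commute)
        then show ?thesis using \<kappa>2 by simp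
      qed
      have near_r: "dist z0 x \<le> r" if "x \<in> ?D" "\<sigma> * f x \<le> e0" for x
      proof (rule ccontr)
        assume "\<not> dist z0 x \<le> r"
        then have x: "r < dist z0 x" "dist z0 x \<le> R" using that by auto
        have "min \<delta> (delta f z0 r) \<le> \<bar>f x\<bar>"
          unfolding \<delta>_def using w x nz by (intro min_delta_le_abs_on_annulus[OF _ w(3) fd]) auto
        then show False using f_pos[of x] x w that(2) e0(1) e0_r by simp
      qed
      \<comment> \<open>\<open>\<kappa> 1 * \<delta>\<close> bounds \<open>f\<close> with its
        gradient, and the error is at most \<open>3/4 * \<delta>\<close>, hence at most
        \<open>3/4 * (\<kappa> 1 * \<delta>)\<close>.\<close>
      define K where "K = 7/4 * (\<kappa> 1 * \<delta>)"
      have K: "norm (mpoly_eval q x, grad ?D (mpoly_eval q) x) \<le> K" if x: "x \<in> ?D" for x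
      proof -
        have "(mpoly_eval q x, grad ?D (mpoly_eval q) x) = (f x, grad ?D f x)
            + (mpoly_eval q x - f x, grad ?D (mpoly_eval q) x - grad ?D f x)" by simp
        then have "norm (mpoly_eval q x, grad ?D (mpoly_eval q) x) \<le> norm (f x, grad ?D f x)
            + norm (mpoly_eval q x - f x, grad ?D (mpoly_eval q) x - grad ?D f x)"
          by (metis norm_triangle_ineq)
        also have "\<dots> \<le> \<kappa> 1 * \<delta> + 3/4 * \<delta>"
          using order_trans[OF norm_le_C_norm[OF f1 x] C1\<kappa>] q(3)[OF x] e1(1) by linarith
        also have "\<dots> \<le> K" using mult_right_mono[OF \<kappa>1, of \<delta>] \<delta> by (simp add: K_def)
        finally show ?thesis .
      qed
      \<comment> \<open>This \<open>d'\<close>, possibly smaller than the even number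
        \<open>2 * k0\<close> and of any parity, is the \<open>d\<close> whose existence is
        claimed.\<close>
      obtain d' where d': "d' \<le> mpoly_degree q"
        "\<And>c x. growth_constant TYPE('n) d' c \<Longrightarrow> R \<le> dist z0 x \<Longrightarrow>
          \<bar>mpoly_eval q x\<bar> \<le> c * K * (dist z0 x / R) ^ d' * (1 + R)"
        using mpoly_growth_outside_disk[OF R K] by blast
      define c where "c = c1 CARD('n) d'"
      have c: "growth_constant TYPE('n) d' c" "c > 0"
        using assms(2)[of d'] by (auto simp: c_def growth_constant_def)
      define \<rho> where "\<rho> = R * exp (- \<tau>)"
      define B where "B = 8 + 8 / \<rho> + 4 * \<rho> + 4 * \<tau>"
      have B: "B > 0" using R \<tau> by (simp add: B_def \<rho>_def add_pos_pos)
      define Th where "Th = (ln (\<kappa> 1) + ln (1 / \<tau>) + ln B + ln c) / \<tau>"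
      define M where "M = Max {1, M2, Th}"
      have M: "M2 \<le> M" "Th \<le> M" by (auto simp: M_def)
      obtain k where k: "real (2 * k) \<le> M" "M < real (2 * k) + 2"
        using even_floor_bounds[of M] M M2_4 by auto
      have k0k: "k0 \<le> k" using k0(1) k(2) M(1) by linarith
      \<comment> \<open>The exponential form of \<open>Th <= M < 2 * k + 2\<close>; the additional 2
        is the loss by rounding.\<close>
      have key: "c * \<kappa> 1 < \<tau> * exp (\<tau> * (real (2 * k) + 2)) / B"
      proof -
        have pos: "0 < \<kappa> 1" "0 < 1 / \<tau>" using \<kappa>1 \<tau> by auto
        then have "ln (\<kappa> 1 * (1 / \<tau>) * B * c) = ln (\<kappa> 1) + ln (1 / \<tau>) + ln B + ln c"
          using B c(2) by (simp only: ln_mult_pos mult_pos_pos)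
        also have "\<dots> = Th * \<tau>" using \<tau> by (simp add: Th_def)
        also have "\<dots> < \<tau> * (real (2 * k) + 2)"
          using M(2) k(2) \<tau> by (simp add: mult.commute)
        finally have "\<kappa> 1 * (1 / \<tau>) * B * c < exp (\<tau> * (real (2 * k) + 2))"
          using \<kappa>1 \<tau> B c(2) by (metis exp_less_cancel_iff exp_ln mult_pos_pos less_le_trans zero_less_one divide_pos_pos)
        then show ?thesis using \<tau> B by (simp add: field_simps)
      qed
      \<comment> \<open>A radius that contains all possible zeros and is small enough for the power:
        \<open>r\<close> from \<open>k = 3\<close> on, and \<open>5/4 * w\<close> for
        \<open>k = 2\<close>.\<close>
      obtain s where s: "s > 0" "\<And>x. x \<in> ?D \<Longrightarrow> \<sigma> * f x \<le> e0 \<Longrightarrow> dist z0 x \<le> s"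
        "7 * \<tau> * exp (\<tau> * (real (2 * k) + 2)) * (1 + R) * ((s / R) ^ (2 * k) * (1 + real (2 * k) / s)) \<le> B"
      proof (cases "k \<ge> 3")
        case True
        have "r / R = exp (- 2 * \<tau>)" using R by (simp add: r)
        then show thesis
          using that[of r] near_r w perturbation_bound_ge_6[OF \<tau> R _ \<rho>_def, of "2 * k"] True
          by (simp add: B_def r)
      next
        case False
        then have k2: "k = 2" "k0 = 2" using k0k k0_2 by auto
        then have M2_6: "M2 < 6" and d4: "d = 4" using k0(2) by (auto simp: d_def)
        \<comment> \<open>Now \<open>\<kappa> 2 < 3\<close>, so the second order estimate gives
          \<open>2 * \<delta> <= 3 * \<delta> * w\<^sup>2\<close>; for \<open>w <= 4/5\<close> the
          right side is at most \<open>1.92 * \<delta>\<close>.\<close>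
        have w8: "w > 4/5"
        proof (rule ccontr)
          assume "\<not> w > 4/5"
          then have "w\<^sup>2 \<le> (4/5)\<^sup>2" using w(1) by (intro power_mono) auto
          have "2 * \<delta> \<le> N * w\<^sup>2"
            unfolding N_def
          proof (rule delta_le_second_order[OF \<sigma>1(2) w(1) _ f _ y])
            show "w < R" using w by simp
            \<comment> \<open>The sign of \<open>f\<close> is known only strictly beyond radius
              \<open>w\<close>; on the sphere itself it follows by a limit along the ray from the
              center.\<close>
            fix x assume x: "dist z0 x = w"
            have xb: "x + 0 *\<^sub>R (x - z0) \<in> ball z0 R" using x w by simp
            have "isCont (\<lambda>t. f (x + t *\<^sub>R (x - z0))) 0"
              by (rule DERIV_isCont[OF GDERIV_along_line[OF GDERIV_grad[OF fd xb]]])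
            then have "((\<lambda>t. \<sigma> * f (x + t *\<^sub>R (x - z0))) \<longlongrightarrow> \<sigma> * f (x + 0 *\<^sub>R (x - z0))) (at_right 0)"
              unfolding isCont_def by (intro tendsto_mult tendsto_const) (auto elim: tendsto_mono[rotated] simp: at_le)
            moreover have "eventually (\<lambda>t. \<sigma> * f (x + t *\<^sub>R (x - z0)) \<ge> 0) (at_right 0)"
            proof -
              have "R / w - 1 > 0" using w by simp
              then have "eventually (\<lambda>t. t \<in> {0<..<R / w - 1}) (at_right 0)"
                by (rule eventually_at_right_real)
              then show ?thesis
              proof eventually_elim
                case (elim t)
                have "dist z0 (x + t *\<^sub>R (x - z0)) = norm ((1 + t) *\<^sub>R (x - z0))"
                  unfolding dist_norm by (subst norm_minus_commute) (simp add: algebra_simps)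
                also have "\<dots> = (1 + t) * w" using x elim by (simp add: dist_norm norm_minus_commute)
                finally have "w < dist z0 (x + t *\<^sub>R (x - z0))" "dist z0 (x + t *\<^sub>R (x - z0)) \<le> R"
                  using elim w by (auto simp: field_simps)
                then show ?case using \<sigma>(2) less_imp_le by blast
              qed
            qed
            ultimately show "\<sigma> * f x \<ge> 0" using tendsto_lowerbound by fastforce
          qed
          also have "\<dots> \<le> (3 * \<delta>) * (4/5)\<^sup>2"
          proof (intro mult_mono)
            have "\<kappa> 2 * \<delta> \<le> 3 * \<delta>" using M2 M2_6 \<delta> by (intro mult_right_mono) auto
            then show "N \<le> 3 * \<delta>" using N\<kappa> by simp
          qed (use \<open>w\<^sup>2 \<le> (4/5)\<^sup>2\<close> \<delta> in auto)
          finally show False using \<delta> by (simp add: power2_eq_square)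
        qed
        have e0_small: "e0 < 3/16 * \<delta>" using M2_6 \<delta> by (simp add: e0_def d4)
        show thesis
        proof (rule that[of "5/4 * w"])
          show "5/4 * w > 0" using w by simp
          show "7 * \<tau> * exp (\<tau> * (real (2 * k) + 2)) * (1 + R)
              * ((5/4 * w / R) ^ (2 * k) * (1 + real (2 * k) / (5/4 * w))) \<le> B"
            using perturbation_bound_4[OF \<tau> R \<rho>_def w_def] by (simp add: B_def k2)
          fix x assume x: "x \<in> ?D" "\<sigma> * f x \<le> e0"
          show "dist z0 x \<le> 5/4 * w"
          proof (cases "dist z0 x \<le> w")
            case False
            then have fx: "\<bar>f x\<bar> \<le> e0" using f_pos[of x] x by simp
            \<comment> \<open>The slope \<open>49/50 * \<delta>\<close> is admissible because the
              squares of \<open>3/16\<close> and \<open>49/50\<close> add up to less than 1. It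
              yields a zero at distance below \<open>(3/16) / (49/50) < 1/5\<close>, and
              \<open>1/5 < w / 4\<close> by the bound on \<open>w\<close>.\<close>
            have "e0\<^sup>2 \<le> (3/16 * \<delta>)\<^sup>2" using e0_small e0_nn by (intro power_mono) auto
            then have "e0\<^sup>2 + (49/50 * \<delta>)\<^sup>2 \<le> ((3/16)\<^sup>2 + (49/50)\<^sup>2) * \<delta>\<^sup>2"
              unfolding power_mult_distrib distrib_right by linarith
            also have "\<dots> < 1 * \<delta>\<^sup>2" using \<delta> by (intro mult_strict_right_mono) (auto simp: power2_eq_square)
            finally have "e0\<^sup>2 + (49/50 * \<delta>)\<^sup>2 < (delta f z0 R)\<^sup>2" by (simp add: \<delta>_def)
            then obtain v where v: "v \<in> ?D" "f v = 0" "49/50 * \<delta> * dist x v \<le> e0"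
              using zero_near_small_value[OF R fd nzR x(1) fx, of "49/50 * \<delta>"] \<delta> by (auto simp: \<delta>_def)
            have "49/50 * \<delta> * dist x v < 49/50 * \<delta> * (1/5)" using v(3) e0_small \<delta> by linarith
            then have "dist x v < 1/5" using \<delta> by (subst (asm) mult_less_cancel_left_pos) auto
            then show ?thesis
              using zeros[OF v(1,2)] dist_triangle[of z0 x v] w8 by (simp add: dist_commute)
          qed (use w in simp)
        qed
      qed
      define A0 where "A0 = c * K * (1 + R)"
      have A0: "A0 \<ge> 0" using c(2) \<kappa>1 \<delta> R by (simp add: A0_def K_def)
      define H where "H = (s / R) ^ (2 * k) * (1 + real (2 * k) / s)"
      have H: "H > 0" using s(1) R by (simp add: H_def add_pos_nonneg)
      \<comment> \<open>Writing \<open>7/4\<close> as a quarter of 7 matches the factor 7 of the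
        numerical estimates, and the power uses at most the reserved
        \<open>\<delta> / 4\<close>.\<close>
      have "A0 * H + e1 < \<delta>"
      proof -
        have "A0 * H = 1/4 * \<delta> * (7 * (c * \<kappa> 1) * (1 + R) * H)" by (simp add: A0_def K_def)
        also have "\<dots> \<le> 1/4 * \<delta> * (7 * (\<tau> * exp (\<tau> * (real (2 * k) + 2)) / B) * (1 + R) * H)"
          using key \<delta> R H by (intro mult_left_mono mult_right_mono) auto
        also have "\<dots> = 1/4 * \<delta> * ((7 * \<tau> * exp (\<tau> * (real (2 * k) + 2)) * (1 + R) * H) / B)"
          by (simp add: mult_ac)
        also have "\<dots> \<le> 1/4 * \<delta> * 1"
          using s(3) B \<delta> unfolding H_def by (intro mult_left_mono) (auto simp: divide_le_eq_1)
        finally show ?thesis using e1(2) by simp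
      qed
      moreover have "\<bar>mpoly_eval q x\<bar> \<le> A0 * (dist z0 x / R) ^ (2 * k)" if x: "R \<le> dist z0 x" for x
      proof -
        have "\<bar>mpoly_eval q x\<bar> \<le> A0 * (dist z0 x / R) ^ d'"
          using d'(2)[OF c(1) x] by (simp add: A0_def mult_ac)
        also have "\<dots> \<le> A0 * (dist z0 x / R) ^ (2 * k)"
          using d'(1) q(1) k0k x R A0 by (intro mult_left_mono power_increasing) auto
        finally show ?thesis .
      qed
      ultimately obtain p where p: "mpoly_degree p \<le> max (mpoly_degree q) (2 * k)"
        "diffeotopic_sets {x. mpoly_eval p x = 0} {x\<in>ball z0 R. f x = 0}"
        using perturbed_polynomial_diffeotopic[OF R f \<sigma>(1) q(2,3) _ w(3) s(1) _ A0, of k] near_r s(2) k0k k0_2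
        unfolding H_def \<delta>_def by auto
      have "mpoly_degree p \<le> 2 * k" using p(1) q(1) k0k by simp
      then have "real (mpoly_degree p) \<le> M" using k(1) by (meson of_nat_mono order_trans)
      moreover have "real d' \<le> M2" using d'(1) q(1) k0(1) by (meson of_nat_mono order_trans)
      ultimately show ?thesis using p(2)
        unfolding M_def Th_def B_def \<rho>_def c_def M2_def Zf_ball by (intro exI[of _ d']) auto
    qed
  qed
qed

end
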